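(* For any $k, m \in \mathbb{N}$ with $k \leq m$, any $\alpha \in (0,1]$, and any $\varepsilon > 1/n$, there is an $\varepsilon$-differentially private sanitizer $\mathcal{A}$ (together with an evaluator $\mathcal{E}$) with running time $m^{\tilde{O}(\sqrt{k}\log(1/\alpha))}$ such that, on input a database $D \in (\mathrm{DL}_{k,m})^n$, provided that $|D| \geq m^{\tilde{O}(\sqrt{k}\log(1/\alpha))}/\varepsilon$, with probability at least $9/10$ over the coins of $\mathcal{A}$ the summary $Z = \mathcal{A}(D)$ satisfies $|\mathcal{E}(Z,y) - q_y(D)| \leq \alpha$ simultaneously for every $y \in \{0,1\}^m$.
   Context: A length-$k$ decision list over $m$ variables is a function $\{0,1\}^m\to\{0,1\}$ of the form "if $\ell_1$ then output $b_1$ else $\cdots$ else if $\ell_k$ then output $b_k$ else output $b_{k+1}$", where each $\ell_i$ is a literal (a variable $y_j$ or its negation) and each $b_i \in \{0,1\}$; $\mathrm{DL}_{k,m}$ denotes the set of all such decision lists. A database $D \in (\mathrm{DL}_{k,m})^n$ is a list of $n$ rows $x^{(1)},\dots,x^{(n)} \in \mathrm{DL}_{k,m}$; two databases are adjacent if they differ in exactly one row. For $y \in \{0,1\}^m$ the query $q_y$ has value $q_y(D) = \frac1n \sum_{i=1}^n x^{(i)}(y)$. A sanitizer $\mathcal{A}$ is a randomized map from databases to outputs in a set $\mathcal{R}$; it is $\varepsilon$-differentially private if for all adjacent $D,D'$ and measurable $S\subseteq\mathcal{R}$, $\Pr[\mathcal{A}(D)\in S]\le e^{\varepsilon}\Pr[\mathcal{A}(D')\in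 S]$. Answers are computed by a deterministic evaluator $\mathcal{E}$, whose running time is counted. $\tilde{O}(\cdot)$ hides polylogarithmic factors.
   Formalization: k is at least 1, the base m is replaced by max(2,m), and running time is up to a constant factor: for m = 1 or k = 0 the size condition would read |D| ≥ 1/ε, which cannot give accuracy α for small α. *)

theory Defs
  imports "HOL-Probability.Probability"
begin

section \<open>Decision lists\<close>

definition cube :: "nat \<Rightarrow> bool list set" where
  "cube m = {y. length y = m}"

text \<open>The literal with index \<open>j\<close> is the \<open>j\<close>-th variable, counted from 0, or its negation.\<close>

datatype dl_literal = Pos nat | Neg nat

primrec lit_var :: "dl_literal \<Rightarrow> nat" where
  "lit_var (Pos j) = j"
| "lit_var (Neg j) = j"

primrec lit_true :: "dl_literal \<Rightarrow> bool list \<Rightarrow> bool" where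
  "lit_true (Pos j) y \<longleftrightarrow> y ! j"
| "lit_true (Neg j) y \<longleftrightarrow> \<not> y ! j"

datatype decision_list = Output bool | IfElse dl_literal bool decision_list

primrec dl_wf :: "nat \<Rightarrow> decision_list \<Rightarrow> bool" where
  "dl_wf m (Output b) \<longleftrightarrow> True"
| "dl_wf m (IfElse l b d) \<longleftrightarrow> lit_var l < m \<and> dl_wf m d"

primrec dl_length :: "decision_list \<Rightarrow> nat" where
  "dl_length (Output b) = 0"
| "dl_length (IfElse l b d) = Suc (dl_length d)"

primrec dl_eval :: "decision_list \<Rightarrow> bool list \<Rightarrow> bool" where
  "dl_eval (Output b) y = b"
| "dl_eval (IfElse l b d) y = (if lit_true l y then b else dl_eval d y)"

definition dl_fun :: "nat \<Rightarrow> decision_list \<Rightarrow> bool list \<Rightarrow> bool" where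
  "dl_fun m d = restrict (dl_eval d) (cube m)"

definition DL :: "nat \<Rightarrow> nat \<Rightarrow> (bool list \<Rightarrow> bool) set" where
  "DL k m = {dl_fun m d | d. dl_length d = k \<and> dl_wf m d}"

text \<open>
  The elements of \<open>DL k m\<close> are functions. An algorithm reads each of them through a
  syntactic decision list that computes it, chosen by an encoding.
\<close>

definition dl_encoding :: "nat \<Rightarrow> nat \<Rightarrow> ((bool list \<Rightarrow> bool) \<Rightarrow> decision_list) \<Rightarrow> bool" where
  "dl_encoding k m enc \<longleftrightarrow>
     (\<forall>f\<in>DL k m. dl_length (enc f) = k \<and> dl_wf m (enc f) \<and> dl_fun m (enc f) = f)"

primrec lit_code :: "dl_literal \<Rightarrow> int" where
  "lit_code (Pos j) = 2 * int j"
| "lit_code (Neg j) = 2 * int j + 1"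

primrec dl_word :: "decision_list \<Rightarrow> int list" where
  "dl_word (Output b) = [of_bool b]"
| "dl_word (IfElse l b d) = lit_code l # of_bool b # dl_word d"


section \<open>Databases, queries, differential privacy\<close>

definition databases :: "'x set \<Rightarrow> nat \<Rightarrow> 'x list set" where
  "databases X n = {D. length D = n \<and> set D \<subseteq> X}"

definition adjacent :: "'x list \<Rightarrow> 'x list \<Rightarrow> bool" where
  "adjacent D D' \<longleftrightarrow> length D = length D' \<and> card {i. i < length D \<and> D ! i \<noteq> D' ! i} = 1"

definition query :: "bool list \<Rightarrow> (bool list \<Rightarrow> bool) list \<Rightarrow> real" where
  "query y D = (\<Sum>i<length D. of_bool ((D ! i) y)) / real (length D)"

text \<open>Outputs are discrete, so every set of outputs is measurable.\<close>

definition diff_private :: "real \<Rightarrow> 'x list set \<Rightarrow> ('x list \<Rightarrow> 'r pmf) \<Rightarrow> bool" where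
  "diff_private \<epsilon> \<D> A \<longleftrightarrow>
     (\<forall>D\<in>\<D>. \<forall>D'\<in>\<D>. adjacent D D' \<longrightarrow>
        (\<forall>S. measure_pmf.prob (A D) S \<le> exp \<epsilon> * measure_pmf.prob (A D') S))"


section \<open>Randomized random access machines\<close>

text \<open>
  Running time is the number of steps of a unit-cost random access machine over the integers.
  A machine has finitely many integer variables, finitely many unbounded arrays, random access
  to a read-only table of integers, and an append-only output. Its arithmetic is addition and
  subtraction only: without multiplication the bit length of the numbers grows by \<open>O(1)\<close> per
  step, so that unit cost is not a hidden source of computing power. Expressions are evaluated
  in one step, which for a fixed program costs only a constant factor. A draw returns a uniform
  element of \<open>{0..<a}\<close>.

  Real parameters are not stored in registers. A machine can only compare them with ratios of
  integers that it has computed.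
\<close>

record ram_input =
  int_pars :: "int list"
  real_pars :: "real list"
  table :: "int list list"

record ram_state =
  var :: "nat \<Rightarrow> int"
  cell :: "nat \<Rightarrow> int \<Rightarrow> int"
  out :: "int list"

definition fetch :: "'b \<Rightarrow> 'b list \<Rightarrow> int \<Rightarrow> 'b" where
  "fetch z xs i = (if 0 \<le> i \<and> nat i < length xs then xs ! nat i else z)"

datatype aexp =
    Num int
  | Var nat
  | Cell nat aexp
  | Par nat
  | Table aexp aexp
  | Plus aexp aexp
  | Minus aexp aexp

datatype bexp =
    Leq aexp aexp
  | RealLeq aexp nat aexp
  | BNot bexp
  | BAnd bexp bexp

datatype com =
    Skip
  | Assign nat aexp
  | Write nat aexp aexp
  | Draw nat aexp
  | Emit aexp
  | Semi com com
  | Cond bexp com com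
  | While bexp com

primrec aval :: "ram_input \<Rightarrow> ram_state \<Rightarrow> aexp \<Rightarrow> int" where
  "aval I s (Num c) = c"
| "aval I s (Var x) = var s x"
| "aval I s (Cell a e) = cell s a (aval I s e)"
| "aval I s (Par i) = fetch 0 (int_pars I) (int i)"
| "aval I s (Table e1 e2) = fetch 0 (fetch [] (table I) (aval I s e1)) (aval I s e2)"
| "aval I s (Plus e1 e2) = aval I s e1 + aval I s e2"
| "aval I s (Minus e1 e2) = aval I s e1 - aval I s e2"

primrec bval :: "ram_input \<Rightarrow> ram_state \<Rightarrow> bexp \<Rightarrow> bool" where
  "bval I s (Leq e1 e2) \<longleftrightarrow> aval I s e1 \<le> aval I s e2"
| "bval I s (RealLeq e1 i e2) \<longleftrightarrow>
     real_of_int (aval I s e1) \<le> fetch 0 (real_pars I) (int i) * real_of_int (aval I s e2)"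
| "bval I s (BNot b) \<longleftrightarrow> \<not> bval I s b"
| "bval I s (BAnd b1 b2) \<longleftrightarrow> bval I s b1 \<and> bval I s b2"

text \<open>
  A configuration consists of a stack of commands still to be executed and a state. The machine
  has halted when the stack is empty.
\<close>

type_synonym config = "com list \<times> ram_state"

primrec step_com :: "ram_input \<Rightarrow> com list \<Rightarrow> ram_state \<Rightarrow> com \<Rightarrow> config pmf" where
  "step_com I cs s Skip = return_pmf (cs, s)"
| "step_com I cs s (Assign x e) =
     return_pmf (cs, s\<lparr>var := (var s)(x := aval I s e)\<rparr>)"
| "step_com I cs s (Write a e1 e2) =
     return_pmf (cs, s\<lparr>cell := (cell s)(a := (cell s a)(aval I s e1 := aval I s e2))\<rparr>)"
| "step_com I cs s (Draw x e) =
     map_pmf (\<lambda>r. (cs, s\<lparr>var := (var s)(x := r)\<rparr>)) (pmf_of_set {0..<max 1 (aval I s e)})"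
| "step_com I cs s (Emit e) = return_pmf (cs, s\<lparr>out := out s @ [aval I s e]\<rparr>)"
| "step_com I cs s (Semi c1 c2) = return_pmf (c1 # c2 # cs, s)"
| "step_com I cs s (Cond b c1 c2) = return_pmf ((if bval I s b then c1 else c2) # cs, s)"
| "step_com I cs s (While b c) =
     return_pmf (if bval I s b then c # While b c # cs else cs, s)"

fun step :: "ram_input \<Rightarrow> config \<Rightarrow> config pmf" where
  "step I ([], s) = return_pmf ([], s)"
| "step I (c # cs, s) = step_com I cs s c"

primrec steps :: "ram_input \<Rightarrow> nat \<Rightarrow> config \<Rightarrow> config pmf" where
  "steps I 0 cf = return_pmf cf"
| "steps I (Suc t) cf = bind_pmf (step I cf) (steps I t)"

definition init_config :: "com \<Rightarrow> config" where
  "init_config p = ([p], \<lparr>var = (\<lambda>_. 0), cell = (\<lambda>_ _. 0), out = []\<rparr>)"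

definition halts_in :: "com \<Rightarrow> ram_input \<Rightarrow> nat \<Rightarrow> bool" where
  "halts_in p I t \<longleftrightarrow> (\<forall>cf\<in>set_pmf (steps I t (init_config p)). fst cf = [])"

text \<open>The time bound holds for every outcome of the coins.\<close>

definition runs_within :: "com \<Rightarrow> ram_input \<Rightarrow> real \<Rightarrow> bool" where
  "runs_within p I T \<longleftrightarrow> (\<exists>t. real t \<le> T \<and> halts_in p I t)"

definition ram_output :: "com \<Rightarrow> ram_input \<Rightarrow> int list pmf" where
  "ram_output p I =
     map_pmf (\<lambda>cf. out (snd cf)) (steps I (LEAST t. halts_in p I t) (init_config p))"

primrec draw_free :: "com \<Rightarrow> bool" where
  "draw_free Skip \<longleftrightarrow> True"
| "draw_free (Assign x e) \<longleftrightarrow> True"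
| "draw_free (Write a e1 e2) \<longleftrightarrow> True"
| "draw_free (Draw x e) \<longleftrightarrow> False"
| "draw_free (Emit e) \<longleftrightarrow> True"
| "draw_free (Semi c1 c2) \<longleftrightarrow> draw_free c1 \<and> draw_free c2"
| "draw_free (Cond b c1 c2) \<longleftrightarrow> draw_free c1 \<and> draw_free c2"
| "draw_free (While b c) \<longleftrightarrow> draw_free c"

lemma steps_halted: "steps I t ([], s) = return_pmf ([], s)"
  by (induction t) (simp_all add: bind_return_pmf)

lemma steps_add: "steps I (t + u) cf = bind_pmf (steps I t cf) (steps I u)"
  by (induction t arbitrary: cf) (simp_all add: bind_return_pmf bind_assoc_pmf cong: bind_pmf_cong)

lemma ram_output_eq:
  assumes "halts_in p I t"
  shows "ram_output p I = map_pmf (\<lambda>cf. out (snd cf)) (steps I t (init_config p))"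
proof -
  define l where "l = (LEAST t. halts_in p I t)"
  have l: "halts_in p I l" "l \<le> t"
    unfolding l_def using assms by (auto intro: LeastI Least_le)
  have "steps I t (init_config p) = bind_pmf (steps I l (init_config p)) (steps I (t - l))"
    using steps_add[of I l "t - l"] l(2) by simp
  also have "\<dots> = bind_pmf (steps I l (init_config p)) return_pmf"
  proof (intro bind_pmf_cong refl)
    fix cf assume "cf \<in> set_pmf (steps I l (init_config p))"
    with l(1) have "cf = ([], snd cf)"
      by (cases cf) (auto simp: halts_in_def)
    then show "steps I (t - l) cf = return_pmf cf"
      by (metis steps_halted)
  qed
  finally show ?thesis
    by (simp add: ram_output_def l_def bind_return_pmf')
qed

lemma draw_free_step:
  assumes "list_all draw_free (fst cf)"
  shows "\<exists>cf'. step I cf = return_pmf cf' \<and> list_all draw_free (fst cf')"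
proof (cases cf)
  case (Pair cs s)
  show ?thesis
  proof (cases cs)
    case (Cons c cs')
    with Pair assms show ?thesis by (cases c) auto
  qed (use Pair in auto)
qed

lemma draw_free_steps:
  "list_all draw_free (fst cf) \<Longrightarrow> \<exists>cf'. steps I t cf = return_pmf cf'"
proof (induction t arbitrary: cf)
  case (Suc t)
  from draw_free_step[OF Suc.prems, of I] Suc.IH show ?case
    by (auto simp: bind_return_pmf)
qed auto

lemma draw_free_output: "draw_free p \<Longrightarrow> \<exists>zs. ram_output p I = return_pmf zs"
  using draw_free_steps[of "init_config p" I "LEAST t. halts_in p I t"]
  by (auto simp: ram_output_def init_config_def)

text \<open>The output of a program without draws, read as a ratio of two integers.\<close>

definition ram_answer :: "com \<Rightarrow> ram_input \<Rightarrow> real" where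
  "ram_answer p I =
     (let zs = the_elem (set_pmf (ram_output p I))
      in real_of_int (fetch 0 zs 0) / real_of_int (fetch 0 zs 1))"


section \<open>Sanitizers and evaluators as programs\<close>

definition sanitizer_input ::
    "nat \<Rightarrow> nat \<Rightarrow> nat \<Rightarrow> real \<Rightarrow> real \<Rightarrow> ((bool list \<Rightarrow> bool) \<Rightarrow> decision_list) \<Rightarrow>
     (bool list \<Rightarrow> bool) list \<Rightarrow> ram_input" where
  "sanitizer_input k m n \<alpha> \<epsilon> enc D =
     \<lparr>int_pars = [int k, int m, int n], real_pars = [\<alpha>, \<epsilon>],
      table = map (\<lambda>x. dl_word (enc x)) D\<rparr>"

definition evaluator_input ::
    "nat \<Rightarrow> nat \<Rightarrow> nat \<Rightarrow> real \<Rightarrow> real \<Rightarrow> int list \<Rightarrow> bool list \<Rightarrow> ram_input" where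
  "evaluator_input k m n \<alpha> \<epsilon> Z y =
     \<lparr>int_pars = [int k, int m, int n], real_pars = [\<alpha>, \<epsilon>], table = [Z, map of_bool y]\<rparr>"


section \<open>Soft-O\<close>

text \<open>
  The bound is uniform on \<open>P\<close>. The polylogarithmic factor is taken in \<open>g\<close> itself; the two
  added ones keep it away from 0 where \<open>g\<close> is small.
\<close>

definition soft_O :: "'a set \<Rightarrow> ('a \<Rightarrow> real) \<Rightarrow> ('a \<Rightarrow> real) set" where
  "soft_O P g = {f. \<exists>C (c::nat). \<forall>p\<in>P. \<bar>f p\<bar> \<le> C * (\<bar>g p\<bar> * (1 + ln (1 + \<bar>g p\<bar>)) ^ c)}"

end

theory Submission
  imports Defs
begin

text \<open>
  A decision list is \<open>\<Sum>\<^sub>j (b_j - b_(j-1)) A_j\<close>, where \<open>A_j\<close> is the conjunction of its first \<open>j\<close> negated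
  literals. If \<open>u \<in> [0, 1]\<close> is one more than the number of satisfied conjuncts, divided by \<open>j + 1\<close>,
  then \<open>u = 1\<close> or \<open>u \<le> 1 - 1 / (k + 1)\<close>, so \<open>A_j\<close> is close to \<open>u^w\<close> for \<open>w\<close> about \<open>k log (k / \<alpha>)\<close>. The
  power \<open>u^w\<close> is the expectation of \<open>T_X(u)\<close> for a random walk \<open>X\<close> of \<open>w\<close> steps and Chebyshev polynomials
  \<open>T\<close>. With high probability \<open>\<bar>X\<bar>\<close> is at
  most \<open>d\<close>, about \<open>sqrt k log (k / \<alpha>)\<close>. Unfolding the
  recursion of \<open>T\<close> at random yields a signed conjunction of at most \<open>d\<close> literals whose mean is, up to
  the factor \<open>3^d\<close>, the value of the approximating polynomial.

  A trial draws a random row and such a conjunction for it or, with probability 1/2, a uniformly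
  random signed conjunction, which has mean 0. The latter bounds all probabilities from below, so the
  law of a trial changes by a factor of at most \<open>1 + 3 (2 m + 1)^d / n\<close> between adjacent databases. The
  summary consists of \<open>m^O(d)\<close> independent trials, and is published only if the resulting privacy loss
  is at most \<open>\<epsilon>\<close>. It is accurate by Hoeffding's inequality and a union bound over the queries. For
  \<open>\<alpha> \<ge> 1/2\<close> the constant answer 1/2 suffices.
\<close>

section \<open>Programs that sample from a distribution\<close>

text \<open>A noisy table of polynomial coefficients would require real-valued noise and
  multiplication, whereas the machine has uniform integer draws, addition and comparisons with real
  parameters. Sampling signed conjunctions keeps the summary a list of small integers. Every trial
  has the same shape, \<open>d\<close> tokens and a sign, even if the walk is cut off or the
  recursion ends early: missing factors are padded by a true token and a cut-off walk gets sign 0.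
  Hence uniform noise of this shape covers every outcome, the scale \<open>3 ^ d\<close> is the same
  everywhere, and time is bounded for all coins. As a trial reads one random row, time does not
  depend on \<open>n\<close>. The privacy test looks at the parameters only, so its outcome reveals
  nothing about the rows. The degree contains log (k / \<alpha>), the claim only log (1 / \<alpha>).
  The surplus log k is logarithmic in the bound itself, which soft-O permits, provided that log (1 /
  \<alpha>) stays away from 0. This is why \<alpha> \<ge> 1/2 is treated separately.\<close>

text \<open>
  The abstract outcome \<open>v\<close>, distributed according to \<open>p\<close>, is coupled with the final machine state. The
  coupling spares a description of the law of the registers. The second component of \<open>q\<close> is the
  number of steps used, which differs between the outcomes of the coins.
\<close>

definition implements ::
    "ram_input \<Rightarrow> com \<Rightarrow> ram_state \<Rightarrow> nat \<Rightarrow> 'a pmf \<Rightarrow> ('a \<Rightarrow> ram_state \<Rightarrow> bool) \<Rightarrow> bool" where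
  "implements I c s t p Q \<longleftrightarrow>
     (\<exists>q. rel_pmf (\<lambda>v st. Q v (fst st) \<and> snd st \<le> t) p q \<and>
        (\<forall>cs u. steps I (t + u) (c # cs, s) =
           bind_pmf q (\<lambda>st. steps I (t + u - snd st) (cs, fst st))))"

lemma implements_mono:
  assumes "implements I c s t p Q" "t \<le> t'" "\<And>v s'. v \<in> set_pmf p \<Longrightarrow> Q v s' \<Longrightarrow> Q' v s'"
  shows "implements I c s t' p Q'"
proof -
  from assms(1) obtain q where q: "rel_pmf (\<lambda>v st. Q v (fst st) \<and> snd st \<le> t) p q"
    "\<And>cs u. steps I (t + u) (c # cs, s) = bind_pmf q (\<lambda>st. steps I (t + u - snd st) (cs, fst st))"
    unfolding implements_def by blast
  have "rel_pmf (\<lambda>v st. Q' v (fst st) \<and> snd st \<le> t') p q"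
    using q(1) by (rule pmf.rel_mono_strong) (use assms(2,3) in auto)
  moreover have "steps I (t' + u) (c # cs, s) = bind_pmf q (\<lambda>st. steps I (t' + u - snd st) (cs, fst st))" for cs u
    using q(2)[of "t' - t + u" cs] assms(2) by (simp add: add.assoc[symmetric])
  ultimately show ?thesis
    unfolding implements_def by blast
qed

lemma implements_det:
  assumes "\<And>cs. step_com I cs s c = return_pmf (cs, s')" "Q v s'"
  shows "implements I c s 1 (return_pmf v) Q"
  unfolding implements_def
  by (intro exI[of _ "return_pmf (s', 1)"]) (use assms in \<open>simp add: bind_return_pmf\<close>)

text \<open>Both \<open>Semi\<close> and a round of \<open>While\<close> replace one command on the
  stack by two, so this serves both. A coupling may relate \<open>v\<close> to several machine
  states. The concrete law of the second phase is therefore chosen per pair \<open>(v, st)\<close>,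
  while the abstract continuation sees \<open>v\<close> alone.\<close>

lemma implements_compose:
  assumes step: "\<And>cs. step_com I cs s c = return_pmf (c1 # c2 # cs, s)"
    and 1: "implements I c1 s t1 p Q1"
    and 2: "\<And>v s'. v \<in> set_pmf p \<Longrightarrow> Q1 v s' \<Longrightarrow> implements I c2 s' t2 (f v) Q2"
  shows "implements I c s (t1 + t2 + 1) (bind_pmf p f) Q2"
proof -
  let ?R = "\<lambda>t Q v (st :: ram_state \<times> nat). Q v (fst st) \<and> snd st \<le> t"
  from 1 obtain q1 where rel1: "rel_pmf (?R t1 Q1) p q1"
    and q1: "\<And>cs u. steps I (t1 + u) (c1 # cs, s) = bind_pmf q1 (\<lambda>st. steps I (t1 + u - snd st) (cs, fst st))"
    unfolding implements_def by blast
  from rel1 obtain pq where pq: "\<And>v st. (v, st) \<in> set_pmf pq \<Longrightarrow> ?R t1 Q1 v st"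
    "map_pmf fst pq = p" "map_pmf snd pq = q1"
    by (auto elim!: rel_pmf.cases)
  let ?P = "\<lambda>v st q. rel_pmf (?R t2 Q2) (f v) q \<and>
     (\<forall>cs u. steps I (t2 + u) (c2 # cs, fst st) = bind_pmf q (\<lambda>st. steps I (t2 + u - snd st) (cs, fst st)))"
  define q2 where "q2 v st = (SOME q. ?P v st q)" for v and st :: "ram_state \<times> nat"
  have q2_props: "?P v st (q2 v st)" if "(v, st) \<in> set_pmf pq" for v st
  proof -
    have "v \<in> set_pmf p" using that unfolding pq(2)[symmetric] by force
    then have "implements I c2 (fst st) t2 (f v) Q2"
      using 2 pq(1)[OF that] by simp
    then have "\<exists>q. ?P v st q" unfolding implements_def .
    then show ?thesis unfolding q2_def by (rule someI_ex)
  qed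
  note rel2 = conjunct1[OF q2_props] and q2 = conjunct2[OF q2_props, rule_format]
  define q where "q = bind_pmf pq (\<lambda>(v, st). map_pmf (\<lambda>st'. (fst st', 1 + snd st + snd st')) (q2 v st))"
  have "rel_pmf (?R (t1 + t2 + 1) Q2) (bind_pmf p f) q"
  proof -
    have "bind_pmf p f = bind_pmf pq (\<lambda>x. f (fst x))"
      unfolding pq(2)[symmetric] by (simp add: bind_map_pmf)
    moreover have "rel_pmf (?R (t1 + t2 + 1) Q2) (bind_pmf pq (\<lambda>x. f (fst x))) q"
      unfolding q_def
    proof (rule rel_pmf_bindI[where R = "\<lambda>x y. x = y \<and> x \<in> set_pmf pq"])
      show "rel_pmf (\<lambda>x y. x = y \<and> x \<in> set_pmf pq) pq pq"
        by (rule rel_pmf_reflI) simp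
      fix x y assume "x = y \<and> x \<in> set_pmf pq"
      then obtain v st where x: "x = (v, st)" "y = (v, st)" "(v, st) \<in> set_pmf pq"
        by (cases x) auto
      show "rel_pmf (?R (t1 + t2 + 1) Q2) (f (fst x))
        (case y of (v, st) \<Rightarrow> map_pmf (\<lambda>st'. (fst st', 1 + snd st + snd st')) (q2 v st))"
        using pq(1)[OF x(3)] unfolding x
        by (auto simp: pmf.rel_map intro: pmf.rel_mono_strong[OF rel2[OF x(3)]])
    qed
    ultimately show ?thesis by simp
  qed
  moreover have "steps I (t1 + t2 + 1 + u) (c # cs, s) =
      bind_pmf q (\<lambda>st. steps I (t1 + t2 + 1 + u - snd st) (cs, fst st))" for cs u
  proof -
    have "steps I (t1 + t2 + 1 + u) (c # cs, s) = steps I (t1 + (t2 + u)) (c1 # c2 # cs, s)"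
      by (simp add: step bind_return_pmf add.assoc)
    also have "\<dots> = bind_pmf q1 (\<lambda>st. steps I (t1 + (t2 + u) - snd st) (c2 # cs, fst st))"
      by (rule q1)
    also have "\<dots> = bind_pmf pq (\<lambda>x. steps I (t1 + (t2 + u) - snd (snd x)) (c2 # cs, fst (snd x)))"
      unfolding pq(3)[symmetric] by (simp add: bind_map_pmf)
    also have "\<dots> = bind_pmf q (\<lambda>st. steps I (t1 + t2 + 1 + u - snd st) (cs, fst st))"
      unfolding q_def bind_assoc_pmf
    proof (intro bind_pmf_cong refl)
      fix x assume x: "x \<in> set_pmf pq"
      obtain v s1 \<tau> where [simp]: "x = (v, s1, \<tau>)" by (cases x)
      have le: "\<tau> \<le> t1" using pq(1)[of v "(s1, \<tau>)"] x by simp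
      then have "t1 + (t2 + u) - \<tau> = t2 + (t1 - \<tau> + u)" by simp
      then show "steps I (t1 + (t2 + u) - snd (snd x)) (c2 # cs, fst (snd x)) =
        bind_pmf (case x of (v, st) \<Rightarrow> map_pmf (\<lambda>st'. (fst st', 1 + snd st + snd st')) (q2 v st))
          (\<lambda>st. steps I (t1 + t2 + 1 + u - snd st) (cs, fst st))"
        using q2[of v "(s1, \<tau>)" "t1 - \<tau> + u" cs] x le
        by (simp add: bind_map_pmf algebra_simps)
    qed
    finally show ?thesis .
  qed
  ultimately show ?thesis
    unfolding implements_def by blast
qed

section \<open>Proof rules for the single commands\<close>

notation Semi (infixr ";;" 60)

lemma implements_Semi:
  assumes "implements I c1 s t1 p Q1"
    and "\<And>v s'. v \<in> set_pmf p \<Longrightarrow> Q1 v s' \<Longrightarrow> implements I c2 s' t2 (f v) Q2"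
  shows "implements I (c1 ;; c2) s (t1 + t2 + 1) (bind_pmf p f) Q2"
  by (rule implements_compose[OF _ assms]) auto

lemma implements_Semi_det:
  assumes "implements I c1 s t1 (return_pmf v) Q1"
    and "\<And>s'. Q1 v s' \<Longrightarrow> implements I c2 s' t2 p Q2"
  shows "implements I (c1 ;; c2) s (t1 + t2 + 1) p Q2"
  using implements_Semi[OF assms(1), of c2 t2 "\<lambda>_. p" Q2] assms(2)
  by (auto simp: bind_return_pmf)

lemma implements_Skip: "Q v s \<Longrightarrow> implements I Skip s 1 (return_pmf v) Q"
  by (rule implements_det) auto

lemma implements_Assign:
  "Q v (s\<lparr>var := (var s)(x := aval I s e)\<rparr>) \<Longrightarrow> implements I (Assign x e) s 1 (return_pmf v) Q"
  by (rule implements_det) auto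

lemma implements_Emit:
  "Q v (s\<lparr>out := out s @ [aval I s e]\<rparr>) \<Longrightarrow> implements I (Emit e) s 1 (return_pmf v) Q"
  by (rule implements_det) auto

definition draw :: "int \<Rightarrow> int pmf" where
  "draw a = pmf_of_set {0..<max 1 a}"

lemma set_pmf_draw: "set_pmf (draw a) = {0..<max 1 a}"
  unfolding draw_def by (rule set_pmf_of_set) auto

lemma implements_Draw:
  "implements I (Draw x e) s 1 (draw (aval I s e)) (\<lambda>r s'. s' = s\<lparr>var := (var s)(x := r)\<rparr>)"
  unfolding implements_def
proof (intro exI conjI allI)
  let ?q = "map_pmf (\<lambda>r. (s\<lparr>var := (var s)(x := r)\<rparr>, 1::nat)) (draw (aval I s e))"
  show "rel_pmf (\<lambda>v st. fst st = s\<lparr>var := (var s)(x := v)\<rparr> \<and> snd st \<le> 1) (draw (aval I s e)) ?q"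
    by (auto simp: pmf.rel_map intro: rel_pmf_reflI)
  show "steps I (1 + u) (Draw x e # cs, s) = bind_pmf ?q (\<lambda>st. steps I (1 + u - snd st) (cs, fst st))" for cs u
    by (simp add: draw_def bind_map_pmf)
qed

lemma implements_Cond:
  assumes "bval I s b \<Longrightarrow> implements I c1 s t1 p1 Q" "\<not> bval I s b \<Longrightarrow> implements I c2 s t2 p2 Q"
  shows "implements I (Cond b c1 c2) s (max t1 t2 + 1) (if bval I s b then p1 else p2) Q"
proof -
  let ?c = "if bval I s b then c1 else c2" and ?p = "if bval I s b then p1 else p2"
  have "implements I ?c s (max t1 t2) ?p Q"
    using assms by (auto intro: implements_mono)
  then obtain q where "rel_pmf (\<lambda>v st. Q v (fst st) \<and> snd st \<le> max t1 t2) ?p q"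
    "\<And>cs u. steps I (max t1 t2 + u) (?c # cs, s) = bind_pmf q (\<lambda>st. steps I (max t1 t2 + u - snd st) (cs, fst st))"
    unfolding implements_def by blast
  then show ?thesis
    unfolding implements_def
    by (intro exI[of _ "map_pmf (\<lambda>st. (fst st, Suc (snd st))) q"])
       (auto simp: pmf.rel_map bind_map_pmf bind_return_pmf elim!: pmf.rel_mono_strong)
qed

lemma implements_Cond_same:
  assumes "bval I s b \<Longrightarrow> implements I c1 s t p Q" "\<not> bval I s b \<Longrightarrow> implements I c2 s t p Q"
  shows "implements I (Cond b c1 c2) s (t + 1) p Q"
  using implements_Cond[of I s b c1 t p Q c2 t p] assms by simp

primrec iter_pmf :: "nat \<Rightarrow> ('a \<Rightarrow> 'a pmf) \<Rightarrow> 'a \<Rightarrow> 'a pmf" where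
  "iter_pmf 0 f x = return_pmf x"
| "iter_pmf (Suc n) f x = bind_pmf (f x) (iter_pmf n f)"

lemma iter_pmf_return: "iter_pmf n (\<lambda>x. return_pmf (f x)) x = return_pmf ((f ^^ n) x)"
  by (induction n arbitrary: x) (simp_all add: bind_return_pmf funpow_swap1)

text \<open>A loop counts as a for-loop: the guard holds before round \<open>n\<close> and fails
  there, whatever the coins were. This suits programs whose iteration counts are fixed by their
  input and yields a worst-case time bound. The induction is on the remaining rounds
  \<open>n - i\<close>.\<close>

lemma implements_While:
  assumes body: "\<And>i v s. i < n \<Longrightarrow> Q i v s \<Longrightarrow> bval I s b \<and> implements I c s t (f v) (Q (Suc i))"
    and exit: "\<And>v s. Q n v s \<Longrightarrow> \<not> bval I s b"
    and start: "Q 0 v s"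
  shows "implements I (While b c) s (n * (t + 1) + 1) (iter_pmf n f v) (Q n)"
proof -
  have "i \<le> n \<Longrightarrow> Q i v s \<Longrightarrow> implements I (While b c) s ((n - i) * (t + 1) + 1) (iter_pmf (n - i) f v) (Q n)"
    for i v s
  proof (induction "n - i" arbitrary: i v s)
    case 0
    with exit have "\<not> bval I s b" "i = n" by auto
    moreover from this 0 have "implements I (While b c) s 1 (return_pmf v) (Q n)"
      by (intro implements_det) auto
    ultimately show ?case by simp
  next
    case (Suc j)
    then have i: "i < n" "n - i = Suc j" "n - Suc i = j" by auto
    have "implements I (While b c) s (t + (j * (t + 1) + 1) + 1) (bind_pmf (f v) (iter_pmf j f)) (Q n)"
    proof (rule implements_compose)
      show "step_com I cs s (While b c) = return_pmf (c # While b c # cs, s)" for cs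
        using body[OF i(1) Suc.prems(2)] by simp
      show "implements I c s t (f v) (Q (Suc i))"
        using body[OF i(1) Suc.prems(2)] by simp
      show "implements I (While b c) s' (j * (t + 1) + 1) (iter_pmf j f w) (Q n)" if "Q (Suc i) w s'" for w s'
        using Suc.hyps(1)[of "Suc i" w s'] i that by simp
    qed
    then show ?case unfolding i(2) by (simp add: algebra_simps)
  qed
  from this[of 0] start show ?thesis by simp
qed

lemma implements_While_det:
  assumes "\<And>i s. i < n \<Longrightarrow> Q i s \<Longrightarrow> bval I s b \<and> implements I c s t (return_pmf ()) (\<lambda>_. Q (Suc i))"
    and "\<And>s. Q n s \<Longrightarrow> \<not> bval I s b" and "Q 0 s"
  shows "implements I (While b c) s (n * (t + 1) + 1) (return_pmf ()) (\<lambda>_. Q n)"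
  using implements_While[of n "\<lambda>i (_::unit). Q i" I b c t "\<lambda>_. return_pmf ()"] assms
  by (simp add: iter_pmf_return)

lemma implements_program:
  assumes "implements I p \<lparr>var = (\<lambda>_. 0), cell = (\<lambda>_ _. 0), out = []\<rparr> t \<mu> (\<lambda>v s. out s = g v)"
  shows "halts_in p I t" "ram_output p I = map_pmf g \<mu>"
proof -
  from assms obtain q where q: "rel_pmf (\<lambda>v st. out (fst st) = g v \<and> snd st \<le> t) \<mu> q"
    "\<And>u. steps I (t + u) (init_config p) = bind_pmf q (\<lambda>st. steps I (t + u - snd st) ([], fst st))"
    unfolding implements_def init_config_def by blast
  have eq: "steps I t (init_config p) = map_pmf (\<lambda>st. ([], fst st)) q"
    using q(2)[of 0] by (simp add: steps_halted map_pmf_def)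
  show h: "halts_in p I t" by (auto simp: halts_in_def eq)
  \<comment> \<open>The output is a function of the abstract value, so the coupling lies on the
    diagonal, which forces equality of the two laws.\<close>
  have "rel_pmf (\<lambda>z w. z = w) (map_pmf g \<mu>) (map_pmf (\<lambda>st. out (fst st)) q)"
    unfolding pmf.rel_map using q(1) by (rule pmf.rel_mono_strong) auto
  then show "ram_output p I = map_pmf g \<mu>"
    by (simp add: ram_output_eq[OF h] eq map_pmf_comp pmf.rel_eq)
qed

section \<open>Concentration and domination\<close>

abbreviation expect :: "'a pmf \<Rightarrow> ('a \<Rightarrow> real) \<Rightarrow> real" where
  "expect p \<equiv> measure_pmf.expectation p"

lemma expectation_bind_finite:
  assumes "finite (set_pmf p)" "\<And>x. x \<in> set_pmf p \<Longrightarrow> finite (set_pmf (f x))"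
  shows "expect (bind_pmf p f) h = expect p (\<lambda>x. expect (f x) h)"
  using pmf_expectation_bind[OF assms subset_refl, where h = h] assms(1)
  by (subst integral_measure_pmf_real[where A = "set_pmf p"]) (auto simp: mult.commute)

lemma finite_set_draw [simp]: "finite (set_pmf (draw a))"
  by (simp add: set_pmf_draw)

lemma expectation_draw:
  assumes "n \<ge> 1"
  shows "expect (draw (int n)) h = (\<Sum>t<n. h (int t)) / real n"
proof -
  have *: "max 1 (int n) = int n" using assms by simp
  have "{0..<int n} = int ` {..<n}"
    using image_int_atLeastLessThan[of 0 n] by (simp add: atLeast0LessThan)
  then have "(\<Sum>t\<in>{0..<int n}. h t) = (\<Sum>t<n. h (int t))"
    by (simp add: sum.reindex)
  then show ?thesis
    unfolding draw_def * using assms by (subst integral_pmf_of_set) auto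
qed

lemma finite_set_iter_pmf [simp]:
  "(\<And>x. finite (set_pmf (f x))) \<Longrightarrow> finite (set_pmf (iter_pmf n f x))"
  by (induction n arbitrary: x) auto

lemma set_iter_pmf_invariant:
  assumes "P i x" "\<And>i x y. P i x \<Longrightarrow> y \<in> set_pmf (f x) \<Longrightarrow> P (Suc i) y" "y \<in> set_pmf (iter_pmf n f x)"
  shows "P (i + n) y"
  using assms(1,3)
proof (induction n arbitrary: i x)
  case (Suc n)
  then show ?case using assms(2)[OF Suc.prems(1)] Suc.IH[of "Suc i"] by auto
qed simp

lemma expectation_iter_bound:
  assumes "\<And>x. finite (set_pmf (f x))" "\<And>x. expect (f x) h \<le> K * h x" "K \<ge> 0"
  shows "expect (iter_pmf n f x) h \<le> K ^ n * h x"
proof (induction n arbitrary: x)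
  case (Suc n)
  have "expect (iter_pmf (Suc n) f x) h = expect (f x) (\<lambda>y. expect (iter_pmf n f y) h)"
    using assms(1) by (simp add: expectation_bind_finite)
  also have "\<dots> \<le> expect (f x) (\<lambda>y. K ^ n * h y)"
    using assms(1) by (intro integral_mono Suc.IH integrable_measure_pmf_finite) auto
  also have "\<dots> \<le> K ^ n * (K * h x)"
    using assms(2,3) by (auto intro!: mult_left_mono)
  finally show ?case by (simp add: mult_ac)
qed simp

lemma mgf_bound:
  assumes fin: "finite (set_pmf p)" and bnd: "\<And>x. x \<in> set_pmf p \<Longrightarrow> \<bar>h x\<bar> \<le> 1" and l: "l > 0"
  shows "expect p (\<lambda>x. exp (l * (h x - expect p h))) \<le> exp (l\<^sup>2 / 2)"
proof -
  interpret interval_bounded_random_variable "measure_pmf p" h "-1" 1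
  proof
    show "AE x in measure_pmf p. h x \<in> {- 1..1}"
      using bnd by (force simp: AE_measure_pmf_iff abs_le_iff)
  qed simp
  have "ennreal (expect p (\<lambda>x. exp (l * (h x - expect p h)))) = (\<integral>\<^sup>+x. exp (l * (h x - expect p h)) \<partial>p)"
    using fin by (intro nn_integral_eq_integral[symmetric] integrable_measure_pmf_finite) auto
  also have "\<dots> \<le> ennreal (exp (l\<^sup>2 * (1 - (-1))\<^sup>2 / 8))"
    by (rule Hoeffdings_lemma_nn_integral[OF l])
  finally show ?thesis by (simp add: field_simps)
qed

text \<open>Stated for a chain whose increments of \<open>S\<close> have the same exponential moment
  bound from every state. It thus applies to the walk, with \<open>S\<close> the signed position,
  and to a growing list of samples, with \<open>S\<close> a centred sum.\<close>

lemma iter_pmf_chernoff: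
  assumes "\<And>x. finite (set_pmf (f x))" "\<And>x. expect (f x) (\<lambda>y. exp (l * (S y - S x))) \<le> exp (l\<^sup>2 / 2)"
    and l: "l > 0"
  shows "measure_pmf.prob (iter_pmf n f x) {y. S y - S x \<ge> b} \<le> exp (n * l\<^sup>2 / 2 - l * b)"
proof -
  let ?p = "iter_pmf n f x"
  have fin: "finite (set_pmf ?p)" using assms(1) by simp
  have "measure_pmf.prob ?p {y. S y - S x \<ge> b} = expect ?p (indicator {y. S y - S x \<ge> b})"
    by simp
  also have "\<dots> \<le> expect ?p (\<lambda>y. exp (l * S y) * exp (- l * S x - l * b))"
  proof (intro integral_mono integrable_measure_pmf_finite fin)
    fix y
    have "exp (l * S y) * exp (- l * S x - l * b) = exp (l * (S y - S x - b))"
      unfolding exp_add[symmetric] by (simp add: algebra_simps)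
    then show "indicator {y. S y - S x \<ge> b} y \<le> exp (l * S y) * exp (- l * S x - l * b)"
      using l by (simp add: indicator_def)
  qed
  also have "\<dots> = expect ?p (\<lambda>y. exp (l * S y)) * exp (- l * S x - l * b)"
    by simp
  also have "expect ?p (\<lambda>y. exp (l * S y)) \<le> exp (l\<^sup>2 / 2) ^ n * exp (l * S x)"
  proof (rule expectation_iter_bound[OF assms(1)])
    fix x
    have "expect (f x) (\<lambda>y. exp (l * S y)) = expect (f x) (\<lambda>y. exp (l * (S y - S x)) * exp (l * S x))"
      by (simp add: exp_add[symmetric] right_diff_distrib)
    also have "\<dots> = expect (f x) (\<lambda>y. exp (l * (S y - S x))) * exp (l * S x)"
      by simp
    also have "\<dots> \<le> exp (l\<^sup>2 / 2) * exp (l * S x)"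
      by (intro mult_right_mono assms) auto
    finally show "expect (f x) (\<lambda>y. exp (l * S y)) \<le> exp (l\<^sup>2 / 2) * exp (l * S x)" .
  qed auto
  also have "exp (l\<^sup>2 / 2) ^ n * exp (l * S x) * exp (- l * S x - l * b) = exp (n * l\<^sup>2 / 2 - l * b)"
    by (simp add: exp_of_nat_mult[symmetric] exp_add[symmetric])
  finally show ?thesis by simp
qed

section \<open>Multiplicative domination of distributions\<close>

definition dominated :: "real \<Rightarrow> 'a pmf \<Rightarrow> 'a pmf \<Rightarrow> bool" where
  "dominated r p q \<longleftrightarrow> (\<forall>x. pmf p x \<le> r * pmf q x)"

lemma dominated_nn_integral:
  assumes "dominated r p q" "r \<ge> 0"
  shows "(\<integral>\<^sup>+x. h x \<partial>measure_pmf p) \<le> ennreal r * (\<integral>\<^sup>+x. h x \<partial>measure_pmf q)"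
proof -
  have "(\<integral>\<^sup>+x. h x \<partial>measure_pmf p) \<le> (\<integral>\<^sup>+x. ennreal r * (ennreal (pmf q x) * h x) \<partial>count_space UNIV)"
    unfolding nn_integral_measure_pmf using assms
    by (intro nn_integral_mono)
       (auto simp: dominated_def mult.assoc[symmetric] ennreal_mult[symmetric] intro!: mult_right_mono ennreal_leI)
  then show ?thesis by (simp add: nn_integral_cmult nn_integral_measure_pmf)
qed

lemma dominated_prob:
  assumes "dominated r p q" "r \<ge> 0"
  shows "measure_pmf.prob p S \<le> r * measure_pmf.prob q S"
proof -
  have "ennreal (measure_pmf.prob p S) \<le> ennreal r * ennreal (measure_pmf.prob q S)"
    using dominated_nn_integral[OF assms, of "indicator S"]
    by (simp add: measure_pmf.emeasure_eq_measure)
  then show ?thesis using assms(2) by (simp add: ennreal_mult[symmetric])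
qed

text \<open>Privacy factors multiply along a composition. The case \<open>r' = 1\<close> is
  postprocessing, and iteration gives the loss of repeated trials.\<close>

lemma dominated_bind:
  assumes "dominated r p q" "\<And>x. dominated r' (f x) (g x)" "r \<ge> 0" "r' \<ge> 0"
  shows "dominated (r * r') (bind_pmf p f) (bind_pmf q g)"
  unfolding dominated_def
proof
  fix y
  have "ennreal (pmf (bind_pmf p f) y) \<le> ennreal r * (\<integral>\<^sup>+x. pmf (f x) y \<partial>measure_pmf q)"
    unfolding ennreal_pmf_bind by (rule dominated_nn_integral[OF assms(1,3)])
  also have "(\<integral>\<^sup>+x. pmf (f x) y \<partial>measure_pmf q) \<le> (\<integral>\<^sup>+x. ennreal r' * ennreal (pmf (g x) y) \<partial>measure_pmf q)"
    using assms(2,4) by (intro nn_integral_mono) (auto simp: dominated_def ennreal_mult[symmetric] intro: ennreal_leI)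
  also have "\<dots> = ennreal r' * ennreal (pmf (bind_pmf q g) y)"
    by (simp add: nn_integral_cmult ennreal_pmf_bind)
  finally show "pmf (bind_pmf p f) y \<le> r * r' * pmf (bind_pmf q g) y"
    using assms(3,4) by (simp add: ennreal_mult[symmetric] mult_left_mono mult.assoc)
qed

lemma dominated_refl: "r \<ge> 1 \<Longrightarrow> dominated r p p"
  unfolding dominated_def using mult_right_mono[of 1 r "pmf p x" for x] by auto

lemma dominated_map: "dominated r p q \<Longrightarrow> r \<ge> 0 \<Longrightarrow> dominated r (map_pmf f p) (map_pmf f q)"
  unfolding map_pmf_def using dominated_bind[of r p q 1 "\<lambda>x. return_pmf (f x)" "\<lambda>x. return_pmf (f x)"]
  by (simp add: dominated_refl)

lemma dominated_iter:
  assumes "\<And>x. dominated r (f x) (g x)" "r \<ge> 0"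
  shows "dominated (r ^ n) (iter_pmf n f x) (iter_pmf n g x)"
proof (induction n arbitrary: x)
  case (Suc n)
  then show ?case using dominated_bind[OF assms(1) Suc.IH] assms(2) by simp
qed (simp add: dominated_refl)

lemma pmf_bind_ge: "pmf p x * pmf (f x) y \<le> pmf (bind_pmf p f) y"
proof -
  have "ennreal (pmf p x * pmf (f x) y) = (\<integral>\<^sup>+z. indicator {x} z * ennreal (pmf (f x) y) \<partial>measure_pmf p)"
    by (simp add: nn_integral_multc emeasure_pmf_single ennreal_mult)
  also have "\<dots> \<le> (\<integral>\<^sup>+z. pmf (f z) y \<partial>measure_pmf p)"
    by (intro nn_integral_mono) (auto simp: indicator_def)
  finally show ?thesis by (simp add: ennreal_pmf_bind[symmetric])
qed

section \<open>A random monomial for a decision list\<close>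

text \<open>
  For the simple random walk \<open>X\<close> after \<open>w\<close> steps, the expectation of \<open>cos (X \<theta>)\<close> is \<open>(cos \<theta>)^w\<close>.
  Discarding \<open>\<bar>X\<bar> > d\<close> leaves a polynomial of degree at most \<open>d\<close> in \<open>cos \<theta>\<close>.
\<close>

definition walk_step :: "int \<Rightarrow> int pmf" where
  "walk_step x = map_pmf (\<lambda>b. x + b + b - 1) (draw 2)"

lemma finite_set_walk_step [simp]: "finite (set_pmf (walk_step x))"
  by (simp add: walk_step_def)

lemma expectation_draw_2: "expect (draw 2) h = (h 0 + h 1) / 2"
  using expectation_draw[of 2 h] by (simp add: numeral_2_eq_2 lessThan_Suc add.commute)

lemma expectation_draw_3: "expect (draw 3) h = (h 0 + h 1 + h 2) / 3"
  using expectation_draw[of 3 h] by (simp add: numeral_3_eq_3 lessThan_Suc add_ac)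

lemma expectation_walk_cos:
  "expect (iter_pmf w walk_step x) (\<lambda>x. cos (real_of_int x * \<theta>)) = cos \<theta> ^ w * cos (real_of_int x * \<theta>)"
proof (induction w arbitrary: x)
  case (Suc w)
  have "expect (iter_pmf (Suc w) walk_step x) (\<lambda>x. cos (real_of_int x * \<theta>)) =
      expect (walk_step x) (\<lambda>x. cos \<theta> ^ w * cos (real_of_int x * \<theta>))"
    by (simp add: expectation_bind_finite Suc.IH)
  also have "\<dots> = cos \<theta> ^ w * ((cos ((real_of_int x - 1) * \<theta>) + cos ((real_of_int x + 1) * \<theta>)) / 2)"
    by (simp add: walk_step_def expectation_draw_2 algebra_simps)
  also have "(cos ((real_of_int x - 1) * \<theta>) + cos ((real_of_int x + 1) * \<theta>)) / 2 =
      cos \<theta> * cos (real_of_int x * \<theta>)"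
    by (simp add: algebra_simps cos_add cos_diff)
  finally show ?case by simp
qed simp

text \<open>A Chernoff bound in both directions. The parameter \<open>l\<close> is left free because
  its best value, the ratio of \<open>d\<close> to \<open>w\<close>, depends on the choice of
  both.\<close>

lemma walk_tail:
  assumes l: "l > 0"
  shows "measure_pmf.prob (iter_pmf w walk_step 0) {x. \<not> \<bar>x\<bar> \<le> int d} \<le> 2 * exp (w * l\<^sup>2 / 2 - l * d)"
proof -
  let ?p = "iter_pmf w walk_step 0"
  have "expect (draw 2) (\<lambda>b. exp (l * (real_of_int (2 * b - 1) - expect (draw 2) (\<lambda>b. real_of_int (2 * b - 1))))) \<le> exp (l\<^sup>2 / 2)"
    by (rule mgf_bound) (use l in \<open>auto simp: set_pmf_draw\<close>)
  then have up: "expect (walk_step x) (\<lambda>y. exp (l * (real_of_int y - real_of_int x))) \<le> exp (l\<^sup>2 / 2)"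
    and down: "expect (walk_step x) (\<lambda>y. exp (l * (- real_of_int y - - real_of_int x))) \<le> exp (l\<^sup>2 / 2)" for x
    by (simp_all add: expectation_draw_2 walk_step_def add.commute)
  have "measure_pmf.prob ?p {x. \<not> \<bar>x\<bar> \<le> int d} \<le>
      measure_pmf.prob ?p ({y. real_of_int y - real_of_int 0 \<ge> real d} \<union> {y. - real_of_int y - - real_of_int 0 \<ge> real d})"
    by (rule measure_pmf.finite_measure_mono) auto
  also have "\<dots> \<le> measure_pmf.prob ?p {y. real_of_int y - real_of_int 0 \<ge> real d} +
      measure_pmf.prob ?p {y. - real_of_int y - - real_of_int 0 \<ge> real d}"
    by (rule measure_Un_le) auto
  also have "\<dots> \<le> exp (w * l\<^sup>2 / 2 - l * real d) + exp (w * l\<^sup>2 / 2 - l * real d)"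
    using iter_pmf_chernoff[where S = real_of_int, OF finite_set_walk_step up l]
      iter_pmf_chernoff[where S = "\<lambda>x. - real_of_int x", OF finite_set_walk_step down l]
    by (intro add_mono) blast+
  finally show ?thesis by simp
qed

lemma truncated_walk_cos:
  assumes "l > 0"
  shows "\<bar>expect (iter_pmf w walk_step 0) (\<lambda>x. if \<bar>x\<bar> \<le> int d then cos (real_of_int \<bar>x\<bar> * \<theta>) else 0) - cos \<theta> ^ w\<bar>
    \<le> 2 * exp (w * l\<^sup>2 / 2 - l * d)"
proof -
  let ?p = "iter_pmf w walk_step 0" and ?A = "{x. \<not> \<bar>x\<bar> \<le> int d}"
  let ?f = "\<lambda>x. if \<bar>x\<bar> \<le> int d then cos (real_of_int \<bar>x\<bar> * \<theta>) else 0"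
  have [simp]: "integrable (measure_pmf ?p) h" for h :: "int \<Rightarrow> real"
    by (rule integrable_measure_pmf_finite) simp
  have cos_abs: "cos (\<bar>real_of_int x\<bar> * \<theta>) = cos (real_of_int x * \<theta>)" for x
    by (cases "x \<ge> 0") auto
  have "expect ?p ?f - cos \<theta> ^ w = expect ?p ?f - expect ?p (\<lambda>x. cos (real_of_int x * \<theta>))"
    by (simp add: expectation_walk_cos)
  also have "\<dots> = expect ?p (\<lambda>x. ?f x - cos (real_of_int x * \<theta>))"
    by (rule Bochner_Integration.integral_diff[symmetric]) simp_all
  also have "\<bar>\<dots>\<bar> \<le> expect ?p (\<lambda>x. \<bar>?f x - cos (real_of_int x * \<theta>)\<bar>)"
    by (rule integral_abs_bound)
  \<comment> \<open>Off the tail the two agree since cosine is even. On the tail one of them is 0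
    and the other at most 1 in absolute value.\<close>
  also have "\<dots> \<le> expect ?p (indicator ?A)"
    by (rule integral_mono) (auto simp: indicator_def cos_abs)
  also have "\<dots> \<le> 2 * exp (w * l\<^sup>2 / 2 - l * d)"
    using walk_tail[OF assms] by simp
  finally show ?thesis .
qed

text \<open>
  Token 1 is always satisfied, token \<open>lit_code l + 2\<close> is satisfied if the literal \<open>l\<close> is false. A
  trial is a list of tokens followed by \<open>c - 2\<close> with a sign \<open>c \<in> {-1, 0, 1}\<close>, and stands for \<open>c\<close> times
  the conjunction of its tokens. The value 0 never occurs, so that reading past the end of a summary
  can be recognized.
\<close>

definition token :: "(int \<Rightarrow> int) \<Rightarrow> int \<Rightarrow> int" where
  "token tb t = (if t \<le> 0 then 1 else tb (t + t - 2) + 2)"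

text \<open>Decides whether the term selected by \<open>r\<close> carries a factor \<open>u\<close>.
  For \<open>x \<ge> 2\<close>, \<open>r = 0\<close> is the term with index \<open>x - 2\<close>,
  without a factor, and \<open>r = 1, 2\<close> are the two copies of the term with index
  \<open>x - 1\<close>. For \<open>x = 1\<close> every term has the factor, for
  \<open>x \<le> 0\<close> none.\<close>

definition pick :: "int \<Rightarrow> int \<Rightarrow> bool" where
  "pick x r \<longleftrightarrow> 1 \<le> x \<and> \<not> (r \<le> 0 \<and> 2 \<le> x)"

text \<open>
  One unfolding of \<open>T_x(u) = 2 u T_{x-1}(u) - T_{x-2}(u)\<close> as 3 times an average of three terms, where a
  factor \<open>u\<close> becomes a random token. For \<open>x = 1\<close> and \<open>x \<le> 0\<close> the three terms are
  \<open>u, u, -u\<close> and \<open>1, 1, -1\<close>.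
\<close>

definition branch_step :: "(int \<Rightarrow> int) \<Rightarrow> int \<Rightarrow> int \<times> int \<times> int list \<Rightarrow> (int \<times> int \<times> int list) pmf" where
  "branch_step tb j = (\<lambda>(x, c, zs). bind_pmf (draw 3) (\<lambda>r.
     map_pmf (\<lambda>t. (if pick x r then x - 1 else x - 2, if r \<le> 0 then - c else c, zs @ [token tb t]))
       (draw ((if pick x r then j else 0) + 1))))"

lemma branch_step_eq:
  "branch_step tb j (x, c, zs) = bind_pmf (draw 3) (\<lambda>r.
     map_pmf (\<lambda>t. (if pick x r then x - 1 else x - 2, if r \<le> 0 then - c else c, zs @ [token tb t]))
       (draw ((if pick x r then j else 0) + 1)))"
  by (simp add: branch_step_def)

lemma finite_set_branch_step [simp]: "finite (set_pmf (branch_step tb j v))"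
  by (simp add: branch_step_def split: prod.split)

text \<open>\<open>3 ^ i\<close> undoes the \<open>i\<close> averages over three terms, and a fresh
  uniform token is satisfied with probability \<open>cos \<theta>\<close>, so the conjunction
  collected so far picks up the factor \<open>u\<close> in the mean. The condition
  \<open>x \<le> int i\<close> ensures that the index has reached 0 or less when the steps run out,
  so that the remaining polynomial is the constant 1.\<close>

lemma expectation_branch:
  assumes ok: "ok 1" and cos: "cos \<theta> = (\<Sum>t<Suc j. of_bool (ok (token tb (int t)))) / real (Suc j)"
  shows "x \<le> int i \<Longrightarrow>
    3 ^ i * expect (iter_pmf i (branch_step tb (int j)) (x, c, zs)) (\<lambda>(x, c, zs). of_bool (list_all ok zs) * real_of_int c) =
    of_bool (list_all ok zs) * real_of_int c * (if x \<le> 0 then 1 else cos (real_of_int x * \<theta>))"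
proof (induction i arbitrary: x c zs)
  case (Suc i)
  let ?h = "\<lambda>(x :: int, c, zs). of_bool (list_all ok zs) * real_of_int c"
  let ?\<tau> = "\<lambda>x. if x \<le> 0 then 1 else cos (real_of_int x * \<theta>)"
  define F where "F v = 3 ^ i * expect (iter_pmf i (branch_step tb (int j)) v) ?h" for v
  have F: "F (x, c, zs) = of_bool (list_all ok zs) * real_of_int c * ?\<tau> x" if "x \<le> int i" for x c zs
    using Suc.IH[OF that, of c zs] by (simp add: F_def)
  define G where "G r = expect (draw ((if pick x r then int j else 0) + 1))
    (\<lambda>t. F (if pick x r then x - 1 else x - 2, if r \<le> 0 then - c else c, zs @ [token tb t]))" for r
  have G: "G r = of_bool (list_all ok zs) * real_of_int (if r \<le> 0 then - c else c) *
      (if pick x r then cos \<theta> * ?\<tau> (x - 1) else ?\<tau> (x - 2))" for r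
  proof (cases "pick x r")
    case True
    have "int j + 1 = int (Suc j)" by simp
    then have "G r = (\<Sum>t<Suc j. F (x - 1, if r \<le> 0 then - c else c, zs @ [token tb (int t)])) / real (Suc j)"
      unfolding G_def using True by (simp only: if_True) (rule expectation_draw, simp)
    also have "\<dots> = (\<Sum>t<Suc j. of_bool (ok (token tb (int t))) *
        (of_bool (list_all ok zs) * real_of_int (if r \<le> 0 then - c else c) * ?\<tau> (x - 1))) / real (Suc j)"
      using Suc.prems by (intro arg_cong2[where f = "(/)"] sum.cong refl, subst F) auto
    also have "\<dots> = cos \<theta> * (of_bool (list_all ok zs) * real_of_int (if r \<le> 0 then - c else c) * ?\<tau> (x - 1))"
      unfolding sum_distrib_right[symmetric] cos by simp
    finally show ?thesis using True by simp
  next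
    case False
    \<comment> \<open>Only \<open>t = 0\<close> can be drawn here, which appends the padding token
      1.\<close>
    have "G r = (\<Sum>t<1. F (x - 2, if r \<le> 0 then - c else c, zs @ [token tb (int t)])) / real 1"
      unfolding G_def using False expectation_draw[of 1] by simp
    also have "\<dots> = of_bool (list_all ok zs) * real_of_int (if r \<le> 0 then - c else c) * ?\<tau> (x - 2)"
      using Suc.prems ok by (simp add: F token_def)
    finally show ?thesis using False by simp
  qed
  have G_eq: "G = (\<lambda>r. 3 ^ i * expect (draw ((if pick x r then int j else 0) + 1))
    (\<lambda>t. expect (iter_pmf i (branch_step tb (int j)) (if pick x r then x - 1 else x - 2, if r \<le> 0 then - c else c, zs @ [token tb t])) ?h))"
    by (simp add: fun_eq_iff G_def F_def)
  have "3 ^ Suc i * expect (iter_pmf (Suc i) (branch_step tb (int j)) (x, c, zs)) ?h =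
      3 * expect (draw 3) G"
    by (simp add: expectation_bind_finite G_eq branch_step_eq)
  also have "\<dots> = G 0 + G 1 + G 2"
    by (simp add: expectation_draw_3)
  also have "\<dots> = of_bool (list_all ok zs) * real_of_int c * ?\<tau> x"
  proof -
    consider "x \<le> 0" | "x = 1" | "x \<ge> 2" by linarith
    then show ?thesis
    proof cases
      case 3
      have "cos (real_of_int x * \<theta>) = 2 * (cos \<theta> * cos (real_of_int (x - 1) * \<theta>)) - cos (real_of_int (x - 2) * \<theta>)"
      proof -
        have "real_of_int x * \<theta> = real_of_int (x - 1) * \<theta> + \<theta>" "real_of_int (x - 2) * \<theta> = real_of_int (x - 1) * \<theta> - \<theta>"
          by (simp_all add: algebra_simps)
        then show ?thesis by (simp only: cos_add cos_diff) (simp add: algebra_simps)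
      qed
      \<comment> \<open>At \<open>x = 2\<close> the padding value 1 agrees with the cosine of
        0.\<close>
      moreover have "?\<tau> (x - 2) = cos (real_of_int (x - 2) * \<theta>)"
        using 3 by (cases "x = 2") auto
      ultimately show ?thesis using 3
        by (simp add: G pick_def) (simp add: algebra_simps)
    qed (simp_all add: G pick_def)
  qed
  finally show ?case .
qed simp

text \<open>
  With outputs \<open>b_0, \<dots>, b_k\<close> this is \<open>b_j - b_(j-1)\<close>. In the word of a decision list \<open>b_j\<close> has
  index \<open>2 j + 1\<close>, except that \<open>b_k\<close> has index \<open>2 k\<close>. For \<open>j = 0\<close> the index -1 reads the default 0.
\<close>

definition coeff :: "(int \<Rightarrow> int) \<Rightarrow> nat \<Rightarrow> int \<Rightarrow> int" where
  "coeff tb k j = tb (if int k \<le> j then j + j else j + j + 1) - tb (j + j - 1)"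

text \<open>A walk beyond \<open>d\<close> is not redrawn but given sign 0. This truncates the
  expectation as required and keeps the length of the trial fixed.\<close>

definition row_trial :: "(int \<Rightarrow> int) \<Rightarrow> nat \<Rightarrow> nat \<Rightarrow> nat \<Rightarrow> int list pmf" where
  "row_trial tb k d w =
     bind_pmf (draw (int k + 1)) (\<lambda>j. bind_pmf (iter_pmf w walk_step 0) (\<lambda>x.
       map_pmf (\<lambda>(x, c, zs). zs @ [c - 2])
         (iter_pmf d (branch_step tb j) (if \<bar>x\<bar> \<le> int d then (\<bar>x\<bar>, coeff tb k j, []) else (0, 0, [])))))"

definition trial_value :: "(int \<Rightarrow> bool) \<Rightarrow> int list \<Rightarrow> real" where
  "trial_value ok z = of_bool (list_all ok (butlast z)) * real_of_int (last z + 2)"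

lemma finite_set_row_trial [simp]: "finite (set_pmf (row_trial tb k d w))"
  by (simp add: row_trial_def)

text \<open>The factor \<open>k + 1\<close> undoes the uniform choice of the coefficient,
  \<open>3 ^ d\<close> the branching. What remains is the sum over all coefficients of the truncated
  walk expectations.\<close>

lemma expectation_row_trial:
  assumes ok: "ok 1"
    and cos: "\<And>j. j \<le> k \<Longrightarrow> cos (\<theta> j) = (\<Sum>t<Suc j. of_bool (ok (token tb (int t)))) / real (Suc j)"
  shows "real (k + 1) * 3 ^ d * expect (row_trial tb k d w) (trial_value ok) =
    (\<Sum>j\<le>k. real_of_int (coeff tb k (int j)) *
      expect (iter_pmf w walk_step 0) (\<lambda>x. if \<bar>x\<bar> \<le> int d then cos (real_of_int \<bar>x\<bar> * \<theta> j) else 0))"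
proof -
  let ?h = "\<lambda>(x :: int, c, zs). of_bool (list_all ok zs) * real_of_int c"
  let ?W = "iter_pmf w walk_step 0"
  define H where "H j x = expect (iter_pmf d (branch_step tb j)
    (if \<bar>x\<bar> \<le> int d then (\<bar>x\<bar>, coeff tb k j, []) else (0, 0, []))) ?h" for j x
  have H: "3 ^ d * H (int j) x = real_of_int (coeff tb k (int j)) *
      (if \<bar>x\<bar> \<le> int d then cos (real_of_int \<bar>x\<bar> * \<theta> j) else 0)" if "j \<le> k" for j x
  proof (cases "\<bar>x\<bar> \<le> int d")
    case True
    then show ?thesis
      using expectation_branch[OF ok cos[OF that] True, of "coeff tb k (int j)" "[]"]
      by (auto simp: H_def)
  next
    case False
    then show ?thesis
      using expectation_branch[OF ok cos[OF that], of 0 d 0 "[]"] by (auto simp: H_def)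
  qed
  have "expect (row_trial tb k d w) (trial_value ok) = expect (draw (int (Suc k))) (\<lambda>j. expect ?W (H j))"
  proof -
    have "trial_value ok (case v of (x, c, zs) \<Rightarrow> zs @ [c - 2]) = ?h v" for v
      by (cases v) (simp add: trial_value_def)
    then show ?thesis
      unfolding row_trial_def H_def
      by (simp add: expectation_bind_finite add.commute)
  qed
  also have "\<dots> = (\<Sum>j<Suc k. expect ?W (H (int j))) / real (Suc k)"
    by (rule expectation_draw) simp
  finally have "real (k + 1) * 3 ^ d * expect (row_trial tb k d w) (trial_value ok) =
      (\<Sum>j\<le>k. expect ?W (\<lambda>x. 3 ^ d * H (int j) x))"
    by (simp add: sum_distrib_left[symmetric] lessThan_Suc_atMost)
  also have "\<dots> = (\<Sum>j\<le>k. real_of_int (coeff tb k (int j)) *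
      expect ?W (\<lambda>x. if \<bar>x\<bar> \<le> int d then cos (real_of_int \<bar>x\<bar> * \<theta> j) else 0))"
    by (intro sum.cong refl) (simp add: H)
  finally show ?thesis .
qed


section \<open>Decision lists as signed sums of conjunctions\<close>

definition token_ok :: "bool list \<Rightarrow> int \<Rightarrow> bool" where
  "token_ok y z \<longleftrightarrow> z = 1 \<or> (\<exists>l. z = lit_code l + 2 \<and> \<not> lit_true l y)"

lemma lit_code_inject [simp]: "lit_code l = lit_code l' \<longleftrightarrow> l = l'"
  by (cases l; cases l') (auto, presburger+)

lemma lit_code_nonneg: "0 \<le> lit_code l"
  by (cases l) auto

lemma token_ok_1 [simp]: "token_ok y 1"
  by (simp add: token_ok_def)

lemma token_ok_lit [simp]: "token_ok y (lit_code l + 2) \<longleftrightarrow> \<not> lit_true l y"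
  using lit_code_nonneg[of l] by (auto simp: token_ok_def)

lemma fetch_Cons: "fetch z (x # xs) i = (if i = 0 then x else if i < 0 then z else fetch z xs (i - 1))"
  by (auto simp: fetch_def nth_Cons' nat_diff_distrib)

lemma fetch_neg [simp]: "i < 0 \<Longrightarrow> fetch z xs i = z"
  by (simp add: fetch_def)

text \<open>Removing the first test shifts indices by two. The exception is \<open>j = 0\<close>:
  left of the shorter word the default 0 is read, where the longer word has the output
  \<open>b\<close>.\<close>

lemma coeff_Suc:
  "coeff (fetch 0 (a # b # ws)) (Suc k) (int (Suc j)) =
     coeff (fetch 0 ws) k (int j) - (if j = 0 then b else 0)"
  by (auto simp: coeff_def fetch_Cons algebra_simps)

lemma coeff_0: "coeff (fetch 0 (a # b # ws)) (Suc k) 0 = b"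
  by (simp add: coeff_def fetch_Cons)

lemma token_Suc: "token (fetch 0 (a # b # ws)) (int (Suc t) + 1) = token (fetch 0 ws) (int t + 1)"
  by (simp add: token_def fetch_Cons algebra_simps)

lemma token_first: "token (fetch 0 (a # ws)) 1 = a + 2"
  by (simp add: token_def fetch_Cons)

text \<open>If the first true literal is at position p, exactly the conjunctions of length at most p
  hold, and the coefficients telescope to the output there. In the induction, a true first literal
  leaves only \<open>j = 0\<close>, and a false one gives \<open>b\<close> plus the sum of the tail,
  whose term \<open>j = 0\<close> is lowered by \<open>b\<close>.\<close>

lemma dl_eval_sum:
  "of_bool (dl_eval e y) = (\<Sum>j\<le>dl_length e. real_of_int (coeff (fetch 0 (dl_word e)) (dl_length e) (int j)) *
     of_bool (\<forall>t<j. token_ok y (token (fetch 0 (dl_word e)) (int t + 1))))"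
proof (induction e)
  case (Output b)
  then show ?case by (simp add: coeff_def fetch_Cons)
next
  case (IfElse l b e)
  let ?T = "fetch 0 (dl_word e)" and ?k = "dl_length e"
  let ?w = "lit_code l # of_bool b # dl_word e"
  let ?A = "\<lambda>j. \<forall>t<j. token_ok y (token ?T (int t + 1))"
  have A: "(\<forall>t<Suc j. token_ok y (token (fetch 0 ?w) (int t + 1))) \<longleftrightarrow> \<not> lit_true l y \<and> ?A j" for j
    unfolding All_less_Suc2 token_Suc by (simp add: token_first)
  have "(\<Sum>j\<le>Suc ?k. real_of_int (coeff (fetch 0 ?w) (Suc ?k) (int j)) *
      of_bool (\<forall>t<j. token_ok y (token (fetch 0 ?w) (int t + 1)))) =
    of_bool b + (\<Sum>j\<le>?k. (real_of_int (coeff ?T ?k (int j)) - (if j = 0 then of_bool b else 0)) *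
      of_bool (\<not> lit_true l y \<and> ?A j))"
    unfolding sum.atMost_Suc_shift coeff_Suc A by (simp add: coeff_0) (auto intro!: sum.cong)
  also have "\<dots> = of_bool (if lit_true l y then b else dl_eval e y)"
  proof (cases "lit_true l y")
    case False
    have "(\<Sum>j\<le>?k. (real_of_int (coeff ?T ?k (int j)) - (if j = 0 then of_bool b else 0)) * of_bool (?A j)) =
       (\<Sum>j\<le>?k. real_of_int (coeff ?T ?k (int j)) * of_bool (?A j)) - (\<Sum>j\<le>?k. if j = 0 then of_bool b else 0)"
      unfolding sum_subtractf[symmetric] by (intro sum.cong refl) (auto simp: algebra_simps)
    also have "\<dots> = of_bool (dl_eval e y) - of_bool b"
      using IfElse.IH by simp
    finally show ?thesis using False by simp
  qed simp
  finally show ?case by simp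
qed

text \<open>What a row must satisfy for its trials to lie in the range of the noise trials.\<close>

definition row_valid :: "(int \<Rightarrow> int) \<Rightarrow> nat \<Rightarrow> nat \<Rightarrow> bool" where
  "row_valid tb k m \<longleftrightarrow> (\<forall>j\<le>k. \<bar>coeff tb k (int j)\<bar> \<le> 1) \<and>
     (\<forall>t<k. token tb (int t + 1) \<in> {1..2 * int m + 1})"

lemma row_valid_dl_word:
  assumes "dl_wf m e" "dl_length e = k"
  shows "row_valid (fetch 0 (dl_word e)) k m"
proof -
  have bits: "fetch 0 (dl_word e) (if int (dl_length e) \<le> int j then int j + int j else int j + int j + 1) \<in> {0, 1} \<and>
    fetch 0 (dl_word e) (int j + int j - 1) \<in> {0, 1}" if "j \<le> dl_length e" for j e
    using that
  proof (induction e arbitrary: j)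
    case (IfElse l b e)
    show ?case
    proof (cases j)
      case (Suc i)
      then show ?thesis using IfElse.IH[of i] IfElse.prems
        by (cases "i = 0") (auto simp: fetch_Cons algebra_simps split: if_splits)
    qed (simp add: fetch_Cons)
  qed (simp add: fetch_Cons)
  have "\<bar>coeff (fetch 0 (dl_word e)) (dl_length e) (int j)\<bar> \<le> 1" if "j \<le> dl_length e" for j
    using bits[OF that] unfolding coeff_def by auto
  moreover have "token (fetch 0 (dl_word e)) (int t + 1) \<in> {1..2 * int m + 1}" if "t < dl_length e" "dl_wf m e" for t e
    using that
  proof (induction e arbitrary: t)
    case (IfElse l b e)
    then show ?case
      by (cases t; cases l) (simp_all add: token_Suc token_first del: of_nat_Suc)
  qed simp
  ultimately show ?thesis using assms by (simp add: row_valid_def)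
qed

text \<open>Each of the \<open>k + 1\<close> conjunctions, with coefficient of absolute value at
  most 1, contributes two errors: its replacement by a power of the average \<open>u j\<close>, and
  the truncation of the walk that represents this power.\<close>

lemma row_trial_approx:
  assumes k: "dl_length e = k" and wf: "dl_wf m e" and l: "l > 0"
  shows "\<bar>real (k + 1) * 3 ^ d * expect (row_trial (fetch 0 (dl_word e)) k d w) (trial_value (token_ok y)) - of_bool (dl_eval e y)\<bar>
    \<le> real (k + 1) * (exp (- real w / real (k + 1)) + 2 * exp (w * l\<^sup>2 / 2 - l * d))"
proof -
  let ?T = "fetch 0 (dl_word e)" and ?ok = "token_ok y"
  \<comment> \<open>Index \<open>t = 0\<close> is the token that always holds, so the average is
    over \<open>j + 1\<close> terms and also makes sense for the empty conjunction. The angle for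
    the Chebyshev polynomials is \<open>arccos (u j)\<close>.\<close>
  define u where "u j = (\<Sum>t<Suc j. of_bool (?ok (token ?T (int t)))) / real (Suc j)" for j
  define A where "A j = (\<forall>t<j. ?ok (token ?T (int t + 1)))" for j
  define p where "p j = expect (iter_pmf w walk_step 0) (\<lambda>x. if \<bar>x\<bar> \<le> int d then cos (real_of_int \<bar>x\<bar> * arccos (u j)) else 0)" for j
  define \<delta> where "\<delta> = exp (- real w / real (k + 1)) + 2 * exp (w * l\<^sup>2 / 2 - l * d)"
  have u: "0 \<le> u j" "u j \<le> 1" for j
  proof -
    show "0 \<le> u j" by (simp add: u_def sum_nonneg)
    have "(\<Sum>t<Suc j. of_bool (?ok (token ?T (int t)))) \<le> (\<Sum>t<Suc j. 1 :: real)"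
      by (intro sum_mono) simp
    then show "u j \<le> 1" by (simp add: u_def)
  qed
  have cos_u: "cos (arccos (u j)) = u j" for j
    using u[of j] by (intro cos_arccos) auto
  have power_u: "\<bar>u j ^ w - of_bool (A j)\<bar> \<le> exp (- real w / real (k + 1))" if "j \<le> k" for j
  proof (cases "A j")
    case True
    have "?ok (token ?T (int t))" if "t < Suc j" for t
      using True that by (cases t) (auto simp: A_def token_def[of _ 0] add.commute)
    then have "u j = 1" by (simp add: u_def)
    then show ?thesis using True by simp
  next
    case False
    then obtain t where t: "t < j" "\<not> ?ok (token ?T (int t + 1))" by (auto simp: A_def)
    \<comment> \<open>Conjunct \<open>t\<close> is token \<open>t + 1\<close>. If it fails, at most
      \<open>j\<close> of the \<open>j + 1\<close> terms count.\<close>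
    have "(\<Sum>i<Suc j. of_bool (?ok (token ?T (int i)))) \<le> (\<Sum>i<Suc j. if i = Suc t then 0 else 1 :: real)"
      using t by (intro sum_mono) (auto simp: add.commute)
    also have "\<dots> = (\<Sum>i\<in>{..<Suc j} - {Suc t}. 1)"
      by (subst sum.remove[of _ "Suc t"]) (use t in auto)
    also have "\<dots> = real j" using t by simp
    finally have "u j \<le> real j / real (Suc j)"
      unfolding u_def by (intro divide_right_mono) auto
    also have "\<dots> = 1 - 1 / real (Suc j)" by (simp add: field_simps)
    also have "\<dots> \<le> 1 - 1 / real (k + 1)" using that by (simp add: field_simps)
    also have "\<dots> \<le> exp (- 1 / real (k + 1))" using exp_ge_add_one_self[of "- 1 / real (k + 1)"] by simp
    finally have "u j ^ w \<le> exp (- 1 / real (k + 1)) ^ w"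
      using u by (intro power_mono)
    also have "\<dots> = exp (- real w / real (k + 1))"
      by (simp add: exp_of_nat_mult[symmetric])
    finally show ?thesis using False u[of j] by simp
  qed
  have p: "\<bar>p j - of_bool (A j)\<bar> \<le> \<delta>" if "j \<le> k" for j
    using truncated_walk_cos[OF l, of w d "arccos (u j)"] power_u[OF that]
    unfolding cos_u p_def[symmetric] \<delta>_def by linarith
  have coeff: "\<bar>real_of_int (coeff ?T k (int j))\<bar> \<le> 1" if "j \<le> k" for j
    using row_valid_dl_word[OF wf k] that unfolding row_valid_def by (simp flip: of_int_abs)
  have "real (k + 1) * 3 ^ d * expect (row_trial ?T k d w) (trial_value ?ok) = (\<Sum>j\<le>k. real_of_int (coeff ?T k (int j)) * p j)"
    unfolding p_def by (rule expectation_row_trial) (simp_all only: token_ok_1 cos_u, simp add: u_def)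
  moreover have "of_bool (dl_eval e y) = (\<Sum>j\<le>k. real_of_int (coeff ?T k (int j)) * of_bool (A j))"
    using dl_eval_sum[of e y] unfolding A_def k by simp
  ultimately have "\<bar>real (k + 1) * 3 ^ d * expect (row_trial ?T k d w) (trial_value ?ok) - of_bool (dl_eval e y)\<bar> =
      \<bar>\<Sum>j\<le>k. real_of_int (coeff ?T k (int j)) * (p j - of_bool (A j))\<bar>"
    by (simp add: sum_subtractf right_diff_distrib)
  also have "\<dots> \<le> (\<Sum>j\<le>k. 1 * \<delta>)"
    by (intro order_trans[OF sum_abs] sum_mono, unfold abs_mult, intro mult_mono) (use coeff p in auto)
  finally show ?thesis by (simp add: \<delta>_def)
qed

section \<open>Privacy and concentration of the trials\<close>

text \<open>The uniform distribution on \<open>trial_range m d\<close>. The symmetric sign, encoded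
  as -3, -2 or -1, makes its mean 0.\<close>

definition noise_trial :: "nat \<Rightarrow> nat \<Rightarrow> int list pmf" where
  "noise_trial m d =
     bind_pmf (iter_pmf d (\<lambda>zs. map_pmf (\<lambda>t. zs @ [t + 1]) (draw (2 * int m + 1))) [])
       (\<lambda>zs. map_pmf (\<lambda>r. zs @ [r - 3]) (draw 3))"

definition trial :: "(int \<Rightarrow> int \<Rightarrow> int) \<Rightarrow> nat \<Rightarrow> nat \<Rightarrow> nat \<Rightarrow> nat \<Rightarrow> nat \<Rightarrow> int list pmf" where
  "trial tabs n k m d w = bind_pmf (draw 2) (\<lambda>b. if b \<le> 0 then noise_trial m d
     else bind_pmf (draw (int n)) (\<lambda>i. row_trial (tabs i) k d w))"

definition trial_range :: "nat \<Rightarrow> nat \<Rightarrow> int list set" where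
  "trial_range m d = {zs @ [c] | zs c. length zs = d \<and> set zs \<subseteq> {1..2 * int m + 1} \<and> c \<in> {-3..-1}}"

lemma finite_set_noise_trial [simp]: "finite (set_pmf (noise_trial m d))"
  by (simp add: noise_trial_def)

lemma finite_set_trial [simp]: "finite (set_pmf (trial tabs n k m d w))"
  by (simp add: trial_def)

lemma set_noise_trial: "set_pmf (noise_trial m d) \<subseteq> trial_range m d"
proof
  fix z assume "z \<in> set_pmf (noise_trial m d)"
  then obtain zs r where z: "z = zs @ [r - 3]" "r \<in> {0..<3}"
    and zs: "zs \<in> set_pmf (iter_pmf d (\<lambda>zs. map_pmf (\<lambda>t. zs @ [t + 1]) (draw (2 * int m + 1))) [])"
    by (auto simp: noise_trial_def set_pmf_draw)
  have "length zs = 0 + d \<and> set zs \<subseteq> {1..2 * int m + 1}"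
    by (rule set_iter_pmf_invariant[OF _ _ zs, where P = "\<lambda>i zs. length zs = i \<and> set zs \<subseteq> {1..2 * int m + 1}"])
       (auto simp: set_pmf_draw subset_eq)
  then show "z \<in> trial_range m d"
    using z by (auto simp: trial_range_def)
qed

lemma set_row_trial:
  assumes "row_valid tb k m"
  shows "set_pmf (row_trial tb k d w) \<subseteq> trial_range m d"
proof
  fix z assume "z \<in> set_pmf (row_trial tb k d w)"
  then obtain j a x c zs where z: "z = zs @ [c - 2]" and j: "0 \<le> j" "j \<le> int k"
    and it: "(x, c, zs) \<in> set_pmf (iter_pmf d (branch_step tb j) (if \<bar>a\<bar> \<le> int d then (\<bar>a\<bar>, coeff tb k j, []) else (0, 0, [])))"
    by (auto simp: row_trial_def set_pmf_draw)
  define P where "P i v = (case v of (x :: int, c :: int, zs) \<Rightarrow> \<bar>c\<bar> \<le> 1 \<and> length zs = i \<and> set zs \<subseteq> {1..2 * int m + 1})" for i v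
  have tok: "token tb t \<in> {1..2 * int m + 1}" if "t \<in> {0..<max 1 (h + 1)}" "h = j \<or> h = 0" for t h
  proof (cases "t = 0")
    case False
    then have "t = int (nat (t - 1)) + 1" "nat (t - 1) < k"
      using that j by auto
    then show ?thesis using assms unfolding row_valid_def by metis
  qed (simp add: token_def)
  have "P (0 + d) (x, c, zs)"
  proof (rule set_iter_pmf_invariant[OF _ _ it])
    show "P 0 (if \<bar>a\<bar> \<le> int d then (\<bar>a\<bar>, coeff tb k j, []) else (0, 0, []))"
      using assms j by (auto simp: P_def row_valid_def dest: spec[of _ "nat j"])
    show "P (Suc i) v'" if "P i v" "v' \<in> set_pmf (branch_step tb j v)" for i v v'
      using that tok[where h = j] tok[where h = 0]
      by (cases v) (auto simp: P_def branch_step_eq set_pmf_draw subset_eq split: if_splits)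
  qed
  then show "z \<in> trial_range m d"
    using z by (auto simp: P_def trial_range_def)
qed

lemma set_trial:
  assumes "\<And>i. i < n \<Longrightarrow> row_valid (tabs (int i)) k m" "n \<ge> 1"
  shows "set_pmf (trial tabs n k m d w) \<subseteq> trial_range m d"
proof -
  have "row_valid (tabs i) k m" if "0 \<le> i" "i < max 1 (int n)" for i
    using assms(1)[of "nat i"] assms(2) that by simp
  then show ?thesis
    using set_noise_trial set_row_trial unfolding trial_def
    by (fastforce simp: set_pmf_draw split: if_splits)
qed

lemma pmf_draw: "0 \<le> t \<Longrightarrow> t < int n \<Longrightarrow> pmf (draw (int n)) t = 1 / real n"
  unfolding draw_def by (subst pmf_of_set) (auto simp: max_def indicator_def)

lemma pmf_noise_trial_ge:
  assumes "z \<in> trial_range m d"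
  shows "1 / (3 * real (2 * m + 1) ^ d) \<le> pmf (noise_trial m d) z"
proof -
  let ?f = "\<lambda>zs. map_pmf (\<lambda>t. zs @ [t + 1]) (draw (2 * int m + 1))"
  have draw: "pmf (draw (2 * int m + 1)) t = 1 / real (2 * m + 1)" if "t \<in> {0..2 * int m}" for t
    using pmf_draw[of t "2 * m + 1"] that by (simp add: add.commute)
  have iter: "(1 / real (2 * m + 1)) ^ length zs \<le> pmf (iter_pmf (length zs) ?f zs0) (zs0 @ zs)"
    if "set zs \<subseteq> {1..2 * int m + 1}" for zs zs0
    using that
  proof (induction zs arbitrary: zs0)
    case (Cons z zs)
    have "(1 / real (2 * m + 1)) ^ length (z # zs) \<le>
        pmf (?f zs0) (zs0 @ [z]) * pmf (iter_pmf (length zs) ?f (zs0 @ [z])) ((zs0 @ [z]) @ zs)"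
    proof -
      have "1 / real (2 * m + 1) = pmf (draw (2 * int m + 1)) (z - 1) * pmf (return_pmf (zs0 @ [z])) (zs0 @ [z])"
        using draw[of "z - 1"] Cons.prems by simp
      also have "\<dots> \<le> pmf (?f zs0) (zs0 @ [z])"
        unfolding map_pmf_def using pmf_bind_ge[of _ "z - 1" "\<lambda>t. return_pmf (zs0 @ [t + 1])" "zs0 @ [z]"] by simp
      finally have "1 / real (2 * m + 1) \<le> pmf (?f zs0) (zs0 @ [z])" .
      moreover have "(1 / real (2 * m + 1)) ^ length zs \<le>
          pmf (iter_pmf (length zs) ?f (zs0 @ [z])) ((zs0 @ [z]) @ zs)"
        using Cons.IH[of "zs0 @ [z]"] Cons.prems by simp
      ultimately show ?thesis
        unfolding length_Cons power_Suc by (rule mult_mono) auto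
    qed
    also have "\<dots> \<le> pmf (iter_pmf (length (z # zs)) ?f zs0) (zs0 @ z # zs)"
      using pmf_bind_ge[of "?f zs0" "zs0 @ [z]" "iter_pmf (length zs) ?f" "zs0 @ z # zs"] by simp
    finally show ?case .
  qed simp
  obtain zs c where z: "z = zs @ [c]" "length zs = d" "set zs \<subseteq> {1..2 * int m + 1}" "c \<in> {-3..-1}"
    using assms by (auto simp: trial_range_def)
  have "1 / real 3 = pmf (draw 3) (c + 3) * pmf (return_pmf z) z"
    using pmf_draw[of "c + 3" 3] z(4) by simp
  also have "\<dots> \<le> pmf (map_pmf (\<lambda>r. zs @ [r - 3]) (draw 3)) z"
    unfolding map_pmf_def using pmf_bind_ge[of _ "c + 3" "\<lambda>r. return_pmf (zs @ [r - 3])" "zs @ [c]"] z(1) by simp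
  finally have "(1 / real (2 * m + 1)) ^ d * (1 / real 3) \<le>
      pmf (iter_pmf d ?f []) zs * pmf (map_pmf (\<lambda>r. zs @ [r - 3]) (draw 3)) z"
    using iter[OF z(3), of "[]"] z(2) by (intro mult_mono) auto
  also have "\<dots> \<le> pmf (noise_trial m d) z"
    unfolding noise_trial_def by (rule pmf_bind_ge)
  finally show ?thesis by (simp add: power_one_over field_simps)
qed

lemma pmf_trial:
  assumes "n \<ge> 1"
  shows "pmf (trial tabs n k m d w) z =
    (pmf (noise_trial m d) z + (\<Sum>i<n. pmf (row_trial (tabs (int i)) k d w) z) / real n) / 2"
  using assms by (simp add: trial_def pmf_bind expectation_draw_2 expectation_draw)

text \<open>The row \<open>i0\<close> is consulted with probability \<open>1 / (2 * n)\<close>, so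
  it changes any probability by at most that much. The noise alone gives each possible outcome at
  least \<open>1 / (2 * U)\<close> with \<open>U = 3 * (2 * m + 1) ^ d\<close>. The change is thus
  at most \<open>U / n\<close> times the probability itself.\<close>

lemma trial_dominated:
  assumes valid: "\<And>i. i < n \<Longrightarrow> row_valid (tabs (int i)) k m"
    and n: "n \<ge> 1" and eq: "\<And>i. i < n \<Longrightarrow> i \<noteq> i0 \<Longrightarrow> tabs (int i) = tabs' (int i)"
  shows "dominated (1 + 3 * real (2 * m + 1) ^ d / real n) (trial tabs n k m d w) (trial tabs' n k m d w)"
  unfolding dominated_def
proof
  fix z
  let ?U = "3 * real (2 * m + 1) ^ d"
  let ?p = "\<lambda>tabs. pmf (trial tabs n k m d w) z" and ?r = "\<lambda>tabs i. pmf (row_trial (tabs (int i)) k d w) z"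
  have U: "?U > 0" by (simp add: add_pos_nonneg)
  show "?p tabs \<le> (1 + ?U / real n) * ?p tabs'"
  proof (cases "z \<in> trial_range m d")
    case True
    have "(\<Sum>i<n. ?r tabs i) \<le> (\<Sum>i<n. ?r tabs' i + (if i = i0 then 1 else 0))"
      using eq by (intro sum_mono) (auto simp: pmf_le_1 add_increasing)
    also have "\<dots> \<le> (\<Sum>i<n. ?r tabs' i) + 1"
      by (simp add: sum.distrib)
    finally have "?p tabs \<le> (pmf (noise_trial m d) z + ((\<Sum>i<n. ?r tabs' i) + 1) / real n) / 2"
      unfolding pmf_trial[OF n] by (intro divide_right_mono add_left_mono) auto
    also have "\<dots> = ?p tabs' + 1 / (2 * real n)"
      unfolding pmf_trial[OF n] by (simp add: add_divide_distrib)
    finally have 1: "?p tabs \<le> ?p tabs' + 1 / (2 * real n)" .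
    have "1 / ?U / 2 \<le> ?p tabs'"
      unfolding pmf_trial[OF n] using pmf_noise_trial_ge[OF True]
      by (intro divide_right_mono) (auto intro!: add_increasing2 divide_nonneg_nonneg sum_nonneg)
    then have "?U / real n * (1 / ?U / 2) \<le> ?U / real n * ?p tabs'"
      using U by (intro mult_left_mono) auto
    moreover have "?U / real n * (1 / ?U / 2) = 1 / (2 * real n)"
      using U by simp
    ultimately show ?thesis using 1 by (simp add: distrib_right)
  next
    case False
    then have "?p tabs = 0"
      using set_trial[of n tabs k m d w] valid n by (auto simp: pmf_eq_0_set_pmf)
    then show ?thesis using U by simp
  qed
qed

lemma expectation_noise_trial: "expect (noise_trial m d) (trial_value ok) = 0"
proof -
  have "expect (map_pmf (\<lambda>r. zs @ [r - 3]) (draw 3)) (trial_value ok) = 0" for zs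
    by (simp add: expectation_draw_3 trial_value_def)
  then show ?thesis
    unfolding noise_trial_def by (subst expectation_bind_finite) auto
qed

lemma expectation_trial:
  assumes "n \<ge> 1"
  shows "expect (trial tabs n k m d w) (trial_value ok) =
    (\<Sum>i<n. expect (row_trial (tabs (int i)) k d w) (trial_value ok)) / (2 * real n)"
  using assms
  by (simp add: trial_def expectation_bind_finite expectation_draw_2 expectation_draw expectation_noise_trial)

lemma trial_value_bound: "z \<in> trial_range m d \<Longrightarrow> \<bar>trial_value ok z\<bar> \<le> 1"
  by (auto simp: trial_range_def trial_value_def)

section \<open>Independent trials and concentration for all queries at once\<close>

definition sample :: "nat \<Rightarrow> 'a pmf \<Rightarrow> 'a list pmf" where
  "sample N p = iter_pmf N (\<lambda>l. map_pmf (\<lambda>z. l @ [z]) p) []"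

lemma set_sample:
  assumes "l \<in> set_pmf (sample N p)"
  shows "length l = N" "set l \<subseteq> set_pmf p"
proof -
  have "length l = 0 + N \<and> set l \<subseteq> set_pmf p"
    by (rule set_iter_pmf_invariant[OF _ _ assms[unfolded sample_def],
          where P = "\<lambda>i l. length l = i \<and> set l \<subseteq> set_pmf p"]) auto
  then show "length l = N" "set l \<subseteq> set_pmf p" by auto
qed

lemma sample_dominated:
  assumes "dominated r p q" "r \<ge> 0"
  shows "dominated (r ^ N) (sample N p) (sample N q)"
  unfolding sample_def by (intro dominated_iter dominated_map assms)

lemma sample_mean:
  assumes fin: "finite (set_pmf p)" and bnd: "\<And>z. z \<in> set_pmf p \<Longrightarrow> \<bar>Y z\<bar> \<le> 1" and b: "b > 0"
  shows "measure_pmf.prob (sample N p) {l. \<bar>sum_list (map Y l) - N * expect p Y\<bar> \<ge> N * b} \<le> 2 * exp (- (real N * b\<^sup>2) / 2)"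
proof -
  let ?f = "\<lambda>l. map_pmf (\<lambda>z. l @ [z]) p"
  define S where "S \<sigma> l = (\<Sum>z\<leftarrow>l. \<sigma> * Y z - expect p (\<lambda>z. \<sigma> * Y z))" for \<sigma> l
  have tail: "measure_pmf.prob (sample N p) {l. S \<sigma> l - S \<sigma> [] \<ge> N * b} \<le> exp (- (real N * b\<^sup>2) / 2)"
    if "\<bar>\<sigma>\<bar> = 1" for \<sigma>
  proof -
    \<comment> \<open>The Chernoff parameter \<open>l = b\<close> minimizes
      \<open>N * l^2 / 2 - l * N * b\<close>. The sign \<open>\<sigma>\<close> lets one argument
      cover both tails.\<close>
    have "measure_pmf.prob (sample N p) {l. S \<sigma> l - S \<sigma> [] \<ge> N * b} \<le> exp (N * b\<^sup>2 / 2 - b * (N * b))"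
      unfolding sample_def
    proof (rule iter_pmf_chernoff[where S = "S \<sigma>", OF _ _ b])
      fix l
      have "expect (?f l) (\<lambda>l'. exp (b * (S \<sigma> l' - S \<sigma> l))) = expect p (\<lambda>z. exp (b * (\<sigma> * Y z - expect p (\<lambda>z. \<sigma> * Y z))))"
        by (simp add: S_def)
      also have "\<dots> \<le> exp (b\<^sup>2 / 2)"
        by (rule mgf_bound[OF fin _ b]) (use bnd that in \<open>simp add: abs_mult\<close>)
      finally show "expect (?f l) (\<lambda>l'. exp (b * (S \<sigma> l' - S \<sigma> l))) \<le> exp (b\<^sup>2 / 2)" .
    qed (use fin in simp)
    also have "N * b\<^sup>2 / 2 - b * (N * b) = - (real N * b\<^sup>2) / 2"
      by (simp add: power2_eq_square)
    finally show ?thesis .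
  qed
  have S: "S \<sigma> l - S \<sigma> [] = \<sigma> * (sum_list (map Y l) - length l * expect p Y)" for \<sigma> l
    by (induction l) (simp_all add: S_def algebra_simps)
  let ?A = "\<lambda>\<sigma>. {l. S \<sigma> l - S \<sigma> [] \<ge> N * b}"
  \<comment> \<open>\<open>S\<close> subtracts the mean \<open>length l\<close> times, which is
    \<open>N\<close> times only on the support.\<close>
  have "measure_pmf.prob (sample N p) {l. \<bar>sum_list (map Y l) - N * expect p Y\<bar> \<ge> N * b} =
      measure_pmf.prob (sample N p) ({l. \<bar>sum_list (map Y l) - N * expect p Y\<bar> \<ge> N * b} \<inter> set_pmf (sample N p))"
    by (rule measure_Int_set_pmf[symmetric])
  also have "\<dots> \<le> measure_pmf.prob (sample N p) (?A 1 \<union> ?A (-1))"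
    by (rule measure_pmf.finite_measure_mono) (auto simp: S dest!: set_sample(1))
  also have "\<dots> \<le> measure_pmf.prob (sample N p) (?A 1) + measure_pmf.prob (sample N p) (?A (-1))"
    by (rule measure_Un_le) auto
  also have "\<dots> \<le> exp (- (real N * b\<^sup>2) / 2) + exp (- (real N * b\<^sup>2) / 2)"
    by (intro add_mono tail) auto
  finally show ?thesis by simp
qed

lemma sample_mean_uniform:
  assumes fin: "finite (set_pmf p)" and bnd: "\<And>y z. y \<in> Q \<Longrightarrow> z \<in> set_pmf p \<Longrightarrow> \<bar>Y y z\<bar> \<le> 1" and b: "b > 0"
    and Q: "finite Q"
  shows "measure_pmf.prob (sample N p) {l. \<forall>y\<in>Q. \<bar>sum_list (map (Y y) l) - N * expect p (Y y)\<bar> \<le> N * b}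
    \<ge> 1 - card Q * (2 * exp (- (real N * b\<^sup>2) / 2))"
proof -
  let ?bad = "\<lambda>y. {l. \<bar>sum_list (map (Y y) l) - N * expect p (Y y)\<bar> \<ge> N * b}"
  have "measure_pmf.prob (sample N p) (\<Union>y\<in>Q. ?bad y) \<le> (\<Sum>y\<in>Q. measure_pmf.prob (sample N p) (?bad y))"
    by (rule measure_pmf.finite_measure_subadditive_finite) (use Q in auto)
  also have "\<dots> \<le> (\<Sum>y\<in>Q. 2 * exp (- (real N * b\<^sup>2) / 2))"
    by (intro sum_mono sample_mean fin bnd b)
  finally have "measure_pmf.prob (sample N p) (\<Union>y\<in>Q. ?bad y) \<le> card Q * (2 * exp (- (real N * b\<^sup>2) / 2))"
    by simp
  moreover have "1 - measure_pmf.prob (sample N p) (\<Union>y\<in>Q. ?bad y) = measure_pmf.prob (sample N p) (- (\<Union>y\<in>Q. ?bad y))"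
    using measure_pmf.prob_compl[of "\<Union>y\<in>Q. ?bad y" "sample N p"] by (simp add: Compl_eq_Diff_UNIV)
  moreover have "measure_pmf.prob (sample N p) (- (\<Union>y\<in>Q. ?bad y)) \<le>
      measure_pmf.prob (sample N p) {l. \<forall>y\<in>Q. \<bar>sum_list (map (Y y) l) - N * expect p (Y y)\<bar> \<le> N * b}"
    by (rule measure_pmf.finite_measure_mono) (auto simp: not_le intro: less_imp_le)
  ultimately show ?thesis by linarith
qed

section \<open>The sampling program\<close>

lemma implements_le: "implements I c s t p Q \<Longrightarrow> t \<le> t' \<Longrightarrow> implements I c s t' p Q"
  by (rule implements_mono)

lemma implements_det_Semi:
  assumes "\<And>cs. step_com I cs s c1 = return_pmf (cs, s1)" "implements I c2 s1 t p Q"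
  shows "implements I (c1 ;; c2) s (t + 2) p Q"
proof -
  have "implements I c1 s 1 (return_pmf ()) (\<lambda>_ s'. s' = s1)"
    using assms(1) by (rule implements_det) simp
  from implements_Semi_det[OF this, of c2 t p Q] assms(2) show ?thesis
    by (simp add: add.commute)
qed

lemma implements_Assign_Semi:
  "implements I c (s\<lparr>var := (var s)(x := aval I s e)\<rparr>) t p Q \<Longrightarrow> implements I (Assign x e ;; c) s (t + 2) p Q"
  by (rule implements_det_Semi) simp_all

lemma implements_Write_Semi:
  "implements I c (s\<lparr>cell := (cell s)(a := (cell s a)(aval I s e1 := aval I s e2))\<rparr>) t p Q \<Longrightarrow>
   implements I (Write a e1 e2 ;; c) s (t + 2) p Q"
  by (rule implements_det_Semi) simp_all

lemma implements_Emit_Semi: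
  "implements I c (s\<lparr>out := out s @ [aval I s e]\<rparr>) t p Q \<Longrightarrow> implements I (Emit e ;; c) s (t + 2) p Q"
  by (rule implements_det_Semi) simp_all

lemma implements_Draw_Semi:
  assumes "aval I s e = a" "\<And>r. r \<in> set_pmf (draw a) \<Longrightarrow> implements I c (s\<lparr>var := (var s)(x := r)\<rparr>) t (f r) Q"
  shows "implements I (Draw x e ;; c) s (t + 2) (bind_pmf (draw a) f) Q"
proof -
  have "implements I (Draw x e ;; c) s (1 + t + 1) (bind_pmf (draw (aval I s e)) f) Q"
    by (rule implements_Semi[OF implements_Draw]) (use assms in simp)
  then show ?thesis using assms(1) by simp
qed

abbreviation Select :: "nat \<Rightarrow> bexp \<Rightarrow> aexp \<Rightarrow> aexp \<Rightarrow> com" where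
  "Select x b e1 e2 \<equiv> Cond b (Assign x e1) (Assign x e2)"

lemma implements_Select:
  assumes "Q v (s\<lparr>var := (var s)(x := if bval I s b then aval I s e1 else aval I s e2)\<rparr>)"
  shows "implements I (Select x b e1 e2) s 2 (return_pmf v) Q"
proof -
  have "implements I (Select x b e1 e2) s (1 + 1) (return_pmf v) Q"
    by (rule implements_Cond_same; rule implements_Assign) (use assms in simp_all)
  then show ?thesis by (simp only: one_add_one)
qed

lemma implements_Select_Semi:
  assumes "implements I c (s\<lparr>var := (var s)(x := if bval I s b then aval I s e1 else aval I s e2)\<rparr>) t p Q"
  shows "implements I (Select x b e1 e2 ;; c) s (t + 3) p Q"
proof -
  let ?s = "s\<lparr>var := (var s)(x := if bval I s b then aval I s e1 else aval I s e2)\<rparr>"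
  have "implements I (Select x b e1 e2) s 2 (return_pmf ()) (\<lambda>_ s'. s' = ?s)"
    by (rule implements_Select) simp
  then have "implements I (Select x b e1 e2 ;; c) s (2 + t + 1) p Q"
    by (rule implements_Semi_det) (use assms in simp)
  moreover have "2 + t + 1 = t + 3" by simp
  ultimately show ?thesis by metis
qed

lemmas implements_intros =
  implements_Assign_Semi implements_Write_Semi implements_Emit_Semi implements_Select_Semi
  implements_Assign implements_Emit implements_Select

text \<open>The registers \<open>vR\<close>, \<open>vS\<close>, \<open>vB\<close> hold a root, its
  square and a power of two, and \<open>vD\<close>, \<open>vL\<close>, \<open>vW\<close>,
  \<open>vN\<close>, \<open>vP\<close> the degree, walk length, weight, number of trials and privacy
  bound. In a trial \<open>vC\<close> is the sign and \<open>vX\<close> the walk position, then the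
  Chebyshev index. In the evaluator \<open>vC\<close> is the running sum and \<open>vX\<close> the
  contribution of the current trial.\<close>

abbreviation (input) "vR \<equiv> 0 :: nat"
abbreviation (input) "vS \<equiv> 1 :: nat"
abbreviation (input) "vB \<equiv> 2 :: nat"
abbreviation (input) "vD \<equiv> 3 :: nat"
abbreviation (input) "vL \<equiv> 4 :: nat"
abbreviation (input) "vW \<equiv> 5 :: nat"
abbreviation (input) "vN \<equiv> 6 :: nat"
abbreviation (input) "vP \<equiv> 7 :: nat"
abbreviation (input) "vQ \<equiv> 8 :: nat"
abbreviation (input) "vH \<equiv> 9 :: nat"
abbreviation (input) "vI \<equiv> 10 :: nat"
abbreviation (input) "vRow \<equiv> 11 :: nat"
abbreviation (input) "vJ \<equiv> 12 :: nat"
abbreviation (input) "vC \<equiv> 13 :: nat"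
abbreviation (input) "vX \<equiv> 14 :: nat"
abbreviation (input) "vT \<equiv> 15 :: nat"
abbreviation (input) "vZ \<equiv> 16 :: nat"
abbreviation (input) "vG \<equiv> 17 :: nat"

notation Plus (infixl "[+]" 65)
notation Minus (infixl "[-]" 65)

abbreviation Less :: "aexp \<Rightarrow> aexp \<Rightarrow> bexp" where
  "Less e1 e2 \<equiv> BNot (Leq e2 e1)"

definition noise_com :: com where
  "noise_com =
     Assign vT (Num 0) ;;
     While (Less (Var vT) (Var vD))
       (Draw vZ (Par 1 [+] Par 1 [+] Num 1) ;; Emit (Var vZ [+] Num 1) ;; Assign vT (Var vT [+] Num 1)) ;;
     Draw vC (Num 3) ;;
     Emit (Var vC [-] Num 3)"

definition walk_com :: com where
  "walk_com =
     While (Less (Var vT) (Var vL))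
       (Draw vZ (Num 2) ;; Assign vX (Var vX [+] Var vZ [+] Var vZ [-] Num 1) ;; Assign vT (Var vT [+] Num 1))"

text \<open>The number of tokens \<open>vH\<close> is fixed before \<open>vX\<close> is overwritten
  because both depend on the old index. \<open>vH = 0\<close> makes the second draw return 0, hence
  the padding token.\<close>

definition branch_step_com :: com where
  "branch_step_com =
     (let pick = BAnd (Leq (Num 1) (Var vX)) (BNot (BAnd (Leq (Var vG) (Num 0)) (Leq (Num 2) (Var vX))))
      in Draw vG (Num 3) ;;
         Select vH pick (Var vJ) (Num 0) ;;
         Select vX pick (Var vX [-] Num 1) (Var vX [-] Num 2) ;;
         Select vC (Leq (Var vG) (Num 0)) (Num 0 [-] Var vC) (Var vC) ;;
         Draw vZ (Var vH [+] Num 1) ;;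
         Select vZ (Leq (Var vZ) (Num 0)) (Num 1) (Table (Var vRow) (Var vZ [+] Var vZ [-] Num 2) [+] Num 2) ;;
         Emit (Var vZ) ;;
         Assign vT (Var vT [+] Num 1))"

definition branch_com :: com where
  "branch_com = While (Less (Var vT) (Var vD)) branch_step_com"

text \<open>The sign is cleared before the index, since the test for a walk that left the range
  reads \<open>vX\<close>.\<close>

definition row_tail_com :: com where
  "row_tail_com =
     Select vX (Leq (Var vX) (Num 0)) (Num 0 [-] Var vX) (Var vX) ;;
     Select vC (Leq (Var vX) (Var vD)) (Var vC) (Num 0) ;;
     Select vX (Leq (Var vX) (Var vD)) (Var vX) (Num 0) ;;
     Assign vT (Num 0) ;;
     branch_com ;;
     Emit (Var vC [-] Num 2)"

definition row_com :: com where
  "row_com =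
     Draw vRow (Par 2) ;;
     Draw vJ (Par 0 [+] Num 1) ;;
     Select vQ (Leq (Par 0) (Var vJ)) (Var vJ [+] Var vJ) (Var vJ [+] Var vJ [+] Num 1) ;;
     Assign vC (Table (Var vRow) (Var vQ) [-] Table (Var vRow) (Var vJ [+] Var vJ [-] Num 1)) ;;
     Assign vX (Num 0) ;;
     Assign vT (Num 0) ;;
     walk_com ;;
     row_tail_com"

definition trial_com :: com where
  "trial_com = Draw vZ (Num 2) ;; Cond (Leq (Var vZ) (Num 0)) noise_com row_com"

definition sample_com :: com where
  "sample_com = While (Less (Var vI) (Var vN)) (trial_com ;; Assign vI (Var vI [+] Num 1))"

definition trial_state :: "nat \<Rightarrow> nat \<Rightarrow> nat \<Rightarrow> nat \<Rightarrow> int list \<Rightarrow> ram_state \<Rightarrow> bool" where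
  "trial_state d w N i zs s \<longleftrightarrow> var s vD = int d \<and> var s vL = int w \<and> var s vN = int N \<and>
     var s vI = int i \<and> out s = zs"

section \<open>Laws and step counts of the sampling commands\<close>

context
  fixes I :: ram_input and k m n :: nat
  assumes pars: "int_pars I = [int k, int m, int n]"
begin

lemma par_simps: "fetch 0 (int_pars I) 0 = int k" "fetch 0 (int_pars I) 1 = int m" "fetch 0 (int_pars I) 2 = int n"
  by (simp_all add: pars fetch_def)

lemma implements_noise_com:
  assumes "trial_state d w N i zs s"
  shows "implements I noise_com s (6 * d + 10) (noise_trial m d) (\<lambda>z. trial_state d w N i (zs @ z))"
proof -
  let ?f = "\<lambda>ys. map_pmf (\<lambda>t. ys @ [t + 1]) (draw (2 * int m + 1))"
  let ?Q = "\<lambda>t ys s. trial_state d w N i (zs @ ys) s \<and> var s vT = int t"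
  have body: "implements I (Draw vZ (Par 1 [+] Par 1 [+] Num 1) ;; Emit (Var vZ [+] Num 1) ;; Assign vT (Var vT [+] Num 1))
      s 5 (?f ys) (?Q (Suc t))" if "?Q t ys s" for t ys s
    unfolding map_pmf_def
    apply (rule implements_le, rule implements_Draw_Semi)
    using that apply (simp add: par_simps)
     apply (rule implements_intros)+
    using that apply (auto simp: trial_state_def)
    done
  show ?thesis
    unfolding noise_com_def noise_trial_def map_pmf_def
    apply (rule implements_le, rule implements_Assign_Semi, rule implements_Semi)
      apply (rule implements_While[where Q = ?Q and n = d and t = 5, OF _ _ _, unfolded map_pmf_def])
    subgoal for j ys s' using body[where t = j and ys = ys and s = s'] by (simp add: trial_state_def map_pmf_def)
    subgoal by (simp add: trial_state_def)
    subgoal using assms by (simp add: trial_state_def)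
     apply (rule implements_Draw_Semi, simp)
     apply (rule implements_Emit)
     apply (simp add: trial_state_def)
    apply simp
    done
qed

text \<open>\<open>g\<close> records the registers that the walk must preserve for the
  branching.\<close>

lemma implements_walk_com:
  assumes "trial_state d w N i zs s" "var s vT = 0" "\<forall>v\<in>{vRow, vJ, vC}. var s v = g v" "var s vX = x"
  shows "implements I walk_com s (6 * w + 1) (iter_pmf w walk_step x)
    (\<lambda>x s. trial_state d w N i zs s \<and> (\<forall>v\<in>{vRow, vJ, vC}. var s v = g v) \<and> var s vX = x)"
proof -
  let ?Q = "\<lambda>t x s. trial_state d w N i zs s \<and> (\<forall>v\<in>{vRow, vJ, vC}. var s v = g v) \<and> var s vX = x \<and> var s vT = int t"
  have body: "implements I (Draw vZ (Num 2) ;; Assign vX (Var vX [+] Var vZ [+] Var vZ [-] Num 1) ;; Assign vT (Var vT [+] Num 1))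
      s 5 (walk_step x) (?Q (Suc t))" if "?Q t x s" for t x s
    unfolding map_pmf_def walk_step_def
    apply (rule implements_le, rule implements_Draw_Semi)
    using that apply simp
     apply (rule implements_intros)+
    using that apply (auto simp: trial_state_def)
    done
  have "implements I walk_com s (w * (5 + 1) + 1) (iter_pmf w walk_step x) (?Q w)"
    unfolding walk_com_def
    by (rule implements_While) (use body assms in \<open>auto simp: trial_state_def\<close>)
  then show ?thesis
    by (rule implements_mono) auto
qed

lemma implements_branch_com:
  assumes "trial_state d w N i zs s" "var s vT = 0" "var s vRow = rw" "var s vJ = j" "var s vX = x" "var s vC = c"
  shows "implements I branch_com s (20 * d + 1)
    (iter_pmf d (branch_step (fetch 0 (fetch [] (table I) rw)) j) (x, c, []))
    (\<lambda>(x, c, ys) s. trial_state d w N i (zs @ ys) s \<and> var s vC = c)"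
proof -
  let ?T = "fetch 0 (fetch [] (table I) rw)"
  define Q where "Q t v s = (case v of (x, c, ys) \<Rightarrow>
    trial_state d w N i (zs @ ys) s \<and> var s vT = int t \<and> var s vRow = rw \<and> var s vJ = j \<and> var s vX = x \<and> var s vC = c)"
    for t v s
  have "implements I branch_com s (d * (19 + 1) + 1) (iter_pmf d (branch_step ?T j) (x, c, [])) (Q d)"
    unfolding branch_com_def
  proof (rule implements_While)
    fix t v s assume t: "t < d" and v: "Q t v s"
    obtain x c ys where [simp]: "v = (x, c, ys)" by (cases v)
    show "bval I s (Less (Var vT) (Var vD)) \<and>
      implements I branch_step_com s 19 (branch_step ?T j v) (Q (Suc t))"
    proof
      show "bval I s (Less (Var vT) (Var vD))"
        using t v by (simp add: Q_def trial_state_def)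
      show "implements I branch_step_com s 19 (branch_step ?T j v) (Q (Suc t))"
        unfolding \<open>v = (x, c, ys)\<close> branch_step_com_def Let_def branch_step_eq map_pmf_def
        apply (rule implements_le, rule implements_Draw_Semi, simp)
         apply (rule implements_Select_Semi)+
         apply (rule implements_Draw_Semi)
          apply (use v in \<open>auto simp: Q_def pick_def\<close>)[1]
         apply (rule implements_intros)+
        using v apply (auto simp: Q_def trial_state_def pick_def token_def)
        done
    qed
  qed (use assms in \<open>auto simp: Q_def trial_state_def\<close>)
  then show ?thesis
    by (rule implements_mono) (auto simp: Q_def)
qed

abbreviation (input) "input_rows \<equiv> \<lambda>i. fetch 0 (fetch [] (table I) i)"

lemma implements_row_tail_com:
  assumes "trial_state d w N i zs s" "var s vRow = rw" "var s vJ = j" "var s vX = x" "var s vC = c"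
  shows "implements I row_tail_com s (20 * d + 14)
    (bind_pmf (iter_pmf d (branch_step (input_rows rw) j) (if \<bar>x\<bar> \<le> int d then (\<bar>x\<bar>, c, []) else (0, 0, [])))
      (\<lambda>v. return_pmf (case v of (x, c, ys) \<Rightarrow> ys @ [c - 2])))
    (\<lambda>z. trial_state d w N i (zs @ z))"
proof -
  have eq: "(if \<bar>x\<bar> \<le> int d then (\<bar>x\<bar>, c, []) else (0, 0, [])) =
      (if \<bar>x\<bar> \<le> int d then \<bar>x\<bar> else 0, if \<bar>x\<bar> \<le> int d then c else 0, [] :: int list)" by simp
  show ?thesis
    unfolding row_tail_com_def eq
    apply (rule implements_le)
     apply (rule implements_Select_Semi implements_Assign_Semi)+
     apply (rule implements_Semi)
      apply (rule implements_branch_com[where zs = zs and w = w and N = N and i = i])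
           apply (use assms in \<open>auto simp: trial_state_def\<close>)[6]
     apply (rule implements_Emit)
     apply (auto simp: trial_state_def)
    done
qed

lemma implements_row_com:
  assumes "trial_state d w N i zs s"
  shows "implements I row_com s (6 * w + 20 * d + 40)
    (bind_pmf (draw (int n)) (\<lambda>r. row_trial (input_rows r) k d w)) (\<lambda>z. trial_state d w N i (zs @ z))"
  unfolding row_com_def row_trial_def map_pmf_def
proof (rule implements_le)
  have *: "implements I (walk_com ;; row_tail_com) s' (6 * w + 1 + (20 * d + 14) + 1)
    (bind_pmf (iter_pmf w walk_step 0) (\<lambda>x. bind_pmf (iter_pmf d (branch_step (input_rows r) j)
       (if \<bar>x\<bar> \<le> int d then (\<bar>x\<bar>, coeff (input_rows r) k j, []) else (0, 0, [])))
       (\<lambda>v. return_pmf (case v of (x, c, ys) \<Rightarrow> ys @ [c - 2]))))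
    (\<lambda>z. trial_state d w N i (zs @ z))"
    if "trial_state d w N i zs s'" "var s' vT = 0" "var s' vRow = r" "var s' vJ = j"
      "var s' vC = coeff (input_rows r) k j" "var s' vX = 0" for s' r j
  proof (rule implements_Semi)
    define g where "g v = (if v = vRow then r else if v = vJ then j else coeff (input_rows r) k j)" for v
    show "implements I walk_com s' (6 * w + 1) (iter_pmf w walk_step 0)
      (\<lambda>x s. trial_state d w N i zs s \<and> (\<forall>v\<in>{vRow, vJ, vC}. var s v = g v) \<and> var s vX = x)"
      by (rule implements_walk_com) (use that in \<open>auto simp: g_def\<close>)
    show "implements I row_tail_com s'' (20 * d + 14) (bind_pmf (iter_pmf d (branch_step (input_rows r) j)
       (if \<bar>x\<bar> \<le> int d then (\<bar>x\<bar>, coeff (input_rows r) k j, []) else (0, 0, [])))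
       (\<lambda>v. return_pmf (case v of (x, c, ys) \<Rightarrow> ys @ [c - 2]))) (\<lambda>z. trial_state d w N i (zs @ z))"
      if "trial_state d w N i zs s'' \<and> (\<forall>v\<in>{vRow, vJ, vC}. var s'' v = g v) \<and> var s'' vX = x" for x s''
      by (rule implements_row_tail_com) (use that in \<open>auto simp: g_def\<close>)
  qed
  show "implements I
     (Draw vRow (Par 2) ;;
      Draw vJ (Par 0 [+] Num 1) ;;
      Select vQ (Leq (Par 0) (Var vJ)) (Var vJ [+] Var vJ) (Var vJ [+] Var vJ [+] Num 1) ;;
      Assign vC (Table (Var vRow) (Var vQ) [-] Table (Var vRow) (Var vJ [+] Var vJ [-] Num 1)) ;;
      Assign vX (Num 0) ;;
      Assign vT (Num 0) ;;
      walk_com ;;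
      row_tail_com) s ((((((((6 * w + 1 + (20 * d + 14) + 1) + 2) + 2) + 2) + 3) + 2) + 2))
    (bind_pmf (draw (int n)) (\<lambda>r. bind_pmf (draw (int k + 1)) (\<lambda>j. bind_pmf (iter_pmf w walk_step 0) (\<lambda>x.
       bind_pmf (iter_pmf d (branch_step (input_rows r) j)
         (if \<bar>x\<bar> \<le> int d then (\<bar>x\<bar>, coeff (input_rows r) k j, []) else (0, 0, [])))
       (\<lambda>v. return_pmf (case v of (x, c, ys) \<Rightarrow> ys @ [c - 2]))))))
    (\<lambda>z. trial_state d w N i (zs @ z))"
    apply (rule implements_Draw_Semi, simp add: par_simps)
    apply (rule implements_Draw_Semi, simp add: par_simps)
    apply (rule implements_Select_Semi, (rule implements_Assign_Semi)+)
    apply (rule *)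
    using assms apply (auto simp: trial_state_def coeff_def par_simps)
    done
qed simp

lemma implements_trial_com:
  assumes "trial_state d w N i zs s"
  shows "implements I trial_com s (6 * w + 20 * d + 50) (trial input_rows n k m d w) (\<lambda>z. trial_state d w N i (zs @ z))"
  unfolding trial_com_def trial_def
proof (rule implements_le, rule implements_Draw_Semi)
  fix r
  let ?s = "s\<lparr>var := (var s)(vZ := r)\<rparr>"
  have s: "trial_state d w N i zs ?s" using assms by (simp add: trial_state_def)
  have "implements I (Cond (Leq (Var vZ) (Num 0)) noise_com row_com) ?s (6 * w + 20 * d + 40 + 1)
    (if r \<le> 0 then noise_trial m d else bind_pmf (draw (int n)) (\<lambda>r. row_trial (input_rows r) k d w))
    (\<lambda>z. trial_state d w N i (zs @ z))"
    by (rule implements_Cond_same)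
       (use implements_row_com[OF s] in \<open>auto intro: implements_le[OF implements_noise_com[OF s]]\<close>)
  then show "implements I (Cond (Leq (Var vZ) (Num 0)) noise_com row_com) ?s (6 * w + 20 * d + 41)
    (if r \<le> 0 then noise_trial m d else bind_pmf (draw (int n)) (\<lambda>r. row_trial (input_rows r) k d w))
    (\<lambda>z. trial_state d w N i (zs @ z))" by (rule implements_le) simp
qed simp_all

lemma implements_sample_com:
  assumes "trial_state d w N 0 hdr s"
  shows "implements I sample_com s (N * (6 * w + 20 * d + 53) + 1) (sample N (trial input_rows n k m d w))
    (\<lambda>l s. out s = hdr @ concat l)"
proof -
  let ?Q = "\<lambda>i l. trial_state d w N i (hdr @ concat l)"
  have body: "implements I (trial_com ;; Assign vI (Var vI [+] Num 1)) s (6 * w + 20 * d + 50 + 1 + 1)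
    (map_pmf (\<lambda>z. l @ [z]) (trial input_rows n k m d w)) (?Q (Suc i) )" if "?Q i l s" for i l s
    unfolding map_pmf_def
    by (rule implements_Semi[OF implements_trial_com[OF that]])
       (rule implements_Assign, simp add: trial_state_def)
  have "implements I sample_com s (N * (6 * w + 20 * d + 50 + 1 + 1 + 1) + 1) (sample N (trial input_rows n k m d w)) (?Q N)"
    unfolding sample_com_def sample_def
  proof (rule implements_While[where Q = ?Q])
    show "bval I s (Less (Var vI) (Var vN)) \<and>
      implements I (trial_com ;; Assign vI (Var vI [+] Num 1)) s (6 * w + 20 * d + 50 + 1 + 1)
        (map_pmf (\<lambda>z. l @ [z]) (trial input_rows n k m d w)) (?Q (Suc i))" if "i < N" "?Q i l s" for i l s
      using body[OF that(2)] that by (simp add: trial_state_def)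
  qed (use assms in \<open>auto simp: trial_state_def\<close>)
  then show ?thesis
    by (rule implements_mono) (auto simp: trial_state_def)
qed

end

section \<open>Parameters and the sanitizer\<close>

text \<open>
  Squares and logarithms are replaced by quantities that a machine without multiplication finds by
  simple loops.
\<close>

definition root_bound :: "nat \<Rightarrow> nat" where
  "root_bound k = (LEAST r. k + 1 \<le> r * r)"

text \<open>About log2 of \<open>8 * (k + 1) / \<alpha>\<close>. The 8, reachable by doublings,
  leaves room for three error terms of \<alpha> / 8 within a bias of \<alpha> / 2.\<close>

definition level :: "nat \<Rightarrow> real \<Rightarrow> nat" where
  "level k \<alpha> = (LEAST l. 8 * (real k + 1) \<le> \<alpha> * 2 ^ l)"

text \<open>With R the root and L the level, the walk has
  \<open>w = R^2 * L \<ge> (k + 1) * L\<close> steps, so a failing conjunction contributes at most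
  \<open>exp (- L)\<close>. The cutoff \<open>d = 2 * R * L\<close> makes the Chernoff exponent
  \<open>- d^2 / (2 * w) = - 2 * L\<close>.\<close>

definition deg :: "nat \<Rightarrow> real \<Rightarrow> nat" where
  "deg k \<alpha> = 2 * root_bound k * level k \<alpha>"

definition walk_length :: "nat \<Rightarrow> real \<Rightarrow> nat" where
  "walk_length k \<alpha> = root_bound k * root_bound k * level k \<alpha>"

text \<open>Undoes three averages: half of the trials are noise, one of \<open>k + 1\<close>
  coefficients is drawn, and each of \<open>d\<close> branchings divides by 3.\<close>

definition weight :: "nat \<Rightarrow> nat \<Rightarrow> nat" where
  "weight k d = 2 * (k + 1) * 3 ^ d"

text \<open>In \<open>27 ^ d\<close>, \<open>9 ^ d\<close> matches the square of the weight and
  \<open>3 ^ d\<close> outweighs the squares of \<open>k + 1\<close> and 1 / \<alpha>. The factor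
  \<open>m + 5\<close> pays for the union bound over \<open>2 ^ m\<close> queries.\<close>

definition num_trials :: "nat \<Rightarrow> nat \<Rightarrow> nat" where
  "num_trials m d = (m + 5) * 27 ^ d"

text \<open>The number of trials times \<open>3 * (2 * m + 1) ^ d\<close>; divided by
  \<open>n\<close>, it bounds the total privacy loss.\<close>

definition privacy_bound :: "nat \<Rightarrow> nat \<Rightarrow> nat" where
  "privacy_bound m d = 3 * (m + 5) * 27 ^ d * (2 * m + 1) ^ d"

lemma root_bound: "k + 1 \<le> root_bound k * root_bound k"
  unfolding root_bound_def by (rule LeastI[of _ "k + 1"]) simp

lemma below_root_bound: "r < root_bound k \<Longrightarrow> r * r < k + 1"
  unfolding root_bound_def by (rule not_le_imp_less) (erule not_less_Least)

lemma level:
  assumes "\<alpha> > 0"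
  shows "8 * (real k + 1) \<le> \<alpha> * 2 ^ level k \<alpha>"
proof -
  obtain l where "8 * (real k + 1) / \<alpha> < 2 ^ l"
    using real_arch_pow[of 2] by auto
  then have "8 * (real k + 1) \<le> \<alpha> * 2 ^ l"
    using assms by (simp add: field_simps)
  then show ?thesis
    unfolding level_def by (rule LeastI)
qed

lemma below_level: "l < level k \<alpha> \<Longrightarrow> \<alpha> * 2 ^ l < 8 * (real k + 1)"
  unfolding level_def by (rule not_le_imp_less) (erule not_less_Least)

abbreviation (input) times3 :: "aexp \<Rightarrow> aexp" where "times3 e \<equiv> e [+] e [+] e"
abbreviation (input) double :: "aexp \<Rightarrow> aexp" where "double e \<equiv> e [+] e"

section \<open>Computing the parameters by additions\<close>

definition root_com :: com where
  "root_com = While (Less (Var vS) (Par 0 [+] Num 1))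
     (Assign vS (Var vS [+] Var vR [+] Var vR [+] Num 1) ;; Assign vR (Var vR [+] Num 1))"

text \<open>Degree and walk length are linear in the level, so they are accumulated alongside the
  powers of two, which avoids two multiplications.\<close>

definition level_com :: com where
  "level_com = While (BNot (RealLeq (double (double (double (Par 0 [+] Num 1)))) 0 (Var vB)))
     (Assign vB (double (Var vB)) ;; Assign vD (Var vD [+] Var vR [+] Var vR) ;; Assign vL (Var vL [+] Var vS))"

definition mult_com :: com where
  "mult_com = While (Less (Var vH) (Par 1 [+] Par 1 [+] Num 1))
     (Assign vP (Var vP [+] Var vQ) ;; Assign vH (Var vH [+] Num 1))"

definition power_com :: com where
  "power_com = While (Less (Var vI) (Var vD))
     (Assign vW (times3 (Var vW)) ;; Assign vN (times3 (times3 (times3 (Var vN)))) ;;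
      Assign vQ (times3 (times3 (times3 (Var vP)))) ;; Assign vP (Num 0) ;; Assign vH (Num 0) ;;
      mult_com ;; Assign vI (Var vI [+] Num 1))"

definition params_com :: com where
  "params_com =
     root_com ;; Assign vB (Num 1) ;; level_com ;;
     Assign vW (double (Par 0 [+] Num 1)) ;; Assign vN (Par 1 [+] Num 5) ;; Assign vP (times3 (Var vN)) ;;
     power_com"

text \<open>Both tests depend on the parameters only, so the choice of branch is the same for all
  databases. The header with weight and number of trials saves the evaluator from recomputing
  them.\<close>

definition san_com :: com where
  "san_com = Cond (RealLeq (Num 1) 0 (Num 2)) Skip
     (params_com ;;
      Cond (RealLeq (Var vP) 1 (Par 2))
        (Emit (Var vW) ;; Emit (Var vN) ;; Assign vI (Num 0) ;; sample_com)
        Skip)"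

context
  fixes I :: ram_input and k m n :: nat and \<alpha> \<epsilon> :: real
  assumes pars: "int_pars I = [int k, int m, int n]" "real_pars I = [\<alpha>, \<epsilon>]"
begin

lemma pars_simps [simp]:
  "fetch 0 (int_pars I) 0 = int k" "fetch 0 (int_pars I) 1 = int m" "fetch 0 (int_pars I) 2 = int n"
  "fetch 0 (real_pars I) 0 = \<alpha>" "fetch 0 (real_pars I) 1 = \<epsilon>"
  by (simp_all add: pars fetch_def)

lemma implements_root_com:
  assumes "var s vS = 0" "var s vR = 0" "var s vD = 0" "var s vL = 0" "var s vI = 0" "out s = []"
  shows "implements I root_com s (4 * root_bound k + 1) (return_pmf ())
    (\<lambda>_ s. var s vR = int (root_bound k) \<and> var s vS = int (root_bound k * root_bound k) \<and>
       var s vD = 0 \<and> var s vL = 0 \<and> var s vI = 0 \<and> out s = [])"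
proof -
  let ?Q = "\<lambda>r (s :: ram_state). var s vR = int r \<and> var s vS = int (r * r) \<and> var s vD = 0 \<and> var s vL = 0 \<and> var s vI = 0 \<and> out s = []"
  have "implements I root_com s (root_bound k * (3 + 1) + 1) (return_pmf ()) (\<lambda>_. ?Q (root_bound k))"
    unfolding root_com_def
  proof (rule implements_While_det[where Q = ?Q])
    fix r s assume r: "r < root_bound k" and Q: "?Q r s"
    have r2: "int (r * r) < int k + 1" using below_root_bound[OF r] by linarith
    show "bval I s (Less (Var vS) (Par 0 [+] Num 1)) \<and>
      implements I (Assign vS (Var vS [+] Var vR [+] Var vR [+] Num 1) ;; Assign vR (Var vR [+] Num 1)) s 3
        (return_pmf ()) (\<lambda>_. ?Q (Suc r))"
      apply (rule conjI)
      using r2 Q apply simp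
      apply (rule implements_le, (rule implements_intros)+)
      using Q apply (simp_all add: algebra_simps)
      done
  next
    fix s assume Q: "?Q (root_bound k) s"
    have "int k + 1 \<le> int (root_bound k * root_bound k)"
      using root_bound[of k] by linarith
    then show "\<not> bval I s (Less (Var vS) (Par 0 [+] Num 1))" using Q by simp
  qed (use assms in simp)
  then show ?thesis by (simp add: mult.commute)
qed

lemma implements_level_com:
  assumes "\<alpha> > 0" "var s vR = int R" "var s vS = int S" "var s vB = 1" "var s vD = 0" "var s vL = 0" "var s vI = 0" "out s = []"
  shows "implements I level_com s (6 * level k \<alpha> + 1) (return_pmf ())
    (\<lambda>_ s. var s vD = int (2 * R * level k \<alpha>) \<and> var s vL = int (S * level k \<alpha>) \<and> var s vI = 0 \<and> out s = [])"
proof -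
  let ?Q = "\<lambda>l (s :: ram_state). var s vR = int R \<and> var s vS = int S \<and> var s vB = 2 ^ l \<and>
    var s vD = int (2 * R * l) \<and> var s vL = int (S * l) \<and> var s vI = 0 \<and> out s = []"
  have "implements I level_com s (level k \<alpha> * (5 + 1) + 1) (return_pmf ()) (\<lambda>_. ?Q (level k \<alpha>))"
    unfolding level_com_def
  proof (rule implements_While_det[where Q = ?Q])
    fix l s assume l: "l < level k \<alpha>" and Q: "?Q l s"
    show "bval I s (BNot (RealLeq (double (double (double (Par 0 [+] Num 1)))) 0 (Var vB))) \<and>
      implements I (Assign vB (double (Var vB)) ;; Assign vD (Var vD [+] Var vR [+] Var vR) ;; Assign vL (Var vL [+] Var vS)) s 5
        (return_pmf ()) (\<lambda>_. ?Q (Suc l))"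
      apply (rule conjI)
      using below_level[OF l] Q apply simp
      apply (rule implements_le, (rule implements_intros)+)
      using Q apply (simp_all add: algebra_simps)
      done
  next
    fix s assume "?Q (level k \<alpha>) s"
    then show "\<not> bval I s (BNot (RealLeq (double (double (double (Par 0 [+] Num 1)))) 0 (Var vB)))"
      using level[OF assms(1), of k] by simp
  qed (use assms in simp)
  then show ?thesis by (rule implements_mono) (auto simp: mult.commute)
qed

lemma implements_mult_com:
  assumes "var s vH = 0" "var s vP = 0"
  shows "implements I mult_com s ((2 * m + 1) * 4 + 1) (return_pmf ())
    (\<lambda>_ s'. var s' vP = var s vQ * int (2 * m + 1) \<and> (\<forall>v\<in>{vD, vL, vW, vN, vI}. var s' v = var s v) \<and> out s' = out s)"
proof -
  let ?Q = "\<lambda>h (s' :: ram_state). var s' vH = int h \<and> var s' vQ = var s vQ \<and> var s' vP = var s vQ * int h \<and>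
    (\<forall>v\<in>{vD, vL, vW, vN, vI}. var s' v = var s v) \<and> out s' = out s"
  have "implements I mult_com s ((2 * m + 1) * (3 + 1) + 1) (return_pmf ()) (\<lambda>_. ?Q (2 * m + 1))"
    unfolding mult_com_def
  proof (rule implements_While_det[where Q = ?Q])
    fix h s' assume h: "h < 2 * m + 1" and Q: "?Q h s'"
    show "bval I s' (Less (Var vH) (Par 1 [+] Par 1 [+] Num 1)) \<and>
      implements I (Assign vP (Var vP [+] Var vQ) ;; Assign vH (Var vH [+] Num 1)) s' 3 (return_pmf ()) (\<lambda>_. ?Q (Suc h))"
      apply (rule conjI)
      using h Q apply simp
      apply (rule implements_le, (rule implements_intros)+)
      using Q apply (simp_all add: algebra_simps)
      done
  qed (use assms in simp_all)
  then show ?thesis by (rule implements_mono) auto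
qed

lemma implements_power_com:
  assumes "var s vD = int d" "var s vL = int w" "var s vI = 0" "out s = []"
    "var s vW = int (2 * (k + 1))" "var s vN = int (m + 5)" "var s vP = int (3 * (m + 5))"
  shows "implements I power_com s (d * (8 * m + 18) + 1) (return_pmf ())
    (\<lambda>_ s. var s vD = int d \<and> var s vL = int w \<and> var s vW = int (weight k d) \<and>
       var s vN = int (num_trials m d) \<and> var s vP = int (privacy_bound m d) \<and> out s = [])"
proof -
  let ?Q = "\<lambda>i (s :: ram_state). var s vD = int d \<and> var s vL = int w \<and> var s vI = int i \<and> var s vW = int (weight k i) \<and>
    var s vN = int (num_trials m i) \<and> var s vP = int (privacy_bound m i) \<and> out s = []"
  have "implements I power_com s (d * ((((((((2 * m + 1) * 4 + 1) + 1 + 1) + 2) + 2) + 2) + 2) + 2 + 1) + 1) (return_pmf ()) (\<lambda>_. ?Q d)"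
    unfolding power_com_def
  proof (rule implements_While_det[where Q = ?Q])
    fix i s assume i: "i < d" and Q: "?Q i s"
    show "bval I s (Less (Var vI) (Var vD)) \<and>
      implements I (Assign vW (times3 (Var vW)) ;; Assign vN (times3 (times3 (times3 (Var vN)))) ;;
      Assign vQ (times3 (times3 (times3 (Var vP)))) ;; Assign vP (Num 0) ;; Assign vH (Num 0) ;;
      mult_com ;; Assign vI (Var vI [+] Num 1)) s ((((((((2 * m + 1) * 4 + 1) + 1 + 1) + 2) + 2) + 2) + 2) + 2)
      (return_pmf ()) (\<lambda>_. ?Q (Suc i))"
      apply (rule conjI)
      using i Q apply simp
      apply (rule implements_Assign_Semi)+
      apply (rule implements_Semi_det, rule implements_mult_com, simp, simp)
      apply (rule implements_Assign)
      using Q apply (simp add: weight_def num_trials_def privacy_bound_def algebra_simps)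
      done
  qed (use assms in \<open>simp_all add: weight_def num_trials_def privacy_bound_def algebra_simps\<close>)
  then show ?thesis by (rule implements_mono) (auto simp: algebra_simps)
qed

lemma implements_params_com:
  assumes \<alpha>: "\<alpha> > 0" and s: "var s = (\<lambda>_. 0)" "out s = []" and d: "d = deg k \<alpha>" and w: "w = walk_length k \<alpha>"
  shows "implements I params_com s (4 * root_bound k + 6 * level k \<alpha> + d * (8 * m + 18) + 20) (return_pmf ())
    (\<lambda>_ s. var s vD = int d \<and> var s vL = int w \<and> var s vW = int (weight k d) \<and>
       var s vN = int (num_trials m d) \<and> var s vP = int (privacy_bound m d) \<and> out s = [])"
  unfolding params_com_def
  apply (rule implements_le)
   apply (rule implements_Semi_det, rule implements_root_com)
         apply (use s in simp_all)[6]
   apply (rule implements_Assign_Semi)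
   apply (rule implements_Semi_det,
       rule implements_level_com[where R = "root_bound k" and S = "root_bound k * root_bound k", OF \<alpha>])
          apply (simp_all)[7]
   apply (rule implements_Assign_Semi)+
   apply (rule implements_power_com)
         apply (simp_all add: d w deg_def walk_length_def)
  done

lemma implements_map:
  assumes "implements I c s t p (\<lambda>v. Q (g v))"
  shows "implements I c s t (map_pmf g p) Q"
  using assms unfolding implements_def pmf.rel_map .

lemma implements_san_com:
  assumes \<alpha>: "\<alpha> > 0" and d: "d = deg k \<alpha>" and w: "w = walk_length k \<alpha>" and N: "N = num_trials m d"
  shows "implements I san_com \<lparr>var = (\<lambda>_. 0), cell = (\<lambda>_ _. 0), out = []\<rparr>
    (if 1 \<le> 2 * \<alpha> then 2 else 4 * root_bound k + 6 * level k \<alpha> + d * (8 * m + 18) + N * (6 * w + 20 * d + 53) + 40)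
    (if 1 \<le> 2 * \<alpha> then return_pmf []
     else if real (privacy_bound m d) \<le> \<epsilon> * real n
     then map_pmf (\<lambda>l. [int (weight k d), int N] @ concat l) (sample N (trial (\<lambda>i. fetch 0 (fetch [] (table I) i)) n k m d w))
     else return_pmf [])
    (\<lambda>v s. out s = v)"
proof (cases "1 \<le> 2 * \<alpha>")
  case True
  then show ?thesis unfolding san_com_def
    by (auto intro!: implements_le[OF implements_Cond_same[where t = 1]] implements_Skip[THEN implements_le])
next
  case False
  let ?p = "if real (privacy_bound m d) \<le> \<epsilon> * real n
     then map_pmf (\<lambda>l. [int (weight k d), int N] @ concat l) (sample N (trial (\<lambda>i. fetch 0 (fetch [] (table I) i)) n k m d w))
     else return_pmf []"
  have "implements I san_com \<lparr>var = (\<lambda>_. 0), cell = (\<lambda>_ _. 0), out = []\<rparr>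
    ((4 * root_bound k + 6 * level k \<alpha> + d * (8 * m + 18) + 20) + (max (N * (6 * w + 20 * d + 53) + 1 + 7) 1 + 1) + 1 + 1) ?p (\<lambda>v s. out s = v)"
    unfolding san_com_def
  proof (rule implements_Cond_same)
    show "implements I
       (params_com ;; Cond (RealLeq (Var vP) 1 (Par 2))
        (Emit (Var vW) ;; Emit (Var vN) ;; Assign vI (Num 0) ;; sample_com) Skip)
       \<lparr>var = (\<lambda>_. 0), cell = (\<lambda>_ _. 0), out = []\<rparr>
       ((4 * root_bound k + 6 * level k \<alpha> + d * (8 * m + 18) + 20) + (max (N * (6 * w + 20 * d + 53) + 1 + 7) 1 + 1) + 1) ?p (\<lambda>v s. out s = v)"
    proof (rule implements_Semi_det, rule implements_params_com[OF \<alpha> _ _ d w])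
      fix s :: ram_state
      assume s: "var s vD = int d \<and> var s vL = int w \<and> var s vW = int (weight k d) \<and>
        var s vN = int (num_trials m d) \<and> var s vP = int (privacy_bound m d) \<and> out s = []"
      have b: "bval I s (RealLeq (Var vP) 1 (Par 2)) \<longleftrightarrow> real (privacy_bound m d) \<le> \<epsilon> * real n"
        using s by simp
      show "implements I (Cond (RealLeq (Var vP) 1 (Par 2))
        (Emit (Var vW) ;; Emit (Var vN) ;; Assign vI (Num 0) ;; sample_com) Skip) s
        (max (N * (6 * w + 20 * d + 53) + 1 + 7) 1 + 1) ?p (\<lambda>v s. out s = v)"
        unfolding b[symmetric]
      proof (rule implements_Cond)
        show "implements I (Emit (Var vW) ;; Emit (Var vN) ;; Assign vI (Num 0) ;; sample_com) s
          (N * (6 * w + 20 * d + 53) + 1 + 7)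
          (map_pmf (\<lambda>l. [int (weight k d), int N] @ concat l) (sample N (trial (\<lambda>i. fetch 0 (fetch [] (table I) i)) n k m d w)))
          (\<lambda>v s. out s = v)"
          apply (rule implements_map)
          apply (rule implements_le)
           apply (rule implements_Emit_Semi implements_Assign_Semi)+
           apply (rule implements_mono[OF implements_sample_com[OF pars(1) ]])
          using s apply (auto simp: trial_state_def N)
          done
      qed (use s in \<open>auto intro: implements_Skip[unfolded One_nat_def]\<close>)
    qed simp_all
  qed (use False in simp)
  then show ?thesis using False by (auto elim!: implements_le)
qed

end

section \<open>The evaluator\<close>

text \<open>\<open>a\<close> is the sum over the finished trials, and \<open>v\<close> is
  \<open>W\<close> until a token of the current trial fails, then 0. A sign closes the trial and
  resets \<open>v\<close>. Adding \<open>W\<close> in place of 1 applies the weight without a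
  multiplication.\<close>

definition ev_step :: "int \<Rightarrow> bool list \<Rightarrow> int \<times> int \<Rightarrow> int \<Rightarrow> int \<times> int" where
  "ev_step W y = (\<lambda>(a, v) z.
     (if z \<le> - 3 then a - v else if - 1 \<le> z \<and> z \<le> 0 then a + v else a,
      if z \<le> 0 then W else if token_ok y z then v else 0))"

lemma foldl_ev_step_tokens:
  "set zs \<subseteq> {1..} \<Longrightarrow> foldl (ev_step W y) (a, v) zs = (a, if list_all (token_ok y) zs then v else 0)"
  by (induction zs arbitrary: v) (auto simp: ev_step_def)

lemma foldl_ev_step_trial:
  assumes "z \<in> trial_range m d"
  shows "\<exists>b. foldl (ev_step W y) (a, W) z = (a + b, W) \<and> real_of_int b = real_of_int W * trial_value (token_ok y) z"
proof -
  obtain zs c where z: "z = zs @ [c]" "set zs \<subseteq> {1..2 * int m + 1}" "c \<in> {-3..-1}"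
    using assms by (auto simp: trial_range_def)
  have "set zs \<subseteq> {1..}" using z(2) by auto
  moreover have "c = -3 \<or> c = -2 \<or> c = -1" using z(3) by auto
  ultimately show ?thesis
    unfolding z(1) foldl_append foldl_ev_step_tokens[OF \<open>set zs \<subseteq> {1..}\<close>]
    by (intro exI[of _ "(if list_all (token_ok y) zs then W else 0) * (c + 2)"])
       (auto simp: ev_step_def trial_value_def)
qed

lemma foldl_ev_step_concat:
  assumes "set l \<subseteq> trial_range m d"
  shows "real_of_int (fst (foldl (ev_step W y) (a, W) (concat l))) =
    real_of_int a + real_of_int W * sum_list (map (trial_value (token_ok y)) l)"
  using assms
proof (induction l arbitrary: a)
  case (Cons z l)
  then obtain b where "foldl (ev_step W y) (a, W) z = (a + b, W)"
    "real_of_int b = real_of_int W * trial_value (token_ok y) z"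
    using foldl_ev_step_trial[of z m d W y a] by auto
  then show ?case using Cons by (simp add: algebra_simps)
qed simp

text \<open>Array 0 is indexed by tokens: \<open>2 * i + 2\<close> belongs to the positive literal
  \<open>i\<close>, \<open>2 * i + 3\<close> to the negative one. A cell is 1 if the literal is
  false, that is, if the token is satisfied.\<close>

definition literals_com :: com where
  "literals_com = While (Less (Var vI) (Par 1))
     (Write 0 (Var vI [+] Var vI [+] Num 2) (Num 1 [-] Table (Num 1) (Var vI)) ;;
      Write 0 (Var vI [+] Var vI [+] Num 3) (Table (Num 1) (Var vI)) ;;
      Assign vI (Var vI [+] Num 1))"

definition fold_com :: com where
  "fold_com = While (BNot (BAnd (Leq (Table (Num 0) (Var vT)) (Num 0)) (Leq (Num 0) (Table (Num 0) (Var vT)))))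
     (Assign vZ (Table (Num 0) (Var vT)) ;;
      Select vC (Leq (Var vZ) (Num (-3))) (Var vC [-] Var vX) (Var vC) ;;
      Select vC (BAnd (Leq (Num (-1)) (Var vZ)) (Leq (Var vZ) (Num 0))) (Var vC [+] Var vX) (Var vC) ;;
      Select vX (Leq (Var vZ) (Num 0)) (Table (Num 0) (Num 0)) (Var vX) ;;
      Select vX (BAnd (Leq (Num 1) (Var vZ)) (Leq (Cell 0 (Var vZ)) (Num 0))) (Num 0) (Var vX) ;;
      Assign vT (Var vT [+] Num 1))"

definition ev_com :: com where
  "ev_com = Cond (RealLeq (Num 1) 0 (Num 2))
     (Emit (Num 1) ;; Emit (Num 2))
     (literals_com ;; Write 0 (Num 1) (Num 1) ;;
      Assign vX (Table (Num 0) (Num 0)) ;; Assign vT (Num 2) ;;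
      fold_com ;; Emit (Var vC) ;; Emit (Table (Num 0) (Num 1)))"

lemma draw_free_ev_com: "draw_free ev_com"
  by (simp add: ev_com_def literals_com_def fold_com_def)

lemma fetch_int: "fetch z xs (int i) = (if i < length xs then xs ! i else z)"
  by (simp add: fetch_def)

context
  fixes I :: ram_input and k m n :: nat and \<alpha> \<epsilon> :: real and Z :: "int list" and y :: "bool list"
  assumes pars: "int_pars I = [int k, int m, int n]" "real_pars I = [\<alpha>, \<epsilon>]" "table I = [Z, map of_bool y]"
    and y: "length y = m"
begin

lemma ev_pars_simps [simp]:
  "fetch 0 (int_pars I) 1 = int m" "fetch 0 (int_pars I) (Suc 0) = int m" "fetch 0 (real_pars I) 0 = \<alpha>"
  "fetch [] (table I) 0 = Z" "fetch [] (table I) 1 = map of_bool y"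
  by (simp_all add: pars fetch_def)

definition literals_state :: "ram_state \<Rightarrow> bool" where
  "literals_state s \<longleftrightarrow> (\<forall>z\<in>{1..2 * int m + 1}. cell s 0 z \<le> 0 \<longleftrightarrow> \<not> token_ok y z)"

lemma implements_literals_com:
  assumes "var s vI = 0" "var s vC = 0" "out s = []"
  shows "implements I literals_com s (6 * m + 1) (return_pmf ())
    (\<lambda>_ s. (\<forall>i<m. cell s 0 (2 * int i + 2) = of_bool (\<not> y ! i) \<and> cell s 0 (2 * int i + 3) = of_bool (y ! i)) \<and>
       var s vC = 0 \<and> out s = [])"
proof -
  let ?Q = "\<lambda>i (s :: ram_state). var s vI = int i \<and>
    (\<forall>j<i. cell s 0 (2 * int j + 2) = of_bool (\<not> y ! j) \<and> cell s 0 (2 * int j + 3) = of_bool (y ! j)) \<and>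
    var s vC = 0 \<and> out s = []"
  have "implements I literals_com s (m * (5 + 1) + 1) (return_pmf ()) (\<lambda>_. ?Q m)"
    unfolding literals_com_def
  proof (rule implements_While_det[where Q = ?Q])
    fix i and s :: ram_state assume i: "i < m" and Q: "?Q i s"
    have [simp]: "fetch 0 (map of_bool y) (int i) = (of_bool (y ! i) :: int)"
      using i y by (simp add: fetch_int)
    show "bval I s (Less (Var vI) (Par 1)) \<and>
      implements I (Write 0 (Var vI [+] Var vI [+] Num 2) (Num 1 [-] Table (Num 1) (Var vI)) ;;
      Write 0 (Var vI [+] Var vI [+] Num 3) (Table (Num 1) (Var vI)) ;;
      Assign vI (Var vI [+] Num 1)) s 5 (return_pmf ()) (\<lambda>_. ?Q (Suc i))"
      apply (rule conjI)
      using i Q apply simp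
      apply (rule implements_le, (rule implements_intros)+)
      using Q apply (auto simp: less_Suc_eq; presburger)[1]
      apply simp
      done
  qed (use assms in simp_all)
  then show ?thesis by (rule implements_mono) auto
qed

lemma literals_stateI:
  assumes "\<forall>i<m. cell s 0 (2 * int i + 2) = of_bool (\<not> y ! i) \<and> cell s 0 (2 * int i + 3) = of_bool (y ! i)"
    and "cell s 0 1 = 1"
  shows "literals_state s"
  unfolding literals_state_def
proof
  fix z assume z: "z \<in> {1..2 * int m + 1}"
  consider "z = 1" | i where "i < m" "z = 2 * int i + 2" | i where "i < m" "z = 2 * int i + 3"
  proof -
    have "z = 1 \<or> (nat ((z - 2) div 2) < m \<and> (z = 2 * int (nat ((z - 2) div 2)) + 2 \<or> z = 2 * int (nat ((z - 2) div 2)) + 3))"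
      using z by auto
    then show ?thesis using that by blast
  qed
  then show "cell s 0 z \<le> 0 \<longleftrightarrow> \<not> token_ok y z"
  proof cases
    case (2 i)
    then show ?thesis using assms(1) token_ok_lit[of y "Pos i"] by simp
  next
    case (3 i)
    then show ?thesis using assms(1) token_ok_lit[of y "Neg i"] by (simp add: add.assoc)
  qed (use assms(2) in simp)
qed

lemma implements_fold_com:
  assumes Z: "set (drop 2 Z) \<subseteq> {-3..-1} \<union> {1..2 * int m + 1}"
    and s: "literals_state s" "var s vX = fetch 0 Z 0" "var s vC = 0" "var s vT = 2" "out s = []"
  shows "implements I fold_com s (20 * length Z + 1) (return_pmf ())
    (\<lambda>_ s. var s vC = fst (foldl (ev_step (fetch 0 Z 0) y) (0, fetch 0 Z 0) (drop 2 Z)) \<and> out s = [])"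
proof -
  let ?ts = "drop 2 Z" and ?W = "fetch 0 Z 0"
  let ?Q = "\<lambda>t (s :: ram_state). literals_state s \<and> var s vT = int t + 2 \<and>
    (var s vC, var s vX) = foldl (ev_step ?W y) (0, ?W) (take t ?ts) \<and> out s = []"
  have tok: "fetch 0 Z (int t + 2) = (if t < length ?ts then ?ts ! t else 0)" for t
    using fetch_int[of 0 Z "t + 2"] by (auto simp: add.commute)
  have "implements I fold_com s (length ?ts * (15 + 1) + 1) (return_pmf ()) (\<lambda>_. ?Q (length ?ts))"
    unfolding fold_com_def
  proof (rule implements_While_det[where Q = ?Q])
    fix t and s :: ram_state assume t: "t < length ?ts" and Q: "?Q t s"
    let ?z = "?ts ! t"
    have z: "?z \<in> {-3..-1} \<union> {1..2 * int m + 1}"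
      using Z t nth_mem by blast
    have tok_t: "fetch 0 Z (int t + 2) = ?z" using tok[of t] t by simp
    have step: "foldl (ev_step ?W y) (0, ?W) (take (Suc t) ?ts) = ev_step ?W y (var s vC, var s vX) ?z"
      using Q t by (simp add: take_Suc_conv_app_nth del: drop_drop take_drop)
    have cell: "1 \<le> ?z \<Longrightarrow> cell s 0 ?z \<le> 0 \<longleftrightarrow> \<not> token_ok y ?z"
      using Q z by (auto simp: literals_state_def)
    have Q': "literals_state s" "var s vT = int t + 2" "out s = []" using Q by auto
    show "bval I s (BNot (BAnd (Leq (Table (Num 0) (Var vT)) (Num 0)) (Leq (Num 0) (Table (Num 0) (Var vT))))) \<and>
      implements I (Assign vZ (Table (Num 0) (Var vT)) ;;
      Select vC (Leq (Var vZ) (Num (-3))) (Var vC [-] Var vX) (Var vC) ;;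
      Select vC (BAnd (Leq (Num (-1)) (Var vZ)) (Leq (Var vZ) (Num 0))) (Var vC [+] Var vX) (Var vC) ;;
      Select vX (Leq (Var vZ) (Num 0)) (Table (Num 0) (Num 0)) (Var vX) ;;
      Select vX (BAnd (Leq (Num 1) (Var vZ)) (Leq (Cell 0 (Var vZ)) (Num 0))) (Num 0) (Var vX) ;;
      Assign vT (Var vT [+] Num 1)) s 15 (return_pmf ()) (\<lambda>_. ?Q (Suc t))"
      unfolding step
      apply (rule conjI)
      using z Q' apply (auto simp: tok_t)[1]
      apply (rule implements_le, (rule implements_intros)+)
      using Q' cell apply (auto simp: tok_t ev_step_def literals_state_def)
      done
  next
    fix s assume "?Q (length ?ts) s"
    then show "\<not> bval I s (BNot (BAnd (Leq (Table (Num 0) (Var vT)) (Num 0)) (Leq (Num 0) (Table (Num 0) (Var vT)))))"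
      using tok[of "length ?ts"] by simp
  qed (use s in simp)
  then show ?thesis
    by (rule implements_mono) (auto simp: fst_def split: prod.splits)
qed

lemma implements_ev_com:
  assumes Z: "set (drop 2 Z) \<subseteq> {-3..-1} \<union> {1..2 * int m + 1}"
  shows "implements I ev_com \<lparr>var = (\<lambda>_. 0), cell = (\<lambda>_ _. 0), out = []\<rparr>
    (if 1 \<le> 2 * \<alpha> then 4 else 6 * m + 20 * length Z + 30) (return_pmf ())
    (\<lambda>_ s. out s = (if 1 \<le> 2 * \<alpha> then [1, 2]
       else [fst (foldl (ev_step (fetch 0 Z 0) y) (0, fetch 0 Z 0) (drop 2 Z)), fetch 0 Z 1]))"
proof (cases "1 \<le> 2 * \<alpha>")
  case True
  have "implements I ev_com \<lparr>var = (\<lambda>_. 0), cell = (\<lambda>_ _. 0), out = []\<rparr> (1 + 2 + 1) (return_pmf ()) (\<lambda>_ s. out s = [1, 2])"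
    unfolding ev_com_def
    by (rule implements_Cond_same, rule implements_Emit_Semi, rule implements_Emit) (use True in simp_all)
  then show ?thesis using True by (auto elim!: implements_le)
next
  case False
  have "implements I ev_com \<lparr>var = (\<lambda>_. 0), cell = (\<lambda>_ _. 0), out = []\<rparr>
    ((6 * m + 1) + (((20 * length Z + 1) + (1 + 2) + 1 + 2 + 2) + 2) + 1 + 1) (return_pmf ())
    (\<lambda>_ s. out s = [fst (foldl (ev_step (fetch 0 Z 0) y) (0, fetch 0 Z 0) (drop 2 Z)), fetch 0 Z 1])"
    unfolding ev_com_def
    apply (rule implements_Cond_same)
    using False apply simp
    apply (rule implements_Semi_det, rule implements_literals_com)
       apply (simp_all)[3]
    apply (rule implements_Write_Semi implements_Assign_Semi)+
    apply (rule implements_Semi_det, rule implements_fold_com[OF Z])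
         apply (rule literals_stateI)
          apply (auto)[6]
    apply (rule implements_Emit_Semi, rule implements_Emit)
    apply simp
    done
  then show ?thesis using False by (auto elim!: implements_le)
qed

end

section \<open>Parameter estimates\<close>

lemma root_bound_ge_2: "1 \<le> k \<Longrightarrow> 2 \<le> root_bound k"
  using root_bound[of k] by (cases "root_bound k = 0 \<or> root_bound k = 1") auto

lemma level_ge_1:
  assumes "\<alpha> > 0" "\<alpha> \<le> 1"
  shows "1 \<le> level k \<alpha>"
proof (rule ccontr)
  assume "\<not> 1 \<le> level k \<alpha>"
  then have "level k \<alpha> = 0" by simp
  then show False using level[OF assms(1), of k] assms(2) by simp
qed

lemma deg_bounds:
  assumes "1 \<le> k" "\<alpha> > 0" "\<alpha> \<le> 1"
  shows "1 \<le> deg k \<alpha>" "root_bound k \<le> deg k \<alpha>" "2 * level k \<alpha> \<le> deg k \<alpha>"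
    "walk_length k \<alpha> \<le> deg k \<alpha> * deg k \<alpha>"
proof -
  obtain r l where r: "root_bound k = Suc r" and l: "level k \<alpha> = Suc l"
    using root_bound_ge_2[OF assms(1)] level_ge_1[OF assms(2,3), of k] by (metis Suc_le_D One_nat_def numeral_2_eq_2)
  show "1 \<le> deg k \<alpha>" "root_bound k \<le> deg k \<alpha>" "2 * level k \<alpha> \<le> deg k \<alpha>"
    by (simp_all add: deg_def r l)
  have "walk_length k \<alpha> * 1 \<le> walk_length k \<alpha> * (4 * level k \<alpha>)"
    by (rule mult_le_mono2) (simp add: l)
  also have "\<dots> = deg k \<alpha> * deg k \<alpha>"
    by (simp add: deg_def walk_length_def)
  finally show "walk_length k \<alpha> \<le> deg k \<alpha> * deg k \<alpha>" by simp
qed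

lemma exp_minus_nat_le: "exp (- real n) \<le> (1 / 2) ^ n"
proof -
  have "exp (- 1 :: real) \<le> 1 / 2"
    using exp_ge_add_one_self[of 1] by (simp add: exp_minus field_simps)
  then have "exp (- 1 :: real) ^ n \<le> (1 / 2) ^ n"
    by (intro power_mono) auto
  then show ?thesis by (simp add: exp_of_nat_mult[symmetric])
qed

lemma real_weight: "real (weight k d) = 2 * (real (k + 1) * 3 ^ d)"
  by (simp add: weight_def algebra_simps)

lemma trial_bias:
  assumes k: "1 \<le> k" and n: "1 \<le> n" and \<alpha>: "\<alpha> > 0" "\<alpha> \<le> 1"
    and e: "\<And>i. i < n \<Longrightarrow> dl_length (e i) = k \<and> dl_wf m (e i)"
    and tabs: "\<And>i. i < n \<Longrightarrow> tabs (int i) = fetch 0 (dl_word (e i))"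
    and d: "d = deg k \<alpha>" and w: "w = walk_length k \<alpha>"
  shows "\<bar>weight k d * expect (trial tabs n k m d w) (trial_value (token_ok y)) -
    (\<Sum>i<n. of_bool (dl_eval (e i) y)) / n\<bar> \<le> \<alpha> / 2"
proof -
  define R L where "R = root_bound k" and "L = level k \<alpha>"
  have R: "R \<ge> 2" "real (k + 1) \<le> real R * real R"
    using root_bound_ge_2[OF k] root_bound[of k] unfolding R_def of_nat_mult[symmetric] of_nat_le_iff by auto
  \<comment> \<open>The parameter \<open>l = 2 / R\<close> is \<open>d / w\<close>; the exponent is
    \<open>2 * L - 4 * L\<close>.\<close>
  have "exp (real w * (2 / real R)\<^sup>2 / 2 - 2 / real R * real d) \<le> exp (- real L)"
    using R(1) by (simp add: w d walk_length_def deg_def R_def[symmetric] L_def[symmetric] power2_eq_square)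
  moreover have "exp (- real w / real (k + 1)) \<le> exp (- real L)"
  proof -
    have "real L * real (k + 1) \<le> real L * (real R * real R)"
      using R(2) by (intro mult_left_mono) auto
    then show ?thesis by (simp add: w walk_length_def R_def[symmetric] L_def[symmetric] field_simps)
  qed
  ultimately have "exp (- real w / real (k + 1)) + 2 * exp (real w * (2 / real R)\<^sup>2 / 2 - 2 / real R * real d) \<le> 3 * exp (- real L)"
    by linarith
  also have "exp (- real L) \<le> (1 / 2) ^ L"
    by (rule exp_minus_nat_le)
  \<comment> \<open>The three errors per conjunction then add up to 3 \<alpha> / 8 after
    multiplication by \<open>k + 1\<close>.\<close>
  also have "(1 / 2) ^ L \<le> \<alpha> / (8 * real (k + 1))"
    using level[OF \<alpha>(1), of k] by (simp add: L_def field_simps)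
  finally have "real (k + 1) * (exp (- real w / real (k + 1)) + 2 * exp (real w * (2 / real R)\<^sup>2 / 2 - 2 / real R * real d))
      \<le> real (k + 1) * (3 * (\<alpha> / (8 * real (k + 1))))"
    by (intro mult_left_mono) auto
  also have "\<dots> = 3 * \<alpha> / 8"
    by (simp del: of_nat_add of_nat_Suc)
  also have "\<dots> \<le> \<alpha> / 2" using \<alpha> by simp
  finally have err: "real (k + 1) * (exp (- real w / real (k + 1)) + 2 * exp (real w * (2 / real R)\<^sup>2 / 2 - 2 / real R * real d)) \<le> \<alpha> / 2" .
  define F where "F i = real (k + 1) * 3 ^ d * expect (row_trial (tabs (int i)) k d w) (trial_value (token_ok y))" for i
  have F: "\<bar>F i - of_bool (dl_eval (e i) y)\<bar> \<le> \<alpha> / 2" if "i < n" for i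
    using row_trial_approx[of "e i" k m "2 / real R" d w y] e[OF that] R(1) err
    unfolding F_def tabs[OF that] by simp
  have "weight k d * expect (trial tabs n k m d w) (trial_value (token_ok y)) = (\<Sum>i<n. F i) / n"
  proof -
    define c where "c = real (k + 1) * 3 ^ d"
    show ?thesis
      using n by (simp add: expectation_trial F_def real_weight c_def[symmetric] sum_distrib_left[symmetric])
  qed
  then have "weight k d * expect (trial tabs n k m d w) (trial_value (token_ok y)) - (\<Sum>i<n. of_bool (dl_eval (e i) y)) / n =
      (\<Sum>i<n. F i - of_bool (dl_eval (e i) y)) / n"
    by (simp add: sum_subtractf diff_divide_distrib)
  also have "\<bar>\<dots>\<bar> \<le> (\<Sum>i<n. \<alpha> / 2) / n"
    unfolding abs_divide abs_of_nat by (intro divide_right_mono order_trans[OF sum_abs] sum_mono) (use F in auto)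
  also have "\<dots> = \<alpha> / 2" using n by simp
  finally show ?thesis .
qed

text \<open>The trial mean may deviate by \<alpha> / 2 divided by the weight W. With L the level,
  \<open>64 * (k + 1)^2 \<le> \<alpha>^2 * 4 ^ L \<le> \<alpha>^2 * 3 ^ d\<close>, because
  \<open>4 ^ L \<le> 3 ^ (2 * L)\<close> and \<open>2 * L \<le> d\<close>. Since
  \<open>8 * W^2 = 32 * (k + 1)^2 * 9 ^ d\<close>, the factor \<open>27 ^ d\<close> is
  enough.\<close>

lemma num_trials_suffice:
  assumes k: "1 \<le> k" and \<alpha>: "\<alpha> > 0" "\<alpha> \<le> 1" and d: "d = deg k \<alpha>"
  shows "m + 5 \<le> real (num_trials m d) * (\<alpha> / (2 * real (weight k d)))\<^sup>2 / 2"
proof -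
  define L where "L = level k \<alpha>"
  have "(8 * (real k + 1))\<^sup>2 \<le> (\<alpha> * 2 ^ L)\<^sup>2"
    using level[OF \<alpha>(1), of k] by (intro power_mono) (auto simp: L_def)
  also have "\<dots> = \<alpha>\<^sup>2 * 4 ^ L"
    by (simp add: power2_eq_square mult_ac flip: power_mult_distrib)
  also have "(4 :: real) ^ L \<le> 9 ^ L" by (intro power_mono) auto
  also have "(9 :: real) ^ L = 3 ^ (2 * L)" by (simp add: power_mult)
  also have "(3 :: real) ^ (2 * L) \<le> 3 ^ d"
    using deg_bounds(3)[OF k \<alpha>] by (intro power_increasing) (auto simp: d L_def)
  finally have 1: "64 * (real k + 1)\<^sup>2 \<le> \<alpha>\<^sup>2 * 3 ^ d"
    using \<alpha> unfolding power_mult_distrib by simp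
  have W: "8 * (real (weight k d))\<^sup>2 = 32 * (real k + 1)\<^sup>2 * 9 ^ d"
  proof -
    have "((3 :: real) ^ d)\<^sup>2 = 9 ^ d"
      by (simp add: power2_eq_square flip: power_mult_distrib)
    then show ?thesis unfolding real_weight power_mult_distrib by (simp add: add.commute)
  qed
  have "8 * (real (weight k d))\<^sup>2 \<le> 64 * (real k + 1)\<^sup>2 * 9 ^ d"
    unfolding W by (intro mult_right_mono) auto
  also have "\<dots> \<le> \<alpha>\<^sup>2 * 3 ^ d * 9 ^ d"
    using 1 by (intro mult_right_mono) auto
  also have "\<dots> = \<alpha>\<^sup>2 * 27 ^ d"
    by (simp add: power_mult_distrib[symmetric])
  finally have 2: "8 * (real (weight k d))\<^sup>2 \<le> \<alpha>\<^sup>2 * 27 ^ d" .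
  have "real (weight k d) > 0" by (simp add: weight_def add_pos_nonneg)
  then have "(real m + 5) * (8 * (real (weight k d))\<^sup>2) / (8 * (real (weight k d))\<^sup>2) \<le>
      (real m + 5) * (\<alpha>\<^sup>2 * 27 ^ d) / (8 * (real (weight k d))\<^sup>2)"
    using 2 by (intro divide_right_mono mult_left_mono) auto
  moreover have "(real m + 5) * (\<alpha>\<^sup>2 * 27 ^ d) / (8 * (real (weight k d))\<^sup>2) =
      real (num_trials m d) * (\<alpha> / (2 * real (weight k d)))\<^sup>2 / 2"
    by (simp add: num_trials_def power_divide power_mult_distrib mult_ac)
  moreover have "(real m + 5) * (8 * (real (weight k d))\<^sup>2) / (8 * (real (weight k d))\<^sup>2) = real m + 5"
    using \<open>real (weight k d) > 0\<close> by simp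
  ultimately show ?thesis by simp
qed

lemma cube_card: "finite (cube m)" "card (cube m) = 2 ^ m"
  using finite_lists_length_eq[of "UNIV :: bool set" m] card_lists_length_eq[of "UNIV :: bool set" m]
  by (simp_all add: cube_def)

lemma sample_accurate:
  assumes k: "1 \<le> k" and n: "1 \<le> n" and \<alpha>: "\<alpha> > 0" "\<alpha> \<le> 1"
    and e: "\<And>i. i < n \<Longrightarrow> dl_length (e i) = k \<and> dl_wf m (e i)"
    and tabs: "\<And>i. i < n \<Longrightarrow> tabs (int i) = fetch 0 (dl_word (e i))"
    and d: "d = deg k \<alpha>" and w: "w = walk_length k \<alpha>" and N: "N = num_trials m d"
  shows "measure_pmf.prob (sample N (trial tabs n k m d w))
    {l. \<forall>y\<in>cube m. \<bar>weight k d * sum_list (map (trial_value (token_ok y)) l) / N -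
       (\<Sum>i<n. of_bool (dl_eval (e i) y)) / n\<bar> \<le> \<alpha>} \<ge> 9 / 10"
proof -
  let ?p = "trial tabs n k m d w" and ?Y = "\<lambda>y. trial_value (token_ok y)"
  define W where "W = real (weight k d)"
  define b where "b = \<alpha> / (2 * W)"
  have W: "W > 0" by (simp add: W_def weight_def add_pos_nonneg)
  have b: "b > 0" using W \<alpha> by (simp add: b_def)
  have N0: "N > 0" by (simp add: N num_trials_def)
  have valid: "row_valid (tabs (int i)) k m" if "i < n" for i
    using row_valid_dl_word[of m "e i" k] e[OF that] tabs[OF that] by simp
  have bnd: "\<bar>?Y y z\<bar> \<le> 1" if "z \<in> set_pmf ?p" for y z
    using set_trial[of n tabs k m d w] valid n that by (intro trial_value_bound[of z m d]) auto
  have "exp (- (real N * b\<^sup>2) / 2) \<le> exp (- real (m + 5))"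
    using num_trials_suffice[OF k \<alpha> d, of m] by (simp add: N b_def W_def)
  also have "\<dots> \<le> (1 / 2) ^ (m + 5)"
    by (rule exp_minus_nat_le)
  finally have "real (card (cube m)) * (2 * exp (- (real N * b\<^sup>2) / 2)) \<le> 2 ^ m * (2 * (1 / 2) ^ (m + 5))"
    unfolding cube_card by simp
  \<comment> \<open>The 5 in \<open>m + 5\<close> brings the union bound below the permitted
    1/10.\<close>
  also have "\<dots> = 1 / 16" by (simp add: power_add field_simps)
  finally have fail: "real (card (cube m)) * (2 * exp (- (real N * b\<^sup>2) / 2)) \<le> 1 / 10" by simp
  have "9 / 10 \<le> 1 - real (card (cube m)) * (2 * exp (- (real N * b\<^sup>2) / 2))"
    using fail by simp
  also have "\<dots> \<le> measure_pmf.prob (sample N ?p) {l. \<forall>y\<in>cube m. \<bar>sum_list (map (?Y y) l) - N * expect ?p (?Y y)\<bar> \<le> N * b}"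
    by (rule sample_mean_uniform[OF _ _ b cube_card(1)]) (use bnd in auto)
  also have "\<dots> \<le> measure_pmf.prob (sample N ?p)
    {l. \<forall>y\<in>cube m. \<bar>W * sum_list (map (?Y y) l) / N - (\<Sum>i<n. of_bool (dl_eval (e i) y)) / n\<bar> \<le> \<alpha>}"
  proof (rule measure_pmf.finite_measure_mono)
    have "\<bar>W * S / N - q\<bar> \<le> \<alpha>"
      if "\<bar>S - N * \<mu>\<bar> \<le> N * b" "\<bar>W * \<mu> - q\<bar> \<le> \<alpha> / 2" for S \<mu> q :: real
    proof -
      have "\<bar>W * S / N - W * \<mu>\<bar> = W / N * \<bar>S - N * \<mu>\<bar>"
      proof -
        have "W * S / N - W * \<mu> = W / N * (S - N * \<mu>)" using N0 by (simp add: field_simps)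
        then show ?thesis using W N0 by (simp add: abs_mult)
      qed
      also have "\<dots> \<le> W / N * (N * b)"
        using that(1) W by (intro mult_left_mono) auto
      also have "\<dots> = \<alpha> / 2" using W N0 by (simp add: b_def)
      finally have "\<bar>W * S / N - W * \<mu>\<bar> \<le> \<alpha> / 2" .
      from add_mono[OF this that(2)] show ?thesis
        using abs_triangle_ineq[of "W * S / N - W * \<mu>" "W * \<mu> - q"] by simp
    qed
    moreover have "\<bar>W * expect ?p (?Y y) - (\<Sum>i<n. of_bool (dl_eval (e i) y)) / n\<bar> \<le> \<alpha> / 2" for y
      unfolding W_def by (rule trial_bias) (use assms in auto)
    ultimately show "{l. \<forall>y\<in>cube m. \<bar>sum_list (map (?Y y) l) - N * expect ?p (?Y y)\<bar> \<le> N * b} \<subseteq>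
      {l. \<forall>y\<in>cube m. \<bar>W * sum_list (map (?Y y) l) / N - (\<Sum>i<n. of_bool (dl_eval (e i) y)) / n\<bar> \<le> \<alpha>}"
      by blast
  qed simp
  finally show ?thesis by (simp add: W_def)
qed

text \<open>By \<open>1 + u \<le> exp u\<close> the factors of the \<open>N\<close> trials combine
  to \<open>exp (N * u)\<close>, and \<open>N * u\<close> is the privacy bound divided by
  \<open>n\<close>.\<close>

lemma sample_private:
  assumes n: "1 \<le> n" and valid: "\<And>i. i < n \<Longrightarrow> row_valid (tabs (int i)) k m"
    and eq: "\<And>i. i < n \<Longrightarrow> i \<noteq> i0 \<Longrightarrow> tabs (int i) = tabs' (int i)"
    and N: "N = num_trials m d" and P: "real (privacy_bound m d) \<le> \<epsilon> * real n"
  shows "dominated (exp \<epsilon>) (sample N (trial tabs n k m d w)) (sample N (trial tabs' n k m d w))"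
proof -
  let ?u = "3 * real (2 * m + 1) ^ d / real n"
  have "dominated ((1 + ?u) ^ N) (sample N (trial tabs n k m d w)) (sample N (trial tabs' n k m d w))"
    by (rule sample_dominated, rule trial_dominated[where ?i0.0 = i0]) (use n valid eq in auto)
  moreover have "(1 + ?u) ^ N \<le> exp \<epsilon>"
  proof -
    have "(1 + ?u) ^ N \<le> exp ?u ^ N"
      using exp_ge_add_one_self[of ?u] by (intro power_mono) (auto intro: add_nonneg_nonneg)
    also have "\<dots> = exp (real (privacy_bound m d) / real n)"
      by (simp add: exp_of_nat_mult[symmetric] N num_trials_def privacy_bound_def mult_ac)
    also have "\<dots> \<le> exp \<epsilon>" using P n by (simp add: field_simps)
    finally show ?thesis .
  qed
  ultimately show ?thesis
    unfolding dominated_def by (meson mult_right_mono order_trans pmf_nonneg)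
qed

text \<open>The root is at most \<open>3 * sqrt k\<close>, and the level is of order log k + log (1
  / \<alpha>). Since \<open>ln (1 / \<alpha>) \<ge> ln 2 \<ge> 1 / 2\<close>, additive constants are
  absorbed and \<open>sqrt k \<le> 2 * g\<close>, so log k is bounded in terms of
  \<open>ln (1 + g)\<close>. The constant is \<open>2 * 3 * 20\<close>.\<close>

lemma deg_bound:
  assumes k: "1 \<le> k" and \<alpha>: "0 < \<alpha>" "2 * \<alpha> < 1"
  defines "g \<equiv> sqrt (real k) * ln (1 / \<alpha>)"
  shows "real (deg k \<alpha>) \<le> 120 * (g * (1 + ln (1 + g)))"
proof -
  define R L where "R = root_bound k" and "L = level k \<alpha>"
  define lam where "lam = ln (1 / \<alpha>)"
  have ln2: "1 / 2 \<le> ln (2 :: real)" "ln (2 :: real) \<le> 1"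
    using ln_le_minus_one[of 2] ln_le_minus_one[of "1 / 2"] by (simp_all add: ln_div)
  have lam: "ln 2 \<le> lam" unfolding lam_def using \<alpha> by (simp add: field_simps)
  have k1: "1 \<le> sqrt (real k)" using k by simp
  have g: "sqrt (real k) / 2 \<le> g" "0 \<le> g"
  proof -
    have "sqrt (real k) * (1 / 2) \<le> sqrt (real k) * lam"
      using lam ln2 by (intro mult_left_mono) auto
    then show "sqrt (real k) / 2 \<le> g" by (simp add: g_def lam_def)
    then show "0 \<le> g" using k1 by linarith
  qed
  have R: "real R \<le> 3 * sqrt (real k)"
  proof -
    obtain r where r: "R = Suc r" using root_bound_ge_2[OF k] by (cases R) (auto simp: R_def)
    then have "r * r < k + 1" using below_root_bound[of r k] by (simp add: R_def)
    then have "r * r \<le> k" by simp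
    then have "(real r)\<^sup>2 \<le> real k" unfolding power2_eq_square of_nat_mult[symmetric] of_nat_le_iff .
    then have "real r \<le> sqrt (real k)" by (rule real_le_rsqrt)
    then show ?thesis unfolding r of_nat_Suc using k1 by linarith
  qed
  have lnk: "ln (real k) \<le> 2 + 2 * ln (1 + g)"
  proof -
    have "sqrt (real k) \<le> 2 * (1 + g)" using g by simp
    then have "ln (sqrt (real k)) \<le> ln (2 * (1 + g))" using k g by (subst ln_le_cancel_iff) auto
    moreover have "ln (2 * (1 + g)) = ln 2 + ln (1 + g)"
      using g by (subst ln_mult) auto
    moreover have "ln (sqrt (real k)) = ln (real k) / 2"
      using k by (subst ln_sqrt) auto
    ultimately have "ln (real k) / 2 \<le> ln 2 + ln (1 + g)" by simp
    then show ?thesis using ln2 by linarith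
  qed
  have l0: "0 \<le> ln (1 + g)" using g by simp
  have L: "real L \<le> 20 * lam * (1 + ln (1 + g))"
  proof -
    obtain l where l: "L = Suc l"
      using level_ge_1[of \<alpha> k] \<alpha> by (cases L) (auto simp: L_def)
    then have "\<alpha> * 2 ^ l < 8 * (real k + 1)" using below_level[of l k \<alpha>] by (simp add: L_def)
    also have "\<dots> \<le> 2 ^ 4 * real k" using k by simp
    finally have "2 ^ l < 2 ^ 4 * real k * (1 / \<alpha>)" using \<alpha> by (simp add: field_simps)
    then have "ln (2 ^ l) < ln (2 ^ 4 * real k * (1 / \<alpha>))" using \<alpha> k by (subst ln_less_cancel_iff) auto
    also have "\<dots> = ln (2 ^ 4) + ln (real k) + lam"
      unfolding lam_def using k \<alpha> by (subst ln_mult, simp, simp, subst ln_mult) auto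
    finally have "real l * ln 2 < 4 * ln 2 + ln (real k) + lam"
      by (simp only: ln_realpow of_nat_numeral)
    moreover have "real l * (1 / 2) \<le> real l * ln 2" using ln2 by (intro mult_left_mono) auto
    ultimately have "real l / 2 \<le> 5 * lam + (2 + 2 * ln (1 + g))" using lam lnk by linarith
    moreover have "1 * (2 + 2 * ln (1 + g)) \<le> 2 * lam * (2 + 2 * ln (1 + g))"
      using lam ln2 l0 by (intro mult_right_mono) auto
    ultimately have "real L \<le> 1 + 10 * lam + 4 * lam * (2 + 2 * ln (1 + g))" using l by simp
    also have "\<dots> \<le> 20 * lam + 8 * lam * ln (1 + g)" using lam ln2 by (simp add: algebra_simps)
    also have "\<dots> \<le> 20 * lam + 20 * lam * ln (1 + g)"
      using lam ln2 l0 by (intro add_left_mono mult_right_mono) auto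
    finally show ?thesis by (simp add: algebra_simps)
  qed
  have "real (deg k \<alpha>) = 2 * (real R * real L)" by (simp add: deg_def R_def L_def)
  also have "\<dots> \<le> 2 * ((3 * sqrt (real k)) * (20 * lam * (1 + ln (1 + g))))"
    using R L by (intro mult_left_mono mult_mono) auto
  also have "\<dots> = 120 * (g * (1 + ln (1 + g)))" by (simp add: g_def lam_def)
  finally show ?thesis .
qed

text \<open>The bound vanishes at \<alpha> = 1, so near it a positive exponent such as a multiple of
  the degree is not soft-O of it. The value 0 is sound there because the programs then run in
  constant time.\<close>

definition exponent :: "nat \<Rightarrow> nat \<times> real \<Rightarrow> real" where
  "exponent c = (\<lambda>(k, \<alpha>). if 1 \<le> 2 * \<alpha> then 0 else real (c * deg k \<alpha>))"

lemma exponent_soft_O: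
  "exponent c \<in> soft_O {(k, \<alpha>). 1 \<le> k \<and> 0 < \<alpha> \<and> \<alpha> \<le> 1} (\<lambda>(k, \<alpha>). sqrt (real k) * ln (1 / \<alpha>))"
  unfolding soft_O_def
proof (intro CollectI exI ballI)
  fix p :: "nat \<times> real" assume "p \<in> {(k, \<alpha>). 1 \<le> k \<and> 0 < \<alpha> \<and> \<alpha> \<le> 1}"
  then obtain k \<alpha> where p: "p = (k, \<alpha>)" "1 \<le> k" "0 < \<alpha>" "\<alpha> \<le> 1" by auto
  let ?g = "sqrt (real k) * ln (1 / \<alpha>)"
  have g: "\<bar>?g\<bar> = ?g" "0 \<le> ?g" using p by simp_all
  show "\<bar>exponent c p\<bar> \<le> (real c * 120) * (\<bar>case p of (k, \<alpha>) \<Rightarrow> sqrt (real k) * ln (1 / \<alpha>)\<bar> *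
      (1 + ln (1 + \<bar>case p of (k, \<alpha>) \<Rightarrow> sqrt (real k) * ln (1 / \<alpha>)\<bar>)) ^ 1)"
  proof (cases "1 \<le> 2 * \<alpha>")
    case True
    then show ?thesis using g by (auto simp: exponent_def p(1) intro!: mult_nonneg_nonneg add_nonneg_nonneg)
  next
    case False
    have "real c * real (deg k \<alpha>) \<le> real c * (120 * (?g * (1 + ln (1 + ?g))))"
      using deg_bound[OF p(2,3)] False by (intro mult_left_mono) auto
    then show ?thesis unfolding p(1) prod.case g(1) using False by (simp add: exponent_def mult.assoc)
  qed
qed

text \<open>The base \<open>M \<ge> 2\<close> absorbs constants: \<open>m + 5\<close> and
  \<open>2 * m + 1\<close> are at most \<open>4 * M \<le> M ^ 3\<close>, and
  \<open>27 \<le> 32 \<le> M ^ 5\<close>. The exponents are \<open>8 = 3 + 5\<close> and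
  \<open>13 = 2 + 8 + 3\<close>.\<close>

lemma power_bounds:
  fixes M m d :: nat
  assumes M: "2 \<le> M" "m \<le> M" and d: "1 \<le> d"
  shows "d \<le> M ^ d" "m \<le> M ^ d" "num_trials m d \<le> M ^ (8 * d)" "privacy_bound m d \<le> M ^ (13 * d)"
proof -
  have "d < 2 ^ d" by (rule less_exp)
  also have "2 ^ d \<le> M ^ d" using M by (intro power_mono) auto
  finally show "d \<le> M ^ d" by simp
  have M_pow: "M ^ a \<le> M ^ b" if "a \<le> b" for a b using M that by (intro power_increasing) auto
  show "m \<le> M ^ d" using M M_pow[of 1 d] d by simp
  have "m + 5 \<le> 4 * M" using M by simp
  also have "4 * M \<le> M * M * M" using M by (intro mult_right_mono mult_mono[of 2 M 2 M, simplified]) auto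
  also have "\<dots> = M ^ 3" by (simp add: power3_eq_cube)
  also have "\<dots> \<le> M ^ (3 * d)" using d by (intro M_pow) simp
  finally have m5: "m + 5 \<le> M ^ (3 * d)" .
  have "(27 :: nat) ^ d \<le> (M ^ 5) ^ d"
    using power_mono[of 2 M 5] M by (intro power_mono) auto
  then have p27: "(27 :: nat) ^ d \<le> M ^ (5 * d)" by (simp add: power_mult)
  have "num_trials m d \<le> M ^ (3 * d) * M ^ (5 * d)"
    unfolding num_trials_def using m5 p27 by (rule mult_mono) auto
  then show N: "num_trials m d \<le> M ^ (8 * d)" by (simp flip: power_add)
  have "2 * m + 1 \<le> 4 * M" using M by simp
  also have "4 * M \<le> M * M * M" using M by (intro mult_right_mono mult_mono[of 2 M 2 M, simplified]) auto
  also have "\<dots> = M ^ 3" by (simp add: power3_eq_cube)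
  finally have "(2 * m + 1) ^ d \<le> (M ^ 3) ^ d" by (intro power_mono) auto
  then have m1: "(2 * m + 1) ^ d \<le> M ^ (3 * d)" by (simp add: power_mult)
  have "4 \<le> M ^ 2" using power_mono[of 2 M 2] M by simp
  moreover have "M ^ 2 \<le> M ^ (2 * d)" using d by (intro M_pow) simp
  ultimately have "3 \<le> M ^ (2 * d)" by linarith
  then have "3 * (num_trials m d * (2 * m + 1) ^ d) \<le> M ^ (2 * d) * (M ^ (8 * d) * M ^ (3 * d))"
    using N m1 by (intro mult_mono) auto
  moreover have "privacy_bound m d = 3 * (num_trials m d * (2 * m + 1) ^ d)"
    by (simp add: privacy_bound_def num_trials_def algebra_simps)
  moreover have "M ^ (2 * d) * (M ^ (8 * d) * M ^ (3 * d)) = M ^ (13 * d)"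
    by (simp flip: power_add)
  ultimately show "privacy_bound m d \<le> M ^ (13 * d)" by simp
qed

lemma time_bounds:
  fixes M m d N R L w z :: nat
  assumes M: "2 \<le> M" "m \<le> M" and d: "1 \<le> d" "R \<le> d" "2 * L \<le> d" "w \<le> d * d"
    and N: "N = num_trials m d" and z: "z \<le> 2 + N * (d + 1)"
  shows "4 * R + 6 * L + d * (8 * m + 18) + N * (6 * w + 20 * d + 53) + 40 \<le> 160 * M ^ (10 * d)"
    "6 * m + 20 * z + 30 \<le> 160 * M ^ (10 * d)"
proof -
  note b = power_bounds[OF M d(1)]
  have M_pow: "M ^ a \<le> M ^ b" if "a \<le> b" for a b using M that by (intro power_increasing) auto
  define X where "X = M ^ d"
  have X: "1 \<le> X" using M by (simp add: X_def)
  have pow: "M ^ (c * d) = X ^ c" for c by (simp add: X_def mult.commute flip: power_mult)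
  have X_pow: "X ^ a \<le> X ^ b" if "a \<le> b" for a b using X that by (intro power_increasing) auto
  have dX: "d \<le> X" "m \<le> X" "N \<le> X ^ 8" using b N unfolding pow by (simp_all add: X_def)
  have 1: "R \<le> X ^ 10" "L \<le> X ^ 10" "m \<le> X ^ 10" "1 \<le> X ^ 10"
    using X_pow[of 1 10] d dX X_pow[of 0 10] by simp_all
  have "d * (8 * m + 18) \<le> X * (8 * X + 18 * X)" using dX X by (intro mult_mono add_mono) auto
  also have "\<dots> = 26 * X ^ 2" by (simp add: power2_eq_square)
  also have "\<dots> \<le> 26 * X ^ 10" using X_pow[of 2 10] by simp
  finally have 2: "d * (8 * m + 18) \<le> 26 * X ^ 10" .
  have dd: "d * d \<le> X ^ 2" using dX by (simp add: power2_eq_square mult_mono)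
  have "6 * w + 20 * d + 53 \<le> 6 * X ^ 2 + 20 * X ^ 2 + 53 * X ^ 2"
    using d(4) dd dX X_pow[of 1 2] X_pow[of 0 2] by simp
  then have "N * (6 * w + 20 * d + 53) \<le> X ^ 8 * (79 * X ^ 2)" using dX by (intro mult_mono) auto
  also have "\<dots> = 79 * X ^ 10" by (simp flip: power_add)
  finally have 3: "N * (6 * w + 20 * d + 53) \<le> 79 * X ^ 10" .
  \<comment> \<open>The coefficients of \<open>X ^ 10\<close> add up to
    \<open>4 + 6 + 26 + 79 + 40 = 155\<close>.\<close>
  show "4 * R + 6 * L + d * (8 * m + 18) + N * (6 * w + 20 * d + 53) + 40 \<le> 160 * M ^ (10 * d)"
    unfolding pow using 1 2 3 by simp
  have "N * (d + 1) \<le> X ^ 8 * (X ^ 2 + X ^ 2)"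
    using dX X_pow[of 1 2] X_pow[of 0 2] by (intro mult_mono add_mono) auto
  also have "\<dots> = 2 * X ^ 10" by (simp flip: power_add mult_2)
  finally show "6 * m + 20 * z + 30 \<le> 160 * M ^ (10 * d)"
    unfolding pow using z 1 by simp
qed

section \<open>The theorem\<close>

lemma sanitizer_run:
  fixes k m n :: nat and \<alpha> \<epsilon> :: real and D :: "(bool list \<Rightarrow> bool) list" and enc
  assumes \<alpha>: "\<alpha> > 0"
  defines "I \<equiv> sanitizer_input k m n \<alpha> \<epsilon> enc D"
  defines "d \<equiv> deg k \<alpha>" and "w \<equiv> walk_length k \<alpha>"
  defines "N \<equiv> num_trials m d"
  shows "halts_in san_com I (if 1 \<le> 2 * \<alpha> then 2
      else 4 * root_bound k + 6 * level k \<alpha> + d * (8 * m + 18) + N * (6 * w + 20 * d + 53) + 40)"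
    and "ram_output san_com I = (if 1 \<le> 2 * \<alpha> then return_pmf []
      else if real (privacy_bound m d) \<le> \<epsilon> * real n
      then map_pmf (\<lambda>l. [int (weight k d), int N] @ concat l)
        (sample N (trial (\<lambda>i. fetch 0 (fetch [] (table I) i)) n k m d w))
      else return_pmf [])"
proof -
  have "int_pars I = [int k, int m, int n]" "real_pars I = [\<alpha>, \<epsilon>]"
    by (simp_all add: I_def sanitizer_input_def)
  note impl = implements_san_com[OF this \<alpha>, of d w N, unfolded d_def w_def N_def, OF refl refl refl]
  note run = implements_program[where g = "\<lambda>v. v", OF impl]
  show "halts_in san_com I (if 1 \<le> 2 * \<alpha> then 2
      else 4 * root_bound k + 6 * level k \<alpha> + d * (8 * m + 18) + N * (6 * w + 20 * d + 53) + 40)"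
    unfolding d_def w_def N_def by (rule run(1))
  show "ram_output san_com I = (if 1 \<le> 2 * \<alpha> then return_pmf []
      else if real (privacy_bound m d) \<le> \<epsilon> * real n
      then map_pmf (\<lambda>l. [int (weight k d), int N] @ concat l)
        (sample N (trial (\<lambda>i. fetch 0 (fetch [] (table I) i)) n k m d w))
      else return_pmf [])"
    unfolding d_def w_def N_def using run(2) by (simp only: map_pmf_ident)
qed

lemma evaluator_run:
  fixes k m n :: nat and \<alpha> \<epsilon> :: real
  assumes y: "y \<in> cube m" and Z: "set (drop 2 Z) \<subseteq> {-3..-1} \<union> {1..2 * int m + 1}"
  defines "I \<equiv> evaluator_input k m n \<alpha> \<epsilon> Z y"
  shows "halts_in ev_com I (if 1 \<le> 2 * \<alpha> then 4 else 6 * m + 20 * length Z + 30)"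
    and "ram_answer ev_com I = (if 1 \<le> 2 * \<alpha> then 1 / 2
      else real_of_int (fst (foldl (ev_step (fetch 0 Z 0) y) (0, fetch 0 Z 0) (drop 2 Z))) / real_of_int (fetch 0 Z 1))"
proof -
  let ?zs = "if 1 \<le> 2 * \<alpha> then [1, 2]
    else [fst (foldl (ev_step (fetch 0 Z 0) y) (0, fetch 0 Z 0) (drop 2 Z)), fetch 0 Z 1]"
  have I: "int_pars I = [int k, int m, int n]" "real_pars I = [\<alpha>, \<epsilon>]" "table I = [Z, map of_bool y]"
    by (simp_all add: I_def evaluator_input_def)
  have "length y = m" using y by (simp add: cube_def)
  note run = implements_program[where g = "\<lambda>_. ?zs", OF implements_ev_com[OF I this Z]]
  show "halts_in ev_com I (if 1 \<le> 2 * \<alpha> then 4 else 6 * m + 20 * length Z + 30)"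
    by (rule run(1))
  have "ram_output ev_com I = return_pmf ?zs"
    using run(2) by (simp only: map_return_pmf)
  then show "ram_answer ev_com I = (if 1 \<le> 2 * \<alpha> then 1 / 2
      else real_of_int (fst (foldl (ev_step (fetch 0 Z 0) y) (0, fetch 0 Z 0) (drop 2 Z))) / real_of_int (fetch 0 Z 1))"
    by (simp add: ram_answer_def fetch_def)
qed

lemma trial_range_concat:
  assumes "set l \<subseteq> trial_range m d"
  shows "set (concat l) \<subseteq> {-3..-1} \<union> {1..2 * int m + 1}" "length (concat l) = length l * (d + 1)"
  using assms by (induction l) (auto simp: trial_range_def)

lemma evaluator_answer:
  assumes "y \<in> cube m" "set l \<subseteq> trial_range m d" "\<not> 1 \<le> 2 * \<alpha>"
  shows "ram_answer ev_com (evaluator_input k m n \<alpha> \<epsilon> ([int W, int N] @ concat l) y) =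
    real W * sum_list (map (trial_value (token_ok y)) l) / real N"
  using evaluator_run(2)[OF assms(1), of "[int W, int N] @ concat l"] trial_range_concat(1)[OF assms(2)]
    foldl_ev_step_concat[OF assms(2), of "int W" y 0] assms(3)
  by (simp add: fetch_def)

lemma query_bounds: "0 \<le> query y D" "query y D \<le> 1"
proof -
  show "0 \<le> query y D" by (simp add: query_def sum_nonneg)
  have "(\<Sum>i<length D. of_bool ((D ! i) y)) \<le> (\<Sum>i<length D. 1 :: real)"
    by (intro sum_mono) simp
  then show "query y D \<le> 1" by (simp add: query_def divide_le_eq_1)
qed

lemma adjacentE:
  assumes "adjacent D D'"
  obtains i0 where "\<And>i. i < length D \<Longrightarrow> i \<noteq> i0 \<Longrightarrow> D ! i = D' ! i"
proof -
  from assms obtain i0 where "{i. i < length D \<and> D ! i \<noteq> D' ! i} = {i0}"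
    unfolding adjacent_def by (auto simp: card_1_singleton_iff)
  then show ?thesis using that by blast
qed

section \<open>Privacy, running time and accuracy for fixed parameters\<close>

context
  fixes k m n :: nat and \<alpha> \<epsilon> :: real and enc :: "(bool list \<Rightarrow> bool) \<Rightarrow> decision_list"
  assumes km: "1 \<le> k" "k \<le> m" "1 \<le> n" and \<alpha>: "0 < \<alpha>" "\<alpha> \<le> 1" and \<epsilon>: "\<epsilon> > 1 / real n"
    and enc: "dl_encoding k m enc"
begin

abbreviation (input) "san_pmf \<equiv> \<lambda>D. ram_output san_com (sanitizer_input k m n \<alpha> \<epsilon> enc D)"
abbreviation (input) "db_rows \<equiv> \<lambda>D i. fetch 0 (fetch [] (table (sanitizer_input k m n \<alpha> \<epsilon> enc D)) i)"
abbreviation (input) "dbs \<equiv> databases (DL k m) n"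

lemma database_row:
  assumes "D \<in> dbs" "i < n"
  shows "dl_length (enc (D ! i)) = k \<and> dl_wf m (enc (D ! i))" "db_rows D (int i) = fetch 0 (dl_word (enc (D ! i)))"
    "y \<in> cube m \<Longrightarrow> (D ! i) y = dl_eval (enc (D ! i)) y"
proof -
  have D: "length D = n" "D ! i \<in> DL k m"
    using assms by (auto simp: databases_def)
  then have e: "dl_length (enc (D ! i)) = k \<and> dl_wf m (enc (D ! i)) \<and> dl_fun m (enc (D ! i)) = D ! i"
    using enc by (simp add: dl_encoding_def)
  then show "dl_length (enc (D ! i)) = k \<and> dl_wf m (enc (D ! i))" by simp
  show "db_rows D (int i) = fetch 0 (dl_word (enc (D ! i)))"
    using D assms(2) by (simp add: sanitizer_input_def fetch_int)
  show "(D ! i) y = dl_eval (enc (D ! i)) y" if "y \<in> cube m"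
    using e that unfolding dl_fun_def by (metis restrict_apply')
qed

lemma database_valid: "D \<in> dbs \<Longrightarrow> i < n \<Longrightarrow> row_valid (db_rows D (int i)) k m"
  using database_row(1,2)[of D i] row_valid_dl_word by simp

lemma sanitizer_private: "diff_private \<epsilon> dbs san_pmf"
  unfolding diff_private_def
proof (intro ballI impI allI)
  fix D D' S assume D: "D \<in> dbs" and D': "D' \<in> dbs" and adj: "adjacent D D'"
  obtain i0 where i0: "\<And>i. i < length D \<Longrightarrow> i \<noteq> i0 \<Longrightarrow> D ! i = D' ! i"
    using adj by (rule adjacentE) blast
  have len: "length D = n" using D by (simp add: databases_def)
  have "0 < 1 / real n" using km by simp
  then have "0 < \<epsilon>" using \<epsilon> by linarith
  then have "1 \<le> exp \<epsilon>" by simp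
  then have "dominated (exp \<epsilon>) (san_pmf D) (san_pmf D')"
    unfolding sanitizer_run(2)[OF \<alpha>(1)]
  \<comment> \<open>The case distinctions agree for \<open>D\<close> and \<open>D'\<close>. The
    constant outputs dominate themselves, and the header is postprocessing, so only the samples
    remain.\<close>
  proof (auto intro: dominated_refl, intro dominated_map, goal_cases)
    case 1
    show ?case
    proof (rule sample_private[OF km(3), where ?i0.0 = i0])
      show "db_rows D (int i) = db_rows D' (int i)" if "i < n" "i \<noteq> i0" for i
        using database_row(2)[OF D that(1)] database_row(2)[OF D' that(1)] i0[of i] that len by simp
    qed (use database_valid[OF D] 1 in auto)
  qed auto
  then show "measure_pmf.prob (san_pmf D) S \<le> exp \<epsilon> * measure_pmf.prob (san_pmf D') S"
    by (rule dominated_prob) simp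
qed

text \<open>The evaluator's time bound concerns every possible summary, including those where
  accuracy fails, so shape and length are needed on the whole support.\<close>

lemma sanitizer_output_cases:
  assumes "D \<in> dbs" "Z \<in> set_pmf (san_pmf D)"
  shows "Z = [] \<or> (\<exists>l. Z = [int (weight k (deg k \<alpha>)), int (num_trials m (deg k \<alpha>))] @ concat l \<and>
    length l = num_trials m (deg k \<alpha>) \<and> set l \<subseteq> trial_range m (deg k \<alpha>) \<and> \<not> 1 \<le> 2 * \<alpha>)"
proof -
  have "length l = num_trials m (deg k \<alpha>) \<and> set l \<subseteq> trial_range m (deg k \<alpha>)"
    if "l \<in> set_pmf (sample (num_trials m (deg k \<alpha>)) (trial (db_rows D) n k m (deg k \<alpha>) (walk_length k \<alpha>)))" for l
    using set_sample[OF that] set_trial[of n "db_rows D" k m] database_valid[OF assms(1)] km(3) by blast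
  then show ?thesis
    using assms(2) unfolding sanitizer_run(2)[OF \<alpha>(1)] by (auto split: if_splits) blast
qed

lemma run_times:
  assumes D: "D \<in> dbs"
  defines "T \<equiv> 160 * real (max 2 m) powr exponent 10 (k, \<alpha>)"
  shows "runs_within san_com (sanitizer_input k m n \<alpha> \<epsilon> enc D) T"
    and "Z \<in> set_pmf (san_pmf D) \<Longrightarrow> y \<in> cube m \<Longrightarrow> runs_within ev_com (evaluator_input k m n \<alpha> \<epsilon> Z y) T"
proof -
  let ?d = "deg k \<alpha>" and ?N = "num_trials m (deg k \<alpha>)" and ?M = "max 2 m"
  have T1: "T = 160" if "1 \<le> 2 * \<alpha>" using that by (simp add: T_def exponent_def)
  have T2: "T = real (160 * ?M ^ (10 * ?d))" if "\<not> 1 \<le> 2 * \<alpha>"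
    using that powr_realpow[of "real ?M" "10 * ?d"] by (simp add: T_def exponent_def)
  note tb = time_bounds[of ?M m ?d "root_bound k" "level k \<alpha>" "walk_length k \<alpha>" ?N,
      OF _ _ deg_bounds[OF km(1) \<alpha>] refl]
  show "runs_within san_com (sanitizer_input k m n \<alpha> \<epsilon> enc D) T"
    unfolding runs_within_def
  proof (intro exI conjI)
    show "halts_in san_com (sanitizer_input k m n \<alpha> \<epsilon> enc D) (if 1 \<le> 2 * \<alpha> then 2
      else 4 * root_bound k + 6 * level k \<alpha> + ?d * (8 * m + 18) + ?N * (6 * walk_length k \<alpha> + 20 * ?d + 53) + 40)"
      by (rule sanitizer_run(1)[OF \<alpha>(1)])
    show "real (if 1 \<le> 2 * \<alpha> then 2
      else 4 * root_bound k + 6 * level k \<alpha> + ?d * (8 * m + 18) + ?N * (6 * walk_length k \<alpha> + 20 * ?d + 53) + 40) \<le> T"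
    proof (cases "1 \<le> 2 * \<alpha>")
      case False
      have "4 * root_bound k + 6 * level k \<alpha> + ?d * (8 * m + 18) + ?N * (6 * walk_length k \<alpha> + 20 * ?d + 53) + 40
          \<le> 160 * ?M ^ (10 * ?d)"
        by (rule tb(1)[of 0]) auto
      then show ?thesis unfolding T2[OF False] using False by (simp only: if_False of_nat_le_iff)
    qed (use T1 in simp)
  qed
  show "runs_within ev_com (evaluator_input k m n \<alpha> \<epsilon> Z y) T" if Z: "Z \<in> set_pmf (san_pmf D)" and y: "y \<in> cube m"
  proof -
    have tok: "set (drop 2 Z) \<subseteq> {-3..-1} \<union> {1..2 * int m + 1}" and len: "length Z \<le> 2 + ?N * (?d + 1)"
      unfolding atomize_conj using sanitizer_output_cases[OF D Z]
    proof (elim disjE exE conjE)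
      fix l assume l: "Z = [int (weight k ?d), int ?N] @ concat l" "length l = ?N" "set l \<subseteq> trial_range m ?d"
      show "set (drop 2 Z) \<subseteq> {-3..-1} \<union> {1..2 * int m + 1} \<and> length Z \<le> 2 + ?N * (?d + 1)"
        using trial_range_concat[OF l(3)] l(1,2) by (simp del: set_concat)
    qed simp
    show ?thesis
      unfolding runs_within_def
    proof (intro exI conjI)
      show "halts_in ev_com (evaluator_input k m n \<alpha> \<epsilon> Z y) (if 1 \<le> 2 * \<alpha> then 4 else 6 * m + 20 * length Z + 30)"
        by (rule evaluator_run(1)[OF y tok])
      show "real (if 1 \<le> 2 * \<alpha> then 4 else 6 * m + 20 * length Z + 30) \<le> T"
      proof (cases "1 \<le> 2 * \<alpha>")
        case False
        have "6 * m + 20 * length Z + 30 \<le> 160 * ?M ^ (10 * ?d)"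
          by (rule tb(2)[OF _ _ len]) auto
        then show ?thesis unfolding T2[OF False] using False by (simp only: if_False of_nat_le_iff)
      qed (use T1 in simp)
    qed
  qed
qed

lemma sanitizer_accurate:
  assumes D: "D \<in> dbs" and n: "real n \<ge> real (max 2 m) powr exponent 13 (k, \<alpha>) / \<epsilon>"
  shows "measure_pmf.prob (san_pmf D)
    {Z. \<forall>y\<in>cube m. \<bar>ram_answer ev_com (evaluator_input k m n \<alpha> \<epsilon> Z y) - query y D\<bar> \<le> \<alpha>} \<ge> 9 / 10"
proof (cases "1 \<le> 2 * \<alpha>")
  case True
  \<comment> \<open>The answer 1/2 is within 1/2 \<le> \<alpha> of any value in [0, 1].\<close>
  have "\<bar>ram_answer ev_com (evaluator_input k m n \<alpha> \<epsilon> [] y) - query y D\<bar> \<le> \<alpha>" if "y \<in> cube m" for y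
    using evaluator_run(2)[OF that, of "[]"] query_bounds[of y D] True by simp
  then show ?thesis
    unfolding sanitizer_run(2)[OF \<alpha>(1)] using True by simp
next
  case False
  let ?d = "deg k \<alpha>" and ?N = "num_trials m (deg k \<alpha>)" and ?W = "weight k (deg k \<alpha>)" and ?M = "max 2 m"
  let ?G = "{Z. \<forall>y\<in>cube m. \<bar>ram_answer ev_com (evaluator_input k m n \<alpha> \<epsilon> Z y) - query y D\<bar> \<le> \<alpha>}"
  define p where "p = sample ?N (trial (db_rows D) n k m ?d (walk_length k \<alpha>))"
  have "0 < 1 / real n" using km by simp
  then have \<epsilon>0: "0 < \<epsilon>" using \<epsilon> by linarith
  \<comment> \<open>The size hypothesis is what makes the privacy test succeed, so that the samples
    are published.\<close>
  have "real (privacy_bound m ?d) \<le> real (?M ^ (13 * ?d))"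
    using power_bounds(4)[of ?M m ?d] deg_bounds(1)[OF km(1) \<alpha>] by (simp only: of_nat_le_iff)
  also have "\<dots> = real ?M powr exponent 13 (k, \<alpha>)"
    using False powr_realpow[of "real ?M" "13 * ?d"] by (simp add: exponent_def)
  also have "\<dots> \<le> \<epsilon> * real n"
    using n \<epsilon>0 by (simp add: field_simps)
  finally have out_eq: "san_pmf D = map_pmf (\<lambda>l. [int ?W, int ?N] @ concat l) p"
    unfolding sanitizer_run(2)[OF \<alpha>(1)] p_def using False by simp
  have len: "length D = n" using D by (simp add: databases_def)
  have query: "query y D = (\<Sum>i<n. of_bool (dl_eval (enc (D ! i)) y)) / n" if "y \<in> cube m" for y
    unfolding query_def len using database_row(3)[OF D _ that] by simp
  let ?H = "{l. \<forall>y\<in>cube m. \<bar>?W * sum_list (map (trial_value (token_ok y)) l) / ?N -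
       (\<Sum>i<n. of_bool (dl_eval (enc (D ! i)) y)) / n\<bar> \<le> \<alpha>}"
  have "9 / 10 \<le> measure_pmf.prob p ?H"
    unfolding p_def
    by (rule sample_accurate[where e = "\<lambda>i. enc (D ! i)", OF km(1,3) \<alpha>]) (use database_row(1,2)[OF D] in auto)
  also have "\<dots> = measure_pmf.prob p (?H \<inter> set_pmf p)"
    by (rule measure_Int_set_pmf[symmetric])
  also have "\<dots> \<le> measure_pmf.prob p ((\<lambda>l. [int ?W, int ?N] @ concat l) -` ?G)"
  proof (rule measure_pmf.finite_measure_mono)
    have "set l \<subseteq> trial_range m ?d" if "l \<in> set_pmf p" for l
      using set_sample(2)[OF that[unfolded p_def]] set_trial[of n "db_rows D" k m ?d] database_valid[OF D] km(3) by blast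
    then show "?H \<inter> set_pmf p \<subseteq> (\<lambda>l. [int ?W, int ?N] @ concat l) -` ?G"
      using evaluator_answer[OF _ _ False, where W = ?W and N = ?N and d = ?d] query by auto
  qed simp
  also have "\<dots> = measure_pmf.prob (san_pmf D) ?G"
    unfolding out_eq by (rule measure_map_pmf[symmetric])
  finally show ?thesis .
qed

end

theorem theorem3:
  shows "\<exists>(san :: com) (ev :: com) (C :: real) (e_time :: nat \<times> real \<Rightarrow> real) (e_size :: nat \<times> real \<Rightarrow> real).
    draw_free ev \<and>
    e_time \<in> soft_O {(k, \<alpha>). 1 \<le> k \<and> 0 < \<alpha> \<and> \<alpha> \<le> 1} (\<lambda>(k, \<alpha>). sqrt (real k) * ln (1 / \<alpha>)) \<and>
    e_size \<in> soft_O {(k, \<alpha>). 1 \<le> k \<and> 0 < \<alpha> \<and> \<alpha> \<le> 1} (\<lambda>(k, \<alpha>). sqrt (real k) * ln (1 / \<alpha>)) \<and>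
    (\<forall>(k :: nat) (m :: nat) (n :: nat) (\<alpha> :: real) (\<epsilon> :: real) enc.
       1 \<le> k \<and> k \<le> m \<and> 1 \<le> n \<and> 0 < \<alpha> \<and> \<alpha> \<le> 1 \<and> \<epsilon> > 1 / real n \<and> dl_encoding k m enc \<longrightarrow>
       (let A = (\<lambda>D. ram_output san (sanitizer_input k m n \<alpha> \<epsilon> enc D));
            E = (\<lambda>Z y. ram_answer ev (evaluator_input k m n \<alpha> \<epsilon> Z y));
            T = C * real (max 2 m) powr e_time (k, \<alpha>)
        in diff_private \<epsilon> (databases (DL k m) n) A \<and>
           (\<forall>D\<in>databases (DL k m) n.
              runs_within san (sanitizer_input k m n \<alpha> \<epsilon> enc D) T \<and>
              (\<forall>Z\<in>set_pmf (A D). \<forall>y\<in>cube m.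
                 runs_within ev (evaluator_input k m n \<alpha> \<epsilon> Z y) T) \<and>
              (real n \<ge> real (max 2 m) powr e_size (k, \<alpha>) / \<epsilon> \<longrightarrow>
                 measure_pmf.prob (A D) {Z. \<forall>y\<in>cube m. \<bar>E Z y - query y D\<bar> \<le> \<alpha>} \<ge> 9 / 10))))"
  \<comment> \<open>With \<open>X = M ^ d\<close> there are at most \<open>X ^ 8\<close> trials of
    cost O(\<open>X ^ 2\<close>), hence \<open>exponent 10\<close>; \<open>exponent 13\<close> is
    the bound on \<open>privacy_bound\<close>.\<close>
  unfolding Let_def
  by (intro exI[of _ san_com] exI[of _ ev_com] exI[of _ 160] exI[of _ "exponent 10"] exI[of _ "exponent 13"]
      conjI allI impI ballI draw_free_ev_com exponent_soft_O; elim conjE)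
     (rule sanitizer_private run_times sanitizer_accurate; assumption)+

end
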